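(* Let $p$ be a prime, $P$ a nontrivial finite $p$-group, and $\mathcal F$ a saturated fusion system on $P$. Then $\mathcal F$ is generated by $C_{\mathcal F}(\mho^1(Z(P)))$ and $N_{\mathcal F}(J(P))$, i.e. $\mathcal F = \langle C_{\mathcal F}(\mho^1(Z(P))),\, N_{\mathcal F}(J(P))\rangle$.
   Context: $\mho^1(A)$ is the subgroup of $A$ generated by all $p$-th powers of elements of $A$. $J(P)$ is the Thompson subgroup: the subgroup generated by all abelian subgroups of $P$ of maximum order. A category on $P$ has as objects the subgroups of $P$, with $\mathrm{Hom}_{\mathcal F}(Q,R)$ a set of injective group homomorphisms $Q\to R$ such that every morphism is an $\mathcal F$-isomorphism followed by an inclusion. A saturated fusion system on $P$ is such a category containing all homomorphisms induced by conjugation by elements of $P$, in which $\mathrm{Aut}_P(P)$ is a Sylow $p$-subgroup of $\mathrm{Aut}_{\mathcal F}(P)$, and such that for every $\mathcal F$-isomorphism $\varphi: Q\to Q'$ with $Q'$ fully $\mathcal F$-normalized (i.e. $|N_P(Q')|\ge |N_P(Q'')|$ for all $Q''$ $\mathcal F$-isomorphic to $Q'$), $\varphi$ extends to an $\mathcal F$-morphism $N_\varphi\to P$, where $N_\varphi=\{x\in N_P(Q): \exists y\in N_P(\varphi(Q))\ \forall z\in Q,\ \varphi(xzx^{-1})=y\varphi(z)y^{-1}\}$. For $W\le P$: $N_{\mathcal F}(W)$ is the category on $N_P(W)$ whose morphisms $R_1\to R_2$ are those $\mathcal F$-morphisms $\varphi$ admitting an extension $\tilde\varphi: WR_1\to WR_2$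 in $\mathcal F$ with $\tilde\varphi(W)=W$; $C_{\mathcal F}(W)$ is the category on $C_P(W)$ whose morphisms $R_1\to R_2$ are those $\mathcal F$-morphisms admitting an extension $\tilde\varphi: WR_1\to WR_2$ in $\mathcal F$ with $\tilde\varphi|_W=\mathrm{id}_W$. The subsystem generated by a collection of such subcategories is the smallest subcategory of $\mathcal F$ (on $P$) containing all their morphisms and closed under composition and restriction of morphisms to subgroups; the claim is that this equals $\mathcal F$. *)

theory Defs
  imports "HOL-Computational_Algebra.Primes" "HOL-Algebra.Coset" "HOL-Algebra.Generated_Groups" "HOL-Library.FuncSet"
begin

definition grp_center :: "('a, 'b) monoid_scheme \<Rightarrow> 'a set" where
  "grp_center P = {z \<in> carrier P. \<forall>x \<in> carrier P. x \<otimes>\<^bsub>P\<^esub> z = z \<otimes>\<^bsub>P\<^esub> x}"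

definition grp_centralizer :: "('a, 'b) monoid_scheme \<Rightarrow> 'a set \<Rightarrow> 'a set" where
  "grp_centralizer P W = {g \<in> carrier P. \<forall>w \<in> W. g \<otimes>\<^bsub>P\<^esub> w = w \<otimes>\<^bsub>P\<^esub> g}"

definition grp_normalizer :: "('a, 'b) monoid_scheme \<Rightarrow> 'a set \<Rightarrow> 'a set" where
  "grp_normalizer P W =
     {g \<in> carrier P. (\<lambda>w. g \<otimes>\<^bsub>P\<^esub> w \<otimes>\<^bsub>P\<^esub> inv\<^bsub>P\<^esub> g) ` W = W}"

definition agemo1 :: "('a, 'b) monoid_scheme \<Rightarrow> nat \<Rightarrow> 'a set \<Rightarrow> 'a set" where
  "agemo1 P p A = generate P {a [^]\<^bsub>P\<^esub> p | a. a \<in> A}"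

definition abelian_subgroup :: "('a, 'b) monoid_scheme \<Rightarrow> 'a set \<Rightarrow> bool" where
  "abelian_subgroup P A \<longleftrightarrow> subgroup A P \<and> (\<forall>a \<in> A. \<forall>b \<in> A. a \<otimes>\<^bsub>P\<^esub> b = b \<otimes>\<^bsub>P\<^esub> a)"

definition thompson :: "('a, 'b) monoid_scheme \<Rightarrow> 'a set" where
  "thompson P = generate P
     (\<Union>{A. abelian_subgroup P A \<and> (\<forall>B. abelian_subgroup P B \<longrightarrow> card B \<le> card A)})"

text \<open>Morphism families. A (candidate) category on P is given by
  Hom :: 'a set => 'a set => ('a => 'a) set; a morphism Q -> R is represented
  by a function that is extensional on Q (value undefined outside Q).\<close>

type_synonym 'a homs = "'a set \<Rightarrow> 'a set \<Rightarrow> ('a \<Rightarrow> 'a) set"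

definition inj_hom :: "('a, 'b) monoid_scheme \<Rightarrow> 'a set \<Rightarrow> 'a set \<Rightarrow> ('a \<Rightarrow> 'a) \<Rightarrow> bool" where
  "inj_hom P Q R \<phi> \<longleftrightarrow> \<phi> \<in> extensional Q \<and> \<phi> ` Q \<subseteq> R \<and> inj_on \<phi> Q \<and>
     (\<forall>x \<in> Q. \<forall>y \<in> Q. \<phi> (x \<otimes>\<^bsub>P\<^esub> y) = \<phi> x \<otimes>\<^bsub>P\<^esub> \<phi> y)"

definition idmap :: "'a set \<Rightarrow> 'a \<Rightarrow> 'a" where
  "idmap Q = (\<lambda>x\<in>Q. x)"

definition conjmap :: "('a, 'b) monoid_scheme \<Rightarrow> 'a \<Rightarrow> 'a set \<Rightarrow> 'a \<Rightarrow> 'a" where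
  "conjmap P g Q = (\<lambda>x\<in>Q. g \<otimes>\<^bsub>P\<^esub> x \<otimes>\<^bsub>P\<^esub> inv\<^bsub>P\<^esub> g)"

definition category_on :: "('a, 'b) monoid_scheme \<Rightarrow> 'a homs \<Rightarrow> bool" where
  "category_on P F \<longleftrightarrow>
     (\<forall>Q R. F Q R \<noteq> {} \<longrightarrow> subgroup Q P \<and> subgroup R P) \<and>
     (\<forall>Q R \<phi>. \<phi> \<in> F Q R \<longrightarrow> inj_hom P Q R \<phi>) \<and>
     (\<forall>Q. subgroup Q P \<longrightarrow> idmap Q \<in> F Q Q) \<and>
     (\<forall>Q R T \<phi> \<psi>. \<phi> \<in> F Q R \<longrightarrow> \<psi> \<in> F R T \<longrightarrow> compose Q \<psi> \<phi> \<in> F Q T) \<and>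
     (\<forall>Q R \<phi>. \<phi> \<in> F Q R \<longrightarrow>
        \<phi> \<in> F Q (\<phi> ` Q) \<and>
        (\<exists>\<psi> \<in> F (\<phi> ` Q) Q. compose Q \<psi> \<phi> = idmap Q \<and> compose (\<phi> ` Q) \<phi> \<psi> = idmap (\<phi> ` Q)) \<and>
        idmap (\<phi> ` Q) \<in> F (\<phi> ` Q) R)"

definition F_iso :: "'a homs \<Rightarrow> 'a set \<Rightarrow> 'a set \<Rightarrow> ('a \<Rightarrow> 'a) \<Rightarrow> bool" where
  "F_iso F Q Q' \<phi> \<longleftrightarrow> \<phi> \<in> F Q Q' \<and> \<phi> ` Q = Q'"

definition fully_normalized :: "('a, 'b) monoid_scheme \<Rightarrow> 'a homs \<Rightarrow> 'a set \<Rightarrow> bool" where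
  "fully_normalized P F Q' \<longleftrightarrow>
     (\<forall>Q'' \<phi>. F_iso F Q'' Q' \<phi> \<longrightarrow> card (grp_normalizer P Q'') \<le> card (grp_normalizer P Q'))"

definition N_phi :: "('a, 'b) monoid_scheme \<Rightarrow> 'a set \<Rightarrow> ('a \<Rightarrow> 'a) \<Rightarrow> 'a set" where
  "N_phi P Q \<phi> = {x \<in> grp_normalizer P Q. \<exists>y \<in> grp_normalizer P (\<phi> ` Q).
      \<forall>z \<in> Q. \<phi> (x \<otimes>\<^bsub>P\<^esub> z \<otimes>\<^bsub>P\<^esub> inv\<^bsub>P\<^esub> x) = y \<otimes>\<^bsub>P\<^esub> \<phi> z \<otimes>\<^bsub>P\<^esub> inv\<^bsub>P\<^esub> y}"

definition Aut_P :: "('a, 'b) monoid_scheme \<Rightarrow> ('a \<Rightarrow> 'a) set" where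
  "Aut_P P = {conjmap P g (carrier P) | g. g \<in> carrier P}"

definition saturated_fusion_system :: "('a, 'b) monoid_scheme \<Rightarrow> nat \<Rightarrow> 'a homs \<Rightarrow> bool" where
  "saturated_fusion_system P p F \<longleftrightarrow>
     category_on P F \<and>
     (\<forall>Q R g. subgroup Q P \<longrightarrow> subgroup R P \<longrightarrow> g \<in> carrier P \<longrightarrow>
        (\<lambda>x. g \<otimes>\<^bsub>P\<^esub> x \<otimes>\<^bsub>P\<^esub> inv\<^bsub>P\<^esub> g) ` Q \<subseteq> R \<longrightarrow> conjmap P g Q \<in> F Q R) \<and>
     (\<exists>a m. card (Aut_P P) = p ^ a \<and> card (F (carrier P) (carrier P)) = p ^ a * m \<and> \<not> p dvd m) \<and>
     (\<forall>Q Q' \<phi>. F_iso F Q Q' \<phi> \<longrightarrow> fully_normalized P F Q' \<longrightarrow>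
        (\<exists>\<psi> \<in> F (N_phi P Q \<phi>) (carrier P). \<forall>z \<in> Q. \<psi> z = \<phi> z))"

definition N_F :: "('a, 'b) monoid_scheme \<Rightarrow> 'a homs \<Rightarrow> 'a set \<Rightarrow> 'a homs" where
  "N_F P F W = (\<lambda>R1 R2. {\<phi> \<in> F R1 R2. subgroup R1 P \<and> subgroup R2 P \<and>
       R1 \<subseteq> grp_normalizer P W \<and> R2 \<subseteq> grp_normalizer P W \<and>
       (\<exists>\<psi> \<in> F (W <#>\<^bsub>P\<^esub> R1) (W <#>\<^bsub>P\<^esub> R2). (\<forall>x \<in> R1. \<psi> x = \<phi> x) \<and> \<psi> ` W = W)})"

definition C_F :: "('a, 'b) monoid_scheme \<Rightarrow> 'a homs \<Rightarrow> 'a set \<Rightarrow> 'a homs" where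
  "C_F P F W = (\<lambda>R1 R2. {\<phi> \<in> F R1 R2. subgroup R1 P \<and> subgroup R2 P \<and>
       R1 \<subseteq> grp_centralizer P W \<and> R2 \<subseteq> grp_centralizer P W \<and>
       (\<exists>\<psi> \<in> F (W <#>\<^bsub>P\<^esub> R1) (W <#>\<^bsub>P\<^esub> R2). (\<forall>x \<in> R1. \<psi> x = \<phi> x) \<and> (\<forall>w \<in> W. \<psi> w = w))})"

definition gen_closed :: "('a, 'b) monoid_scheme \<Rightarrow> 'a homs \<Rightarrow> 'a homs set \<Rightarrow> 'a homs \<Rightarrow> bool" where
  "gen_closed P F Hs G \<longleftrightarrow>
     (\<forall>Q R. G Q R \<subseteq> F Q R) \<and>
     (\<forall>H \<in> Hs. \<forall>Q R. H Q R \<subseteq> G Q R) \<and>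
     (\<forall>Q. subgroup Q P \<longrightarrow> idmap Q \<in> G Q Q) \<and>
     (\<forall>Q R T \<phi> \<psi>. \<phi> \<in> G Q R \<longrightarrow> \<psi> \<in> G R T \<longrightarrow> compose Q \<psi> \<phi> \<in> G Q T) \<and>
     (\<forall>Q R Q' R' \<phi>. \<phi> \<in> G Q R \<longrightarrow> subgroup Q' P \<longrightarrow> subgroup R' P \<longrightarrow> Q' \<subseteq> Q \<longrightarrow>
        \<phi> ` Q' \<subseteq> R' \<longrightarrow> R' \<subseteq> R \<longrightarrow> restrict \<phi> Q' \<in> G Q' R')"

definition generated_subsystem :: "('a, 'b) monoid_scheme \<Rightarrow> 'a homs \<Rightarrow> 'a homs set \<Rightarrow> 'a homs" where
  "generated_subsystem P F Hs = (\<lambda>Q R. \<Inter>{G Q R | G. gen_closed P F Hs G})"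

end

theory Submission
  imports Defs "HOL-Algebra.Group_Action" "HOL-Algebra.Left_Coset" "HOL-Algebra.Sylow"
    "HOL-Algebra.Multiplicative_Group" "HOL-Number_Theory.Cong"
begin

text \<open>By induction on the index, as in Alperin's fusion theorem, it suffices to generate the automorphisms of
  a fully normalized centric subgroup \<open>Q\<close>, all morphisms between larger subgroups being available.
  Let \<open>T\<close> consist of the elements of \<open>N\<^sub>P(Q)\<close> that centralize the \<open>p\<close>-th powers of
  \<open>Z(Q)\<close>. If \<open>T > Q\<close>, a Frattini argument writes each automorphism as one that fixes the
  \<open>p\<close>-th powers of \<open>Z(Q)\<close>, hence those of \<open>Z(P)\<close>, times one that extends to \<open>T\<close>.
  If \<open>T = Q\<close>, Thompson's replacement theorem gives \<open>J(N\<^sub>P(Q)) \<subseteq> Q\<close>: an abelian subgroup of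
  maximal order that acts quadratically on \<open>Z(Q)\<close> would contain an element outside \<open>Q\<close> that
  centralizes the \<open>p\<close>-th powers. Then \<open>J(Q) = J(N\<^sub>P(Q))\<close> has a larger normalizer than \<open>Q\<close>, or
  \<open>N\<^sub>P(Q) = P\<close> and \<open>J(Q) = J(P)\<close>. So the induction also runs over the morphisms that normalize
  a given subgroup, ordered by the order of its normalizer.\<close>

section \<open>Sylow arguments by counting fixed points\<close>

text \<open>The axioms give a Sylow automizer only for \<open>P\<close> itself and extensions only
  onto fully normalized images, while \<open>power_cent W\<close> and \<open>J W\<close> need not be
  fully normalized. So every fully normalized subgroup is shown to have a Sylow automizer; then any
  subgroup can be moved to a fully normalized one by a morphism defined on its whole normalizer.
  Centricity must survive this move, and it does because a morphism defined on the normalizer of a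
  fully normalized \<open>W\<close> maps it onto the normalizer of the image. The p-th powers enter
  through quadratic action: it yields [a^p, z] = [a, z^p] for \<open>z\<close> in Z(W), so an
  element \<open>a\<close> of the acting group with a^p in \<open>W\<close> centralizes the powers,
  though perhaps not Z(W). The powers suffice for generation, since a centric \<open>W\<close>
  contains Z(P) and so Z(P) lies in Z(W).\<close>

lemma (in group_action) p_group_fixed_points:
  assumes p: "Factorial_Ring.prime (p::nat)" and G: "card (carrier G) = p ^ k" and E: "finite E"
  shows "[card E = card {x \<in> E. \<forall>g \<in> carrier G. \<phi> g x = x}] (mod p)"
proof -
  interpret group G
    using group_hom group_hom.axioms(1) by blast
  let ?Fix = "{x \<in> E. \<forall>g \<in> carrier G. \<phi> g x = x}"
  have orb_sub: "orbit G \<phi> x \<subseteq> E" if "x \<in> E" for x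
    using that element_image unfolding orbit_def by blast
  have orb_eq': "orbit G \<phi> x = orbit G \<phi> z" if x: "x \<in> E" and z: "z \<in> orbit G \<phi> x" for x z
  proof -
    have zE: "z \<in> E" using orb_sub x z by blast
    have "x \<in> orbit G \<phi> z" using orbit_sym[OF x zE z] .
    then show ?thesis
      using orbit_trans[OF x zE _ z] orbit_trans[OF zE x] orb_sub[OF x] orb_sub[OF zE] by blast
  qed
  have orb_eq: "orbit G \<phi> x = orbit G \<phi> y" if "x \<in> E" "y \<in> E" "z \<in> orbit G \<phi> x" "z \<in> orbit G \<phi> y" for x y z
    using orb_eq'[OF that(1,3)] orb_eq'[OF that(2,4)] by simp
  have un: "\<Union>(orbits G E \<phi>) = E"
    using orb_sub orbit_refl unfolding orbits_def by blast
  have fin: "finite (orbits G E \<phi>)"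
    by (metis E finite_UnionD un)
  have disj: "pairwise disjnt (orbits G E \<phi>)"
    using orb_eq unfolding pairwise_def disjnt_def orbits_def by blast
  have cE: "card E = (\<Sum>D\<in>orbits G E \<phi>. card D)"
    using card_Union_disjoint[OF disj] un E by (metis Union_upper finite_subset)
  let ?S = "{D \<in> orbits G E \<phi>. card D = 1}"
  \<comment> \<open>The length of an orbit divides the group order \<open>p ^ k\<close>, so an orbit
    that is not a single point contributes 0 modulo \<open>p\<close>.\<close>
  have big: "[card D = 0] (mod p)" if D: "D \<in> orbits G E \<phi>" "card D \<noteq> 1" for D
  proof -
    obtain x where x: "x \<in> E" "D = orbit G \<phi> x" using D(1) by (auto simp: orbits_def)
    have "card D dvd p ^ k"
      using orbit_stabilizer_theorem[OF x(1)] x(2) G unfolding order_def by (metis dvd_triv_left)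
    then obtain i where "card D = p ^ i" using p divides_primepow_nat by blast
    with D(2) have "p dvd card D" by (cases i) auto
    then show ?thesis by (simp add: cong_0_iff)
  qed
  have "(\<Sum>D\<in>orbits G E \<phi>. card D) = (\<Sum>D\<in>orbits G E \<phi> - ?S. card D) + (\<Sum>D\<in>?S. card D)"
    by (rule sum.subset_diff) (use fin in auto)
  moreover have "[(\<Sum>D\<in>orbits G E \<phi> - ?S. card D) = (\<Sum>D\<in>orbits G E \<phi> - ?S. 0)] (mod p)"
    by (rule cong_sum) (use big in auto)
  ultimately have "[card E = card ?S] (mod p)"
    using cE cong_add[of "\<Sum>D\<in>orbits G E \<phi> - ?S. card D" 0 p "card ?S" "card ?S"] by simp
  moreover have bij: "bij_betw (\<lambda>x. {x}) ?Fix ?S"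
  proof (rule bij_betw_imageI)
    show "inj_on (\<lambda>x. {x}) ?Fix" by simp
    show "(\<lambda>x. {x}) ` ?Fix = ?S"
    proof (intro equalityI subsetI)
      fix D assume "D \<in> (\<lambda>x. {x}) ` ?Fix"
      then obtain x where x: "x \<in> ?Fix" "D = {x}" by blast
      then have "orbit G \<phi> x = {x}" using orbit_refl[of x] unfolding orbit_def by auto
      then show "D \<in> ?S" using x unfolding orbits_def by force
    next
      fix D assume D: "D \<in> ?S"
      then obtain x where x: "x \<in> E" "D = orbit G \<phi> x" by (auto simp: orbits_def)
      obtain y where "D = {y}" using D by (auto simp: card_1_singleton_iff)
      then have Dx: "D = {x}" using orbit_refl[OF x(1)] x(2) by simp
      have "x \<in> ?Fix" using x(1) Dx[unfolded x(2)] unfolding orbit_def by blast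
      then show "D \<in> (\<lambda>x. {x}) ` ?Fix" using Dx by blast
    qed
  qed
  ultimately show ?thesis using bij_betw_same_card[OF bij] by simp
qed

\<comment> \<open>\<open><#\<close> is needed for left cosets.\<close>
no_notation (input) subset_mset (infix \<open><#\<close> 50)

section \<open>Left cosets, Sylow conjugation and growing normalizers in finite groups\<close>

context group
begin

lemma l_coset_eq_iff:
  assumes "subgroup A G" "x \<in> carrier G" "y \<in> carrier G"
  shows "x <# A = y <# A \<longleftrightarrow> inv y \<otimes> x \<in> A"
proof
  assume "x <# A = y <# A"
  then have "x \<in> y <# A" using lcos_self assms by blast
  then show "inv y \<otimes> x \<in> A"
    using assms by (metis group_axioms subgroup.lcos_module_imp)
next
  assume "inv y \<otimes> x \<in> A"
  then have "x \<in> y <# A"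
    using assms by (meson group_axioms subgroup.lcos_module_rev)
  then show "x <# A = y <# A"
    using l_repr_independence[OF _ assms(3,1)] by blast
qed

lemma left_mult_action:
  assumes A: "subgroup A G" and B: "subgroup B G"
  shows "group_action (G\<lparr>carrier := B\<rparr>) (lcosets A) (\<lambda>b. \<lambda>X\<in>lcosets A. b <# X)"
proof -
  have cl: "b <# X \<in> lcosets A" if "b \<in> carrier G" "X \<in> lcosets A" for b X
    using that A unfolding LCOSETS_def
    by (auto simp: lcos_m_assoc subgroup.subset intro!: bexI[of _ "b \<otimes> _"])
  have sub: "X \<subseteq> carrier G" if "X \<in> lcosets A" for X
    using that A lcosets_subset_PowG by blast
  have one: "\<one> <# X = X" if "X \<in> lcosets A" for X
    using sub[OF that] lcos_mult_one by blast
  have bij: "bij_betw (\<lambda>X\<in>lcosets A. b <# X) (lcosets A) (lcosets A)" if b: "b \<in> carrier G" for b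
  proof (rule bij_betwI)
    show "(\<lambda>X\<in>lcosets A. b <# X) \<in> lcosets A \<rightarrow> lcosets A"
      using cl[OF b] by auto
    show "(\<lambda>X\<in>lcosets A. inv b <# X) \<in> lcosets A \<rightarrow> lcosets A"
      using cl[OF inv_closed[OF b]] by auto
    show "(\<lambda>X\<in>lcosets A. inv b <# X) ((\<lambda>X\<in>lcosets A. b <# X) X) = X" if "X \<in> lcosets A" for X
      using that cl[OF b that] sub[OF that] one[OF that] b by (simp add: lcos_m_assoc)
    show "(\<lambda>X\<in>lcosets A. b <# X) ((\<lambda>X\<in>lcosets A. inv b <# X) X) = X" if "X \<in> lcosets A" for X
      using that cl[OF inv_closed[OF b] that] sub[OF that] one[OF that] b by (simp add: lcos_m_assoc)
  qed
  have Bc: "b \<in> carrier G" if "b \<in> B" for b using subgroup.mem_carrier[OF B that] .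
  have "(\<lambda>b. \<lambda>X\<in>lcosets A. b <# X) \<in> hom (G\<lparr>carrier := B\<rparr>) (BijGroup (lcosets A))"
  proof (rule homI)
    fix b assume "b \<in> carrier (G\<lparr>carrier := B\<rparr>)"
    then have "b \<in> carrier G" using Bc by simp
    then show "(\<lambda>X\<in>lcosets A. b <# X) \<in> carrier (BijGroup (lcosets A))"
      using bij unfolding BijGroup_def Bij_def by simp
  next
    fix b c assume "b \<in> carrier (G\<lparr>carrier := B\<rparr>)" "c \<in> carrier (G\<lparr>carrier := B\<rparr>)"
    then have bc: "b \<in> carrier G" "c \<in> carrier G" using Bc by auto
    have "(\<lambda>X\<in>lcosets A. (b \<otimes> c) <# X) = compose (lcosets A) (\<lambda>X\<in>lcosets A. b <# X) (\<lambda>X\<in>lcosets A. c <# X)"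
      using bc cl sub by (intro ext) (simp add: compose_def lcos_m_assoc)
    then show "(\<lambda>X\<in>lcosets A. (b \<otimes>\<^bsub>G\<lparr>carrier := B\<rparr>\<^esub> c) <# X) =
        (\<lambda>X\<in>lcosets A. b <# X) \<otimes>\<^bsub>BijGroup (lcosets A)\<^esub> (\<lambda>X\<in>lcosets A. c <# X)"
      using bij bc unfolding BijGroup_def Bij_def by simp
  qed
  then show ?thesis
    unfolding group_action_def group_hom_def group_hom_axioms_def
    using B group_BijGroup subgroup_imp_group by blast
qed

text \<open>\<open>B\<close> acts on the left cosets of \<open>A\<close> by left multiplication, and
  it fixes \<open>h <# A\<close> exactly if conjugation by \<open>inv h\<close> takes
  \<open>B\<close> into \<open>A\<close>.\<close>

lemma coset_fixed_points:
  assumes fin: "finite (carrier G)" and p: "Factorial_Ring.prime p"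
    and A: "subgroup A G" and B: "subgroup B G" and cB: "card B = p ^ k"
  shows "[card (lcosets A) = card {h <# A | h. h \<in> carrier G \<and> (\<forall>b\<in>B. inv h \<otimes> b \<otimes> h \<in> A)}] (mod p)"
proof -
  interpret act: group_action "G\<lparr>carrier := B\<rparr>" "lcosets A" "\<lambda>b. \<lambda>X\<in>lcosets A. b <# X"
    using left_mult_action[OF A B] .
  have Bc: "b \<in> carrier G" if "b \<in> B" for b using subgroup.mem_carrier[OF B that] .
  have finl: "finite (lcosets A)"
    by (meson A fin finite_Pow_iff finite_subset lcosets_subset_PowG)
  have fx: "b <# (h <# A) = h <# A \<longleftrightarrow> inv h \<otimes> b \<otimes> h \<in> A" if "b \<in> B" "h \<in> carrier G" for b h
    using that A Bc[OF that(1)] l_coset_eq_iff[OF A, of "b \<otimes> h" h]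
    by (simp add: lcos_m_assoc subgroup.subset m_assoc)
  have "{x \<in> lcosets A. \<forall>g \<in> B. (\<lambda>X\<in>lcosets A. g <# X) x = x} = {x \<in> lcosets A. \<forall>g \<in> B. g <# x = x}"
    by auto
  also have "\<dots> = {h <# A | h. h \<in> carrier G \<and> (\<forall>b\<in>B. b <# (h <# A) = h <# A)}"
    unfolding LCOSETS_def by blast
  also have "\<dots> = {h <# A | h. h \<in> carrier G \<and> (\<forall>b\<in>B. inv h \<otimes> b \<otimes> h \<in> A)}"
    using fx by blast
  finally have "{x \<in> lcosets A. \<forall>g \<in> B. (\<lambda>X\<in>lcosets A. g <# X) x = x}
      = {h <# A | h. h \<in> carrier G \<and> (\<forall>b\<in>B. inv h \<otimes> b \<otimes> h \<in> A)}" .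
  then show ?thesis
    using act.p_group_fixed_points[OF p _ finl, of k] cB by simp
qed

lemma sylow_conjugate:
  assumes fin: "finite (carrier G)" and p: "Factorial_Ring.prime p"
    and A: "subgroup A G" and B: "subgroup B G" and cB: "card B = p ^ k"
    and ndvd: "\<not> p dvd card (lcosets A)"
  obtains h where "h \<in> carrier G" "\<And>b. b \<in> B \<Longrightarrow> inv h \<otimes> b \<otimes> h \<in> A"
proof -
  have "card {h <# A | h. h \<in> carrier G \<and> (\<forall>b\<in>B. inv h \<otimes> b \<otimes> h \<in> A)} \<noteq> 0"
    using coset_fixed_points[OF fin p A B cB] ndvd by (metis cong_0_iff)
  then have "{h <# A | h. h \<in> carrier G \<and> (\<forall>b\<in>B. inv h \<otimes> b \<otimes> h \<in> A)} \<noteq> {}"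
    by (metis card.empty)
  then show ?thesis using that by blast
qed

text \<open>For \<open>B = A\<close> the fixed cosets are those contained in the normalizer of
  \<open>A\<close>. Their number is divisible by \<open>p\<close>, as is the index of a proper
  subgroup of a p-group, so the trivial coset is not the only one.\<close>

lemma p_group_normalizer_grows:
  assumes fin: "finite (carrier G)" and p: "Factorial_Ring.prime p"
    and A: "subgroup A G" and cG: "card (carrier G) = p ^ k" and ne: "A \<noteq> carrier G"
  obtains h where "h \<in> carrier G" "h \<notin> A" "\<And>a. a \<in> A \<Longrightarrow> h \<otimes> a \<otimes> inv h \<in> A"
proof -
  have lag: "card (lcosets A) * card A = p ^ k"
    using l_lagrange[OF fin A] cG by (simp add: order_def)
  have "card A dvd p ^ k" using lag by (metis dvd_triv_right)
  then obtain j where cA: "card A = p ^ j" using divides_primepow_nat[OF p] by auto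
  have "card (lcosets A) dvd p ^ k" using lag by (metis dvd_triv_left)
  then obtain i where i: "card (lcosets A) = p ^ i" using divides_primepow_nat[OF p] by auto
  have "card (lcosets A) \<noteq> 1"
    using lag cG ne A by (metis card_subset_eq fin mult_1 subgroup.subset)
  then have "p dvd card (lcosets A)" using i by (cases i) auto
  let ?S = "{h <# A | h. h \<in> carrier G \<and> (\<forall>b\<in>A. inv h \<otimes> b \<otimes> h \<in> A)}"
  have dv: "p dvd card ?S"
    using coset_fixed_points[OF fin p A A cA] \<open>p dvd card (lcosets A)\<close> cong_dvd_iff by blast
  have "\<one> <# A \<in> ?S" using A subgroup.mem_carrier[OF A] by fastforce
  have "?S \<noteq> {\<one> <# A}" using dv p by (metis card_1_singleton_iff nat_dvd_1_iff_1 not_prime_1 One_nat_def)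
  then obtain h where h: "h \<in> carrier G" "\<forall>b\<in>A. inv h \<otimes> b \<otimes> h \<in> A" "h <# A \<noteq> \<one> <# A"
    using \<open>\<one> <# A \<in> ?S\<close> by blast
  have "h \<notin> A" using h l_coset_eq_iff[OF A h(1) one_closed] by simp
  then have "inv h \<notin> A" using A h(1) by (metis inv_inv subgroup.m_inv_closed)
  then show ?thesis using that[of "inv h"] h by simp
qed

lemma mult_inv_cancel:
  assumes "x \<in> carrier G" "y \<in> carrier G"
  shows "x \<otimes> (inv x \<otimes> y) = y" "inv x \<otimes> (x \<otimes> y) = y"
  using assms by (simp_all add: m_assoc[symmetric])

lemma set_mult_subgroup:
  assumes V: "subgroup V G" and A: "subgroup A G"
    and AV: "\<And>a v. a \<in> A \<Longrightarrow> v \<in> V \<Longrightarrow> a \<otimes> v \<otimes> inv a \<in> V"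
  shows "subgroup (V <#> A) G"
proof (rule subgroupI)
  have c: "v \<in> carrier G" "a \<in> carrier G" if "v \<in> V" "a \<in> A" for v a
    using subgroup.mem_carrier[OF V that(1)] subgroup.mem_carrier[OF A that(2)] by auto
  then show "V <#> A \<subseteq> carrier G" unfolding set_mult_def by blast
  show "V <#> A \<noteq> {}" using subgroup.one_closed[OF V] subgroup.one_closed[OF A] unfolding set_mult_def by blast
  fix x assume "x \<in> V <#> A"
  then obtain v a where va: "v \<in> V" "a \<in> A" "x = v \<otimes> a" unfolding set_mult_def by blast
  have ia: "inv a \<in> A" using subgroup.m_inv_closed[OF A va(2)] .
  have "inv a \<otimes> inv v \<otimes> inv (inv a) \<in> V"
    using AV[OF ia subgroup.m_inv_closed[OF V va(1)]] .
  moreover have "inv x = (inv a \<otimes> inv v \<otimes> inv (inv a)) \<otimes> inv a"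
    using va c by (simp add: m_assoc inv_mult_group)
  ultimately show "inv x \<in> V <#> A" using ia unfolding set_mult_def by blast
  fix y assume "y \<in> V <#> A"
  then obtain w b where wb: "w \<in> V" "b \<in> A" "y = w \<otimes> b" unfolding set_mult_def by blast
  have "v \<otimes> (a \<otimes> w \<otimes> inv a) \<in> V"
    using AV[OF va(2) wb(1)] va(1) subgroup.m_closed[OF V] by blast
  moreover have "a \<otimes> b \<in> A" using va wb subgroup.m_closed[OF A] by blast
  moreover have "x \<otimes> y = (v \<otimes> (a \<otimes> w \<otimes> inv a)) \<otimes> (a \<otimes> b)"
    using va wb c by (simp add: m_assoc mult_inv_cancel)
  ultimately show "x \<otimes> y \<in> V <#> A" unfolding set_mult_def by blast
qed

lemma sylow_conjugate_normal:
  assumes fin: "finite (carrier G)" and p: "Factorial_Ring.prime p"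
    and A: "subgroup A G" and B: "subgroup B G" and cB: "card B = p ^ k"
    and L: "L \<lhd> G" and BLA: "B \<subseteq> L <#> A"
    and ndvd: "\<not> p dvd card (lcosets A)"
  obtains l where "l \<in> L" "\<And>b. b \<in> B \<Longrightarrow> inv l \<otimes> b \<otimes> l \<in> A"
proof -
  have Ls: "subgroup L G" using L by (rule normal_imp_subgroup)
  let ?H = "L <#> A"
  have H: "subgroup ?H G"
    using L subgroup.mem_carrier[OF A] by (intro set_mult_subgroup[OF Ls A]) (simp add: normal_inv_iff)
  have AH: "A \<subseteq> ?H"
    using subgroup.one_closed[OF Ls] subgroup.mem_carrier[OF A] unfolding set_mult_def by force
  interpret H: group "G\<lparr>carrier := ?H\<rparr>" using subgroup_imp_group[OF H] .
  have finH: "finite ?H" using finite_subset[OF subgroup.subset[OF H] fin] .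
  have AsH: "subgroup A (G\<lparr>carrier := ?H\<rparr>)" using subgroup_incl[OF A H AH] .
  have BsH: "subgroup B (G\<lparr>carrier := ?H\<rparr>)" using subgroup_incl[OF B H BLA] .
  have "card (lcosets A) * card A = order G" using l_lagrange[OF fin A] .
  also have "\<dots> = card (lcosets ?H) * card ?H" using l_lagrange[OF fin H] by simp
  also have "card ?H = card (lcosets\<^bsub>G\<lparr>carrier := ?H\<rparr>\<^esub> A) * card A"
    using H.l_lagrange[OF _ AsH] finH by (simp add: order_def)
  finally have "card (lcosets A) * card A
      = (card (lcosets ?H) * card (lcosets\<^bsub>G\<lparr>carrier := ?H\<rparr>\<^esub> A)) * card A" by (simp only: mult.assoc)
  moreover have "card A > 0" using subgroup.finite_imp_card_positive[OF A fin] .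
  ultimately have "card (lcosets A) = card (lcosets ?H) * card (lcosets\<^bsub>G\<lparr>carrier := ?H\<rparr>\<^esub> A)"
    by (metis mult_right_cancel less_not_refl)
  then have nd: "\<not> p dvd card (lcosets\<^bsub>G\<lparr>carrier := ?H\<rparr>\<^esub> A)" using ndvd dvd_mult by metis
  obtain h where h: "h \<in> ?H" "\<And>b. b \<in> B \<Longrightarrow> inv\<^bsub>G\<lparr>carrier := ?H\<rparr>\<^esub> h \<otimes> b \<otimes> h \<in> A"
    using H.sylow_conjugate[OF _ p AsH BsH cB nd] finH by auto
  have h2: "inv h \<otimes> b \<otimes> h \<in> A" if "b \<in> B" for b
    using h(2)[OF that] m_inv_consistent[OF H h(1)] by simp
  obtain l a where la: "l \<in> L" "a \<in> A" "h = l \<otimes> a" using h(1) unfolding set_mult_def by blast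
  have c: "l \<in> carrier G" "a \<in> carrier G" using subgroup.mem_carrier[OF Ls la(1)] subgroup.mem_carrier[OF A la(2)] by auto
  have "inv l \<otimes> b \<otimes> l \<in> A" if b: "b \<in> B" for b
  proof -
    have bc: "b \<in> carrier G" using subgroup.mem_carrier[OF B b] .
    have "a \<otimes> (inv h \<otimes> b \<otimes> h) \<otimes> inv a \<in> A"
      using h2[OF b] la(2) subgroup.m_closed[OF A] subgroup.m_inv_closed[OF A] by blast
    moreover have "a \<otimes> (inv h \<otimes> b \<otimes> h) \<otimes> inv a = inv l \<otimes> b \<otimes> l"
      using c bc la(3) by (simp add: m_assoc inv_mult_group mult_inv_cancel)
    ultimately show ?thesis by simp
  qed
  then show ?thesis using that la(1) by blast
qed

lemma conj_nat_pow:
  assumes "a \<in> carrier G" "z \<in> carrier G"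
  shows "(a \<otimes> z \<otimes> inv a) [^] (k :: nat) = a \<otimes> z [^] k \<otimes> inv a"
  using assms by (induction k) (simp_all add: m_assoc mult_inv_cancel)

lemma pow_mod_exponent:
  assumes "x \<in> carrier G" "x [^] (N :: nat) = \<one>"
  shows "x [^] k = x [^] (k mod N)"
proof -
  have "x [^] k = x [^] (N * (k div N) + k mod N)" by simp
  also have "\<dots> = (x [^] N) [^] (k div N) \<otimes> x [^] (k mod N)"
    using assms(1) by (simp only: nat_pow_mult nat_pow_pow)
  finally show ?thesis using assms by simp
qed

text \<open>A p-subgroup whose index is divisible by \<open>p\<close> is not Sylow. Moved into a
  Sylow subgroup \<open>S\<close> it is proper there, so its normalizer in \<open>S\<close> is
  larger, and moving back yields a normalizing element of p-power order.\<close>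

lemma normalizing_p_element:
  assumes fin: "finite (carrier G)" and p: "Factorial_Ring.prime p"
    and A: "subgroup A G" and cA: "card A = p ^ j" and dv: "p dvd card (lcosets A)"
  obtains x i where "x \<in> carrier G" "x \<notin> A" "\<And>a. a \<in> A \<Longrightarrow> x \<otimes> a \<otimes> inv x \<in> A"
    "x [^] (p ^ i :: nat) = \<one>"
proof -
  have "order G \<noteq> 0" using fin order_gt_0_iff_finite by simp
  then obtain a m where am: "order G = p ^ a * m" "\<not> p dvd m"
    using prime_power_canonical[OF p, of "order G"] by (metis gr0I mult.commute)
  obtain S where S: "subgroup S G" "card S = p ^ a"
    using sylow_thm[OF p group_axioms am(1) fin] by blast
  have "card (lcosets S) = m"
    using l_lagrange[OF fin S(1)] am(1) S(2) prime_gt_0_nat[OF p] by simp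
  then have nd: "\<not> p dvd card (lcosets S)" using am(2) by simp
  obtain h where h: "h \<in> carrier G" "\<And>b. b \<in> A \<Longrightarrow> inv h \<otimes> b \<otimes> h \<in> S"
    using sylow_conjugate[OF fin p S(1) A cA nd] by blast
  have Ac: "b \<in> carrier G" if "b \<in> A" for b using subgroup.mem_carrier[OF A that] .
  have Sc: "b \<in> carrier G" if "b \<in> S" for b using subgroup.mem_carrier[OF S(1) that] .
  let ?A = "{s \<in> S. h \<otimes> s \<otimes> inv h \<in> A}"
  have Asub: "subgroup ?A G"
  proof (rule subgroupI)
    show "?A \<subseteq> carrier G" using Sc by blast
    show "?A \<noteq> {}" using subgroup.one_closed[OF S(1)] subgroup.one_closed[OF A] h(1) by force
    fix s assume s: "s \<in> ?A"
    have "h \<otimes> inv s \<otimes> inv h = inv (h \<otimes> s \<otimes> inv h)"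
      using h(1) Sc s by (simp add: inv_mult_group m_assoc)
    then show "inv s \<in> ?A" using s subgroup.m_inv_closed[OF S(1)] subgroup.m_inv_closed[OF A] by simp
    fix t assume t: "t \<in> ?A"
    have "h \<otimes> (s \<otimes> t) \<otimes> inv h = (h \<otimes> s \<otimes> inv h) \<otimes> (h \<otimes> t \<otimes> inv h)"
      using h(1) Sc s t by (simp add: m_assoc mult_inv_cancel)
    then show "s \<otimes> t \<in> ?A" using s t subgroup.m_closed[OF S(1)] subgroup.m_closed[OF A] by simp
  qed
  have eA: "(\<lambda>b. inv h \<otimes> b \<otimes> h) ` A = ?A"
  proof (intro equalityI subsetI)
    fix x assume "x \<in> (\<lambda>b. inv h \<otimes> b \<otimes> h) ` A"
    then obtain b where b: "b \<in> A" "x = inv h \<otimes> b \<otimes> h" by blast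
    then have "h \<otimes> x \<otimes> inv h = b" using h(1) Ac[OF b(1)] by (simp add: m_assoc mult_inv_cancel)
    then show "x \<in> ?A" using b h(2)[OF b(1)] by simp
  next
    fix x assume x: "x \<in> ?A"
    have "x = inv h \<otimes> (h \<otimes> x \<otimes> inv h) \<otimes> h" using x h(1) Sc by (simp add: m_assoc mult_inv_cancel)
    then show "x \<in> (\<lambda>b. inv h \<otimes> b \<otimes> h) ` A" using x by blast
  qed
  have cA': "card ?A = card A"
  proof -
    have "inj_on (\<lambda>b. inv h \<otimes> b \<otimes> h) A" using h(1) Ac by (intro inj_onI) simp
    then show ?thesis using card_image eA by metis
  qed
  have "?A \<noteq> S"
  proof
    assume "?A = S"
    then have "card A = p ^ a" using cA' S(2) by simp
    then have "card (lcosets A) = m"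
      using l_lagrange[OF fin A] am(1) prime_gt_0_nat[OF p] by simp
    then show False using dv am(2) by simp
  qed
  moreover have "subgroup ?A (G\<lparr>carrier := S\<rparr>)" by (rule subgroup_incl[OF Asub S(1)]) blast
  ultimately obtain s where s: "s \<in> S" "s \<notin> ?A"
      "\<And>a. a \<in> ?A \<Longrightarrow> s \<otimes> a \<otimes> inv\<^bsub>G\<lparr>carrier := S\<rparr>\<^esub> s \<in> ?A"
    using group.p_group_normalizer_grows[OF subgroup_imp_group[OF S(1)] _ p, of ?A a]
      finite_subset[OF subgroup.subset[OF S(1)] fin] S(2) by auto
  have sn: "s \<otimes> a \<otimes> inv s \<in> ?A" if "a \<in> ?A" for a
    using s(3)[OF that] m_inv_consistent[OF S(1) s(1)] by simp
  define x where "x = h \<otimes> s \<otimes> inv h"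
  have sc: "s \<in> carrier G" using Sc s(1) .
  have xc: "x \<in> carrier G" unfolding x_def using h(1) sc by simp
  have "x \<notin> A" using s unfolding x_def by blast
  moreover have "x \<otimes> b \<otimes> inv x \<in> A" if b: "b \<in> A" for b
  proof -
    have "h \<otimes> (s \<otimes> (inv h \<otimes> b \<otimes> h) \<otimes> inv s) \<otimes> inv h \<in> A" using sn[of "inv h \<otimes> b \<otimes> h"] eA b by blast
    moreover have "h \<otimes> (s \<otimes> (inv h \<otimes> b \<otimes> h) \<otimes> inv s) \<otimes> inv h = x \<otimes> b \<otimes> inv x"
      unfolding x_def using h(1) sc Ac[OF b] by (simp add: m_assoc inv_mult_group)
    ultimately show ?thesis by simp
  qed
  moreover have "x [^] (p ^ a) = \<one>"
  proof -
    have "s [^] (p ^ a) = \<one>"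
      using group.pow_order_eq_1[OF subgroup_imp_group[OF S(1)], of s] s(1) S(2)
      by (simp add: order_def nat_pow_consistent[symmetric])
    then show ?thesis unfolding x_def using conj_nat_pow[OF h(1) sc] h(1) by simp
  qed
  ultimately show ?thesis using that xc by blast
qed

end

section \<open>Finite p-groups and the Thompson subgroup\<close>

locale finite_p_group = group P for P :: "('a, 'b) monoid_scheme" (structure) +
  fixes p n :: nat
  assumes prime_p: "Factorial_Ring.prime p"
    and finite_carrier: "finite (carrier P)"
    and card_carrier: "card (carrier P) = p ^ n"
begin

abbreviation norm :: "'a set \<Rightarrow> 'a set" where "norm \<equiv> grp_normalizer P"
\<comment> \<open>\<open>HOL-Algebra\<close> has another constant \<open>abelian_subgroup\<close>, for additive groups of rings.\<close>
abbreviation abel :: "'a set \<Rightarrow> bool" where "abel \<equiv> Defs.abelian_subgroup P"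
abbreviation cent :: "'a set \<Rightarrow> 'a set" where "cent \<equiv> grp_centralizer P"

definition center_of :: "'a set \<Rightarrow> 'a set" where
  "center_of W = W \<inter> cent W"

text \<open>Z(W) is abelian for a subgroup \<open>W\<close>, so its p-th powers already form the
  subgroup agemo1 of Z(W); the bare set is easier to transport along morphisms.\<close>

definition center_powers :: "'a set \<Rightarrow> 'a set" where
  "center_powers W = (\<lambda>z. z [^] p) ` center_of W"

definition power_cent :: "'a set \<Rightarrow> 'a set" where
  "power_cent W = norm W \<inter> cent (center_powers W)"

text \<open>Formed inside an arbitrary \<open>K\<close>, because the argument compares the Thompson
  subgroups of \<open>W\<close>, of its normalizer and of \<open>P\<close>.\<close>

definition max_abelian :: "'a set \<Rightarrow> 'a set set" where
  "max_abelian K = {A. abel A \<and> A \<subseteq> K \<and>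
     (\<forall>B. abel B \<longrightarrow> B \<subseteq> K \<longrightarrow> card B \<le> card A)}"

definition J :: "'a set \<Rightarrow> 'a set" where
  "J K = generate P (\<Union>(max_abelian K))"

lemma finite_sub: "subgroup Q P \<Longrightarrow> finite Q"
  using finite_carrier finite_subset subgroup.subset by blast

lemma sub_carrier: "subgroup Q P \<Longrightarrow> x \<in> Q \<Longrightarrow> x \<in> carrier P"
  by (rule subgroup.mem_carrier)

lemma sub_subset: "subgroup Q P \<Longrightarrow> Q \<subseteq> carrier P"
  by (rule subgroup.subset)

lemma carrier_sub: "subgroup (carrier P) P"
  by (rule subgroup_self)

lemma sub_conj:
  assumes "subgroup Q P" "x \<in> Q" "y \<in> Q"
  shows "x \<otimes> y \<otimes> inv x \<in> Q"
  using assms by (simp add: subgroup.m_closed subgroup.m_inv_closed)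

lemma conj_eq_iff:
  assumes "x \<in> carrier P" "y \<in> carrier P" "z \<in> carrier P"
  shows "x \<otimes> y \<otimes> inv x = z \<longleftrightarrow> x \<otimes> y = z \<otimes> x"
  using assms by (simp add: inv_solve_right')

lemma sub_pow:
  assumes "subgroup H P" "x \<in> H"
  shows "x [^] (k :: nat) \<in> H"
  using assms by (induction k) (auto simp: subgroup.one_closed subgroup.m_closed)

lemma normI:
  assumes W: "subgroup W P" and g: "g \<in> carrier P" and c: "\<And>w. w \<in> W \<Longrightarrow> g \<otimes> w \<otimes> inv g \<in> W"
  shows "g \<in> norm W"
proof -
  have "inj_on (\<lambda>w. g \<otimes> w \<otimes> inv g) W"
    using g sub_carrier[OF W] by (intro inj_onI) simp
  then have "(\<lambda>w. g \<otimes> w \<otimes> inv g) ` W = W"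
    using c finite_sub[OF W] by (intro endo_inj_surj) auto
  then show ?thesis using g by (simp add: grp_normalizer_def)
qed

lemma normD:
  assumes "g \<in> norm W" "w \<in> W"
  shows "g \<otimes> w \<otimes> inv g \<in> W"
  using assms unfolding grp_normalizer_def by blast

lemma norm_carrier: "g \<in> norm W \<Longrightarrow> g \<in> carrier P"
  by (simp add: grp_normalizer_def)

lemma norm_sub:
  assumes W: "subgroup W P"
  shows "subgroup (norm W) P"
proof (rule subgroupI)
  show "norm W \<subseteq> carrier P" using norm_carrier by blast
  have "\<one> \<in> norm W" by (rule normI[OF W]) (simp_all add: sub_carrier[OF W])
  then show "norm W \<noteq> {}" by blast
next
  fix a assume a: "a \<in> norm W"
  have ac: "a \<in> carrier P" using a norm_carrier by blast
  show "inv a \<in> norm W"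
  proof (rule normI[OF W])
    fix w assume "w \<in> W"
    then obtain v where v: "v \<in> W" "w = a \<otimes> v \<otimes> inv a"
      using a unfolding grp_normalizer_def by blast
    then have "inv a \<otimes> w \<otimes> inv (inv a) = v"
      using ac sub_carrier[OF W v(1)] by (simp add: m_assoc inv_solve_left')
    then show "inv a \<otimes> w \<otimes> inv (inv a) \<in> W" using v by simp
  qed (use ac in simp)
next
  fix a b assume a: "a \<in> norm W" and b: "b \<in> norm W"
  have ac: "a \<in> carrier P" "b \<in> carrier P" using a b norm_carrier by auto
  show "a \<otimes> b \<in> norm W"
  proof (rule normI[OF W])
    fix w assume w: "w \<in> W"
    have "a \<otimes> b \<otimes> w \<otimes> inv (a \<otimes> b) = a \<otimes> (b \<otimes> w \<otimes> inv b) \<otimes> inv a"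
      using ac sub_carrier[OF W w] by (simp add: m_assoc inv_mult_group)
    then show "a \<otimes> b \<otimes> w \<otimes> inv (a \<otimes> b) \<in> W" using normD[OF a normD[OF b w]] by simp
  qed (use ac in simp)
qed

lemma sub_norm: "subgroup W P \<Longrightarrow> W \<subseteq> norm W"
  by (intro subsetI normI) (auto intro: sub_carrier sub_conj)

lemma cent_sub:
  assumes W: "W \<subseteq> carrier P"
  shows "subgroup (cent W) P"
proof (rule subgroupI)
  show "cent W \<subseteq> carrier P" by (auto simp: grp_centralizer_def)
  have "\<one> \<in> cent W" using W by (auto simp: grp_centralizer_def)
  then show "cent W \<noteq> {}" by blast
next
  fix a assume a: "a \<in> cent W"
  have ac: "a \<in> carrier P" using a by (simp add: grp_centralizer_def)
  have "inv a \<otimes> w = w \<otimes> inv a" if w: "w \<in> W" for w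
  proof -
    have wc: "w \<in> carrier P" using w W by blast
    have "inv a \<otimes> (a \<otimes> w) \<otimes> inv a = inv a \<otimes> (w \<otimes> a) \<otimes> inv a"
      using a w by (simp add: grp_centralizer_def)
    then show ?thesis using ac wc by (simp add: m_assoc inv_solve_left')
  qed
  then show "inv a \<in> cent W" using ac by (simp add: grp_centralizer_def)
next
  fix a b assume a: "a \<in> cent W" and b: "b \<in> cent W"
  have ac: "a \<in> carrier P" "b \<in> carrier P" using a b by (auto simp: grp_centralizer_def)
  have "a \<otimes> b \<otimes> w = w \<otimes> (a \<otimes> b)" if w: "w \<in> W" for w
  proof -
    have wc: "w \<in> carrier P" using w W by blast
    have "a \<otimes> b \<otimes> w = a \<otimes> (w \<otimes> b)" using ac wc b w by (simp add: m_assoc grp_centralizer_def)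
    also have "\<dots> = w \<otimes> a \<otimes> b" using ac wc a w by (simp add: m_assoc[symmetric] grp_centralizer_def)
    finally show ?thesis using ac wc by (simp add: m_assoc)
  qed
  then show "a \<otimes> b \<in> cent W" using ac by (simp add: grp_centralizer_def)
qed

lemma cent_comm: "x \<in> cent W \<Longrightarrow> w \<in> W \<Longrightarrow> x \<otimes> w = w \<otimes> x"
  by (simp add: grp_centralizer_def)

lemma cent_mono: "V \<subseteq> W \<Longrightarrow> cent W \<subseteq> cent V"
  by (auto simp: grp_centralizer_def)

lemma cent_norm:
  assumes W: "subgroup W P"
  shows "cent W \<subseteq> norm W"
proof
  fix x assume x: "x \<in> cent W"
  then have xc: "x \<in> carrier P" by (simp add: grp_centralizer_def)
  show "x \<in> norm W"
  proof (rule normI[OF W xc])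
    fix w assume w: "w \<in> W"
    then have "x \<otimes> w \<otimes> inv x = w"
      using cent_comm[OF x w] conj_eq_iff[of x w w] xc sub_carrier[OF W w] by blast
    then show "x \<otimes> w \<otimes> inv x \<in> W" using w by simp
  qed
qed

lemma inter_sub: "subgroup H P \<Longrightarrow> subgroup K P \<Longrightarrow> subgroup (H \<inter> K) P"
  by (rule subgroups_Inter_pair)

lemma center_of_sub: "subgroup W P \<Longrightarrow> subgroup (center_of W) P"
  unfolding center_of_def by (intro inter_sub cent_sub sub_subset)

lemma card_sub:
  assumes "subgroup K P"
  obtains j where "card K = p ^ j"
proof -
  have "card K dvd p ^ n"
    using lagrange[OF assms] card_carrier unfolding order_def by (metis dvd_triv_right)
  then show ?thesis using divides_primepow_nat[OF prime_p] that by auto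
qed

lemma norm_grows:
  assumes H: "subgroup H P" and K: "subgroup K P" and HK: "H \<subseteq> K" and ne: "H \<noteq> K"
  obtains x where "x \<in> K" "x \<notin> H" "x \<in> norm H"
proof -
  obtain j where j: "card K = p ^ j" using card_sub[OF K] .
  have HK': "subgroup H (P\<lparr>carrier := K\<rparr>)"
    using H K HK by (simp add: subgroup_incl)
  obtain x where x: "x \<in> K" "x \<notin> H" "\<And>a. a \<in> H \<Longrightarrow> x \<otimes> a \<otimes> inv\<^bsub>P\<lparr>carrier := K\<rparr>\<^esub> x \<in> H"
    using group.p_group_normalizer_grows[OF subgroup_imp_group[OF K] _ prime_p HK', of j] finite_sub[OF K] j ne
    by auto
  have "x \<in> norm H"
    using x m_inv_consistent[OF K x(1)] by (intro normI[OF H]) (auto intro: sub_carrier[OF K])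
  then show ?thesis using that x by blast
qed

lemma card_sub_lt:
  assumes "subgroup K P" "H \<subseteq> K" "H \<noteq> K"
  shows "card H < card K"
  by (rule psubset_card_mono) (use assms finite_sub in auto)

lemma norm_grows_card:
  assumes H: "subgroup H P" and ne: "H \<noteq> carrier P"
  shows "card H < card (norm H)"
proof -
  obtain x where "x \<notin> H" "x \<in> norm H"
    using norm_grows[OF H carrier_sub sub_subset[OF H] ne] by blast
  then show ?thesis
    using card_sub_lt[OF norm_sub[OF H] sub_norm[OF H]] by blast
qed

text \<open>A commuting set lies in its centralizer and in its double centralizer. Both are
  subgroups, so they contain the generated group, and any two of its elements commute.\<close>

lemma commuting_abelian:
  assumes S: "S \<subseteq> K" and K: "subgroup K P" and comm: "\<And>x y. x \<in> S \<Longrightarrow> y \<in> S \<Longrightarrow> x \<otimes> y = y \<otimes> x"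
  shows "abel (generate P S)" "generate P S \<subseteq> K"
proof -
  have Sc: "S \<subseteq> carrier P" using S sub_subset[OF K] by blast
  show "generate P S \<subseteq> K" using generate_subgroup_incl[OF S K] .
  have 1: "subgroup (cent S) P" using cent_sub[OF Sc] .
  have "S \<subseteq> cent S" using comm Sc by (auto simp: grp_centralizer_def)
  then have 2: "generate P S \<subseteq> cent S" using generate_subgroup_incl 1 by blast
  have "S \<subseteq> cent (cent S)" using Sc by (auto simp: grp_centralizer_def)
  then have 3: "generate P S \<subseteq> cent (cent S)"
    using generate_subgroup_incl cent_sub[OF sub_subset[OF 1]] by blast
  show "abel (generate P S)"
    unfolding Defs.abelian_subgroup_def using generate_is_subgroup[OF Sc] 2 3 cent_comm by blast
qed

lemma max_abelianD:
  assumes "A \<in> max_abelian K"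
  shows "subgroup A P" "A \<subseteq> K" "\<And>x y. x \<in> A \<Longrightarrow> y \<in> A \<Longrightarrow> x \<otimes> y = y \<otimes> x"
    "\<And>B. abel B \<Longrightarrow> B \<subseteq> K \<Longrightarrow> card B \<le> card A"
  using assms unfolding max_abelian_def Defs.abelian_subgroup_def by auto

lemma max_abelian_self_centralizing:
  assumes A: "A \<in> max_abelian K" and K: "subgroup K P" and x: "x \<in> K"
    and comm: "\<And>a. a \<in> A \<Longrightarrow> x \<otimes> a = a \<otimes> x"
  shows "x \<in> A"
proof -
  let ?B = "generate P (insert x A)"
  have S: "insert x A \<subseteq> K" using x max_abelianD(2)[OF A] by blast
  have c: "u \<otimes> v = v \<otimes> u" if "u \<in> insert x A" "v \<in> insert x A" for u v
    using that comm max_abelianD(3)[OF A] by (metis insert_iff)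
  have B: "abel ?B" "?B \<subseteq> K"
    using commuting_abelian[OF S K c] by blast+
  have AB: "insert x A \<subseteq> ?B" by (auto intro: generate.incl)
  have "card ?B \<le> card A" using max_abelianD(4)[OF A B] .
  moreover have "finite ?B" using B finite_sub unfolding Defs.abelian_subgroup_def by blast
  ultimately have "A = ?B" using AB by (intro card_seteq) auto
  then show ?thesis using AB by blast
qed

lemma max_abelian_nonempty:
  assumes K: "subgroup K P"
  obtains A where "A \<in> max_abelian K"
proof -
  let ?Q = "\<lambda>A. abel A \<and> A \<subseteq> K"
  have "?Q {\<one>}" using K unfolding Defs.abelian_subgroup_def
    by (simp add: subgroup.one_closed triv_subgroup)
  moreover have "\<forall>A. ?Q A \<longrightarrow> card A < Suc (card K)"
    using finite_sub[OF K] by (auto simp: card_mono less_Suc_eq_le)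
  ultimately obtain A where "?Q A" "\<forall>B. ?Q B \<longrightarrow> card B \<le> card A"
    using ex_has_greatest_nat[of ?Q "{\<one>}" card "Suc (card K)"] by auto
  then show ?thesis using that unfolding max_abelian_def by blast
qed

lemma max_abelian_J: "A \<in> max_abelian K \<Longrightarrow> A \<subseteq> J K"
  unfolding J_def by (auto intro: generate.incl)

lemma J_sub:
  assumes "subgroup K P"
  shows "subgroup (J K) P" "J K \<subseteq> K"
proof -
  have *: "\<Union>(max_abelian K) \<subseteq> K" unfolding max_abelian_def by blast
  then show "subgroup (J K) P" unfolding J_def using generate_is_subgroup sub_subset[OF assms] by blast
  show "J K \<subseteq> K" unfolding J_def using generate_subgroup_incl[OF * assms] .
qed

lemma J_carrier: "J (carrier P) = thompson P"
proof -
  have *: "A \<subseteq> carrier P" if "abel A" for A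
    using that sub_subset by (simp add: Defs.abelian_subgroup_def)
  have "max_abelian (carrier P) = {A. abel A \<and> (\<forall>B. abel B \<longrightarrow> card B \<le> card A)}"
    unfolding max_abelian_def using * by blast
  then show ?thesis unfolding J_def thompson_def by simp
qed

text \<open>\<open>W\<close> contains every abelian subgroup of maximal order of \<open>K\<close>,
  so the maximal orders in \<open>W\<close> and \<open>K\<close> agree and the same subgroups attain
  them.\<close>

lemma J_eqI:
  assumes K: "subgroup K P" and WK: "W \<subseteq> K" and JW: "J K \<subseteq> W"
  shows "J W = J K"
proof -
  obtain A where A: "A \<in> max_abelian K" using max_abelian_nonempty[OF K] .
  have AW: "A \<subseteq> W" using A JW max_abelian_J by blast
  have "max_abelian W = max_abelian K"
  proof (intro equalityI subsetI)
    fix B assume B: "B \<in> max_abelian K"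
    then have "B \<subseteq> W" using JW max_abelian_J by blast
    then show "B \<in> max_abelian W" using B WK unfolding max_abelian_def by blast
  next
    fix B assume B: "B \<in> max_abelian W"
    then have "card A \<le> card B" using A AW unfolding max_abelian_def by blast
    then show "B \<in> max_abelian K" using A B WK le_trans unfolding max_abelian_def by blast
  qed
  then show ?thesis unfolding J_def by simp
qed

lemma center_of_max_abelian:
  assumes K: "subgroup K P" and A: "A \<in> max_abelian K"
  shows "center_of K \<subseteq> A"
proof
  fix x assume x: "x \<in> center_of K"
  then have xK: "x \<in> K" and c: "\<And>k. k \<in> K \<Longrightarrow> x \<otimes> k = k \<otimes> x" by (auto simp: center_of_def grp_centralizer_def)
  show "x \<in> A"
    using max_abelian_self_centralizing[OF A K xK] c max_abelianD(2)[OF A] by blast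
qed

lemma center_powers_subset:
  assumes W: "subgroup W P"
  shows "center_powers W \<subseteq> center_of W"
  unfolding center_powers_def using center_of_sub[OF W] by (auto intro: sub_pow)

section \<open>Commutators, Thompson replacement and quadratic action\<close>

definition comm :: "'a \<Rightarrow> 'a \<Rightarrow> 'a" where
  "comm x y = x \<otimes> y \<otimes> inv x \<otimes> inv y"

lemma comm_closed: "x \<in> carrier P \<Longrightarrow> y \<in> carrier P \<Longrightarrow> comm x y \<in> carrier P"
  by (simp add: comm_def)

text \<open>For fixed \<open>v\<close> the map from \<open>x\<close> to \<open>comm x v\<close> is a
  crossed homomorphism; the replacement argument rests on this identity.\<close>

lemma comm_mult_left:
  assumes "x \<in> carrier P" "y \<in> carrier P" "v \<in> carrier P"
  shows "comm (x \<otimes> y) v = x \<otimes> comm y v \<otimes> inv x \<otimes> comm x v"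
  using assms by (simp add: comm_def m_assoc inv_mult_group mult_inv_cancel)

lemma comm_mult:
  assumes "x \<in> carrier P" "y \<in> carrier P"
  shows "comm x y \<otimes> y = x \<otimes> y \<otimes> inv x"
  using assms by (simp add: comm_def m_assoc)

text \<open>The element form of Thompson's replacement: \<open>A\<close> is replaced by the subgroup generated by
  \<open>[A, v]\<close> and its centralizer in \<open>A\<close>.\<close>

lemma thompson_replacement:
  assumes K: "subgroup K P" and V: "subgroup V P" "V \<subseteq> K" "K \<subseteq> norm V"
    and Vab: "\<And>x y. x \<in> V \<Longrightarrow> y \<in> V \<Longrightarrow> x \<otimes> y = y \<otimes> x"
    and A: "A \<in> max_abelian K" and v: "v \<in> V" "v \<notin> norm A"
    and vA: "\<And>a. a \<in> A \<Longrightarrow> comm a v \<in> norm A"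
  obtains B where "B \<in> max_abelian K" "B \<subseteq> norm A" "A \<inter> V \<subset> B \<inter> V"
proof -
  note A' = max_abelianD[OF A]
  define f where "f a = comm a v" for a
  have vc: "v \<in> carrier P" using v V sub_carrier by blast
  have Ac: "a \<in> carrier P" if "a \<in> A" for a using sub_carrier[OF A'(1) that] .
  have Vc: "a \<in> carrier P" if "a \<in> V" for a using sub_carrier[OF V(1) that] .
  have conjV: "a \<otimes> u \<otimes> inv a \<in> V" if "a \<in> A" "u \<in> V" for a u
    using that V(3) A'(2) normD by blast
  have fV: "f a \<in> V" if "a \<in> A" for a
    unfolding f_def comm_def using conjV[OF that v(1)] v(1) V(1)
    by (simp add: subgroup.m_closed subgroup.m_inv_closed)
  have fmult: "f (x \<otimes> y) = x \<otimes> f y \<otimes> inv x \<otimes> f x" if "x \<in> A" "y \<in> A" for x y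
    unfolding f_def using comm_mult_left Ac that vc by blast
  \<comment> \<open>The centralizer in \<open>A\<close> of all commutators with \<open>v\<close>;
    together with these commutators it generates the new subgroup.\<close>
  define D where "D = A \<inter> cent (f ` A)"
  have fAc: "f ` A \<subseteq> carrier P" using fV Vc by blast
  have D: "subgroup D P" unfolding D_def by (rule inter_sub[OF A'(1) cent_sub[OF fAc]])
  \<comment> \<open>If \<open>f u\<close> and \<open>f u'\<close> lie in the same coset of
    \<open>D\<close>, so do \<open>u\<close> and \<open>u'\<close>. Hence the cosets of
    \<open>D\<close> in \<open>A\<close> inject into those of \<open>D\<close> in \<open>B\<close>,
    and \<open>B\<close> is at least as large as \<open>A\<close>.\<close>
  have key: "inv u' \<otimes> u \<in> D" if u: "u \<in> A" "u' \<in> A" and c: "inv (f u') \<otimes> f u \<in> D" for u u'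
  proof -
    define w where "w = inv u' \<otimes> u"
    have w: "w \<in> A" unfolding w_def using u A'(1) by (simp add: subgroup.m_closed subgroup.m_inv_closed)
    have uw: "u = u' \<otimes> w" unfolding w_def using u Ac by (simp add: m_assoc[symmetric])
    have wc: "w \<in> carrier P" "u' \<in> carrier P" "f w \<in> carrier P" "f u' \<in> carrier P" "f u \<in> carrier P"
      using w u Ac fV Vc by auto
    have gV: "u' \<otimes> f w \<otimes> inv u' \<in> V" using conjV[OF u(2) fV[OF w]] .
    have "inv (f u') \<otimes> f u = inv (f u') \<otimes> (u' \<otimes> f w \<otimes> inv u' \<otimes> f u')"
      using fmult[OF u(2) w] uw by simp
    also have "\<dots> = inv (f u') \<otimes> (f u' \<otimes> (u' \<otimes> f w \<otimes> inv u'))"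
      using Vab[OF gV fV[OF u(2)]] by simp
    also have "\<dots> = u' \<otimes> f w \<otimes> inv u'" using wc by (simp add: m_assoc[symmetric])
    finally have e: "inv (f u') \<otimes> f u = u' \<otimes> f w \<otimes> inv u'" .
    then have gA: "u' \<otimes> f w \<otimes> inv u' \<in> A" using c unfolding D_def by simp
    have "inv u' \<otimes> (u' \<otimes> f w \<otimes> inv u') \<otimes> inv (inv u') \<in> A"
      using sub_conj[OF A'(1) subgroup.m_inv_closed[OF A'(1) u(2)] gA] .
    moreover have "inv u' \<otimes> (u' \<otimes> f w \<otimes> inv u') \<otimes> inv (inv u') = f w"
      using wc by (simp add: m_assoc inv_solve_left')
    ultimately have fwA: "f w \<in> A" by simp
    have "w \<otimes> f a = f a \<otimes> w" if a: "a \<in> A" for a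
    proof -
      have ac: "a \<in> carrier P" "f a \<in> carrier P" using a Ac fV Vc by auto
      \<comment> \<open>As \<open>w\<close> and \<open>a\<close> commute, the two expansions of
        \<open>f (w \<otimes> a)\<close> agree, and comparing them shows that \<open>w\<close>
        centralizes \<open>f a\<close>.\<close>
      have "w \<otimes> f a \<otimes> inv w \<otimes> f w = f (w \<otimes> a)" using fmult[OF w a] by simp
      also have "\<dots> = f (a \<otimes> w)" using A'(3)[OF w a] by simp
      also have "\<dots> = a \<otimes> f w \<otimes> inv a \<otimes> f a" using fmult[OF a w] by simp
      also have "a \<otimes> f w \<otimes> inv a = f w"
        using conj_eq_iff[of a "f w" "f w"] A'(3)[OF a fwA] ac wc by simp
      also have "f w \<otimes> f a = f a \<otimes> f w" using Vab fV a w by blast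
      finally have "w \<otimes> f a \<otimes> inv w = f a" using ac wc by simp
      then show ?thesis using conj_eq_iff[of w "f a" "f a"] ac wc by simp
    qed
    then show ?thesis unfolding w_def[symmetric] D_def using w wc by (auto simp: grp_centralizer_def)
  qed
  let ?S = "f ` A \<union> D"
  define B where "B = generate P ?S"
  have SK: "?S \<subseteq> K" using fV V(2) A'(2) unfolding D_def by blast
  have Scomm: "x \<otimes> y = y \<otimes> x" if "x \<in> ?S" "y \<in> ?S" for x y
  proof -
    consider "x \<in> f ` A" "y \<in> f ` A" | "x \<in> D" "y \<in> f ` A" | "x \<in> f ` A" "y \<in> D" | "x \<in> D" "y \<in> D"
      using \<open>x \<in> ?S\<close> \<open>y \<in> ?S\<close> by blast
    then show ?thesis
    proof cases
      case 1 then show ?thesis using Vab fV by blast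
    next
      case 2 then show ?thesis unfolding D_def using cent_comm by blast
    next
      case 3 then show ?thesis unfolding D_def using cent_comm[of y "f ` A" x] by simp
    next
      case 4 then show ?thesis unfolding D_def using A'(3) by blast
    qed
  qed
  have B: "abel B" "B \<subseteq> K" unfolding B_def using commuting_abelian[OF SK K Scomm] by blast+
  have Bs: "subgroup B P" using B unfolding Defs.abelian_subgroup_def by blast
  have SB: "?S \<subseteq> B" unfolding B_def by (auto intro: generate.incl)
  have An: "subgroup (norm A) P" using norm_sub[OF A'(1)] .
  have Bn: "B \<subseteq> norm A" unfolding B_def
    by (rule generate_subgroup_incl[OF _ An])
       (use vA sub_norm[OF A'(1)] in \<open>auto simp: f_def D_def\<close>)
  have DA: "D \<subseteq> A" unfolding D_def by blast
  have cardle: "card A \<le> card B"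
  proof -
    let ?A = "P\<lparr>carrier := A\<rparr>" and ?B = "P\<lparr>carrier := B\<rparr>"
    interpret gA: group ?A using subgroup_imp_group[OF A'(1)] .
    interpret gB: group ?B using subgroup_imp_group[OF Bs] .
    have DsA: "subgroup D ?A" by (rule subgroup_incl[OF D A'(1) DA])
    have DsB: "subgroup D ?B" by (rule subgroup_incl[OF D Bs]) (use SB in blast)
    have la: "lcosets\<^bsub>?A\<^esub> D = (\<lambda>u. u <# D) ` A" by (auto simp: LCOSETS_def l_coset_def)
    have lb: "lcosets\<^bsub>?B\<^esub> D = (\<lambda>u. u <# D) ` B" by (auto simp: LCOSETS_def l_coset_def)
    \<comment> \<open>A coset goes to the coset of \<open>f\<close> at a chosen representative; for
      the count the map only has to be injective.\<close>
    define h where "h X = f (SOME u. u \<in> A \<and> X = u <# D) <# D" for X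
    have rep: "(SOME u. u \<in> A \<and> X = u <# D) \<in> A \<and> X = (SOME u. u \<in> A \<and> X = u <# D) <# D"
      if "X \<in> (\<lambda>u. u <# D) ` A" for X
      using that by (intro someI_ex[of "\<lambda>u. u \<in> A \<and> X = u <# D"]) blast
    have "inj_on h ((\<lambda>u. u <# D) ` A)"
    proof (rule inj_onI)
      fix X Y assume X: "X \<in> (\<lambda>u. u <# D) ` A" and Y: "Y \<in> (\<lambda>u. u <# D) ` A" and e: "h X = h Y"
      obtain u where u: "u \<in> A" "X = u <# D" "h X = f u <# D" using rep[OF X] unfolding h_def by blast
      obtain u' where u': "u' \<in> A" "Y = u' <# D" "h Y = f u' <# D" using rep[OF Y] unfolding h_def by blast
      have "inv (f u') \<otimes> f u \<in> D"
        using l_coset_eq_iff[OF D, of "f u" "f u'"] u u' e Vc fV by auto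
      then show "X = Y" using key[OF u(1) u'(1)] l_coset_eq_iff[OF D, of u u'] u u' Ac by auto
    qed
    moreover have "h ` ((\<lambda>u. u <# D) ` A) \<subseteq> (\<lambda>u. u <# D) ` B"
      using rep SB unfolding h_def by blast
    ultimately have "card ((\<lambda>u. u <# D) ` A) \<le> card ((\<lambda>u. u <# D) ` B)"
      using finite_sub[OF Bs] by (meson card_inj_on_le finite_imageI)
    then have le: "card ((\<lambda>u. u <# D) ` A) * card D \<le> card ((\<lambda>u. u <# D) ` B) * card D"
      by (rule mult_le_mono1)
    have "card ((\<lambda>u. u <# D) ` A) * card D = card A" "card ((\<lambda>u. u <# D) ` B) * card D = card B"
      using gA.l_lagrange[OF _ DsA] gB.l_lagrange[OF _ DsB] finite_sub[OF A'(1)] finite_sub[OF Bs] la lb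
      by (simp_all add: order_def)
    then show ?thesis using le by (simp only:)
  qed
  have Bm: "B \<in> max_abelian K"
    using B A'(4) cardle le_trans unfolding max_abelian_def by blast
  have "A \<inter> V \<subseteq> D" unfolding D_def grp_centralizer_def using Vab fV Ac by auto
  then have 1: "A \<inter> V \<subseteq> B \<inter> V" using SB by blast
  \<comment> \<open>A commutator outside \<open>A\<close> makes the inclusion of intersections with
    \<open>V\<close> strict. If all of them lay in \<open>A\<close>, then \<open>v\<close> would
    normalize \<open>A\<close>, because \<open>a \<otimes> f (inv a)\<close> is the conjugate of
    \<open>a\<close> by \<open>v\<close>.\<close>
  have "\<exists>a\<in>A. f a \<notin> A"
  proof (rule ccontr)
    assume "\<not> ?thesis"
    then have fA: "f a \<in> A" if "a \<in> A" for a using that by blast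
    have "v \<in> norm A"
    proof (rule normI[OF A'(1) vc])
      fix a assume a: "a \<in> A"
      have ia: "inv a \<in> A" using subgroup.m_inv_closed[OF A'(1) a] .
      have "a \<otimes> f (inv a) \<in> A" using fA[OF ia] a A'(1) by (simp add: subgroup.m_closed)
      moreover have "inv (a \<otimes> f (inv a)) = v \<otimes> inv a \<otimes> inv v"
        unfolding f_def comm_def using Ac[OF a] vc by (simp add: m_assoc[symmetric] inv_mult_group)
      ultimately have *: "v \<otimes> inv a \<otimes> inv v \<in> A" using subgroup.m_inv_closed[OF A'(1)] by metis
      have "inv (v \<otimes> inv a \<otimes> inv v) = v \<otimes> a \<otimes> inv v" using Ac[OF a] vc
        by (simp add: m_assoc inv_mult_group)
      then show "v \<otimes> a \<otimes> inv v \<in> A" using subgroup.m_inv_closed[OF A'(1) *] by simp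
    qed
    then show False using v by blast
  qed
  then obtain a where "a \<in> A" "f a \<notin> A" by blast
  then have "A \<inter> V \<noteq> B \<inter> V" using fV SB by blast
  then show ?thesis using that[OF Bm Bn] 1 by blast
qed

lemma set_mult_sub:
  assumes "subgroup V P" "subgroup A P" "A \<subseteq> norm V"
  shows "subgroup (V <#> A) P"
  using assms normD by (intro set_mult_subgroup) blast+

text \<open>This supplies the \<open>v\<close> that replacement needs. If \<open>V\<close> does not
  normalize \<open>A\<close>, the normalizer \<open>X\<close> of \<open>A\<close> in
  \<open>V <#> A\<close> is proper there, so some element outside \<open>X\<close> normalizes
  \<open>X\<close>; dropping its factor in \<open>A\<close> leaves \<open>v\<close>. Since
  \<open>A\<close> lies in \<open>X\<close>, the commutators of \<open>A\<close> with
  \<open>v\<close> stay in \<open>X\<close>.\<close>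

lemma max_abelian_normalized:
  assumes K: "subgroup K P" and V: "subgroup V P" "V \<subseteq> K" "K \<subseteq> norm V"
    and A: "A \<in> max_abelian K" and VA: "\<not> V \<subseteq> norm A"
  obtains v where "v \<in> V" "v \<notin> norm A" "\<And>a. a \<in> A \<Longrightarrow> comm a v \<in> norm A"
proof -
  note A' = max_abelianD[OF A]
  have An: "subgroup (norm A) P" using norm_sub[OF A'(1)] .
  have Y: "subgroup (V <#> A) P"
    using set_mult_sub[OF V(1) A'(1)] A'(2) V(3) by blast
  have VY: "V \<subseteq> V <#> A"
    using subgroup.one_closed[OF A'(1)] sub_carrier[OF V(1)] unfolding set_mult_def by force
  have AY: "A \<subseteq> V <#> A"
    using subgroup.one_closed[OF V(1)] sub_carrier[OF A'(1)] unfolding set_mult_def by force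
  let ?X = "(V <#> A) \<inter> norm A"
  have X: "subgroup ?X P" by (rule inter_sub[OF Y An])
  have "?X \<noteq> V <#> A" using VY VA by blast
  then obtain y where y: "y \<in> V <#> A" "y \<notin> ?X" "y \<in> norm ?X"
    using norm_grows[OF X Y] by blast
  obtain v b where vb: "v \<in> V" "b \<in> A" "y = v \<otimes> b" using y(1) unfolding set_mult_def by blast
  have c: "v \<in> carrier P" "b \<in> carrier P" using vb sub_carrier V(1) A'(1) by blast+
  have AX: "A \<subseteq> ?X" using AY sub_norm[OF A'(1)] by blast
  have "v \<notin> norm A"
    using y(1,2) vb AX subgroup.m_closed[OF An, of v b] by blast
  moreover have "comm a v \<in> norm A" if a: "a \<in> A" for a
  proof -
    have ac: "a \<in> carrier P" using a sub_carrier A'(1) by blast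
    have "b \<in> norm ?X" using vb(2) AX sub_norm[OF X] by blast
    then have "y \<otimes> inv b \<in> norm ?X" using y(3) norm_sub[OF X]
      by (simp add: subgroup.m_closed subgroup.m_inv_closed)
    then have vX: "v \<in> norm ?X" using c vb(3) by (simp add: m_assoc)
    have "inv a \<in> ?X" using AX subgroup.m_inv_closed[OF A'(1) a] by blast
    then have "v \<otimes> inv a \<otimes> inv v \<in> norm A" using normD[OF vX] by blast
    moreover have "a \<in> norm A" using a sub_norm[OF A'(1)] by blast
    ultimately have "a \<otimes> (v \<otimes> inv a \<otimes> inv v) \<in> norm A" by (simp add: subgroup.m_closed[OF An])
    then show ?thesis using ac c by (simp add: comm_def m_assoc)
  qed
  ultimately show ?thesis using that vb(1) by blast
qed

text \<open>If Z(W) normalizes \<open>A\<close>, then [Z(W), A] lies in the abelian group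
  \<open>A\<close> and is centralized by it: \<open>A\<close> acts quadratically on Z(W).\<close>

lemma quadratic_max_abelian:
  assumes K: "subgroup K P" and W: "subgroup W P" "W \<subseteq> K" "K \<subseteq> norm W"
    and JK: "\<not> J K \<subseteq> W"
  obtains A where "A \<in> max_abelian K" "\<not> A \<subseteq> W" "center_of W \<subseteq> norm A"
proof -
  let ?V = "center_of W"
  have V: "subgroup ?V P" using center_of_sub[OF W(1)] .
  have VW: "?V \<subseteq> W" unfolding center_of_def by blast
  have Vcomm: "x \<otimes> w = w \<otimes> x" if "x \<in> ?V" "w \<in> W" for x w
    using that unfolding center_of_def by (auto simp: grp_centralizer_def)
  have KV: "K \<subseteq> norm ?V"
  proof
    fix g assume "g \<in> K"
    then have g: "g \<in> norm W" using W(3) by blast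
    then have gc: "g \<in> carrier P" using norm_carrier by blast
    have ig: "inv g \<in> norm W" using subgroup.m_inv_closed[OF norm_sub[OF W(1)] g] .
    show "g \<in> norm ?V"
    proof (rule normI[OF V gc])
      fix z assume z: "z \<in> ?V"
      have zc: "z \<in> carrier P" using sub_carrier[OF V z] .
      have zW: "g \<otimes> z \<otimes> inv g \<in> W" using normD[OF g] z VW by blast
      have "g \<otimes> z \<otimes> inv g \<otimes> w = w \<otimes> (g \<otimes> z \<otimes> inv g)" if w: "w \<in> W" for w
      proof -
        have wc: "w \<in> carrier P" using sub_carrier[OF W(1) w] .
        have "z \<otimes> (inv g \<otimes> w \<otimes> g) = inv g \<otimes> w \<otimes> g \<otimes> z"
          using Vcomm[OF z] normD[OF ig w] gc by simp
        then have "g \<otimes> (z \<otimes> (inv g \<otimes> w \<otimes> g)) \<otimes> inv g = g \<otimes> (inv g \<otimes> w \<otimes> g \<otimes> z) \<otimes> inv g" by simp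
        then show ?thesis using gc zc wc by (simp add: m_assoc mult_inv_cancel)
      qed
      then show "g \<otimes> z \<otimes> inv g \<in> ?V"
        using zW gc zc unfolding center_of_def by (simp add: grp_centralizer_def)
    qed
  qed
  let ?Q = "\<lambda>A. A \<in> max_abelian K \<and> \<not> A \<subseteq> W"
  obtain A0 where A0: "?Q A0"
  proof (rule ccontr)
    assume "\<not> thesis"
    then have "\<Union>(max_abelian K) \<subseteq> W" using that by blast
    then have "J K \<subseteq> W" unfolding J_def by (rule generate_subgroup_incl[OF _ W(1)])
    then show False using JK by blast
  qed
  have "\<forall>A. ?Q A \<longrightarrow> card (A \<inter> ?V) < Suc (card ?V)"
    using finite_sub[OF V] by (auto simp: card_mono less_Suc_eq_le)
  \<comment> \<open>\<open>A\<close> is chosen outside \<open>W\<close> with the largest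
    intersection with Z(W), so a replacement \<open>B\<close> for it must lie in \<open>W\<close>.
    Then Z(W) centralizes \<open>B\<close>, hence lies in \<open>B\<close>, and \<open>B\<close>
    normalizes \<open>A\<close>.\<close>
  then obtain A where A: "?Q A" and Amax: "\<And>B. ?Q B \<Longrightarrow> card (B \<inter> ?V) \<le> card (A \<inter> ?V)"
    using ex_has_greatest_nat[of ?Q A0 "\<lambda>A. card (A \<inter> ?V)" "Suc (card ?V)"] A0 by blast
  have "?V \<subseteq> norm A"
  proof (rule ccontr)
    assume nn: "\<not> ?thesis"
    have VK: "?V \<subseteq> K" using VW W(2) by blast
    have AK: "A \<in> max_abelian K" using A by blast
    have Vab: "x \<otimes> y = y \<otimes> x" if "x \<in> ?V" "y \<in> ?V" for x y
      using Vcomm[OF that(1)] that(2) VW by blast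
    obtain v where v: "v \<in> ?V" "v \<notin> norm A" "\<And>a. a \<in> A \<Longrightarrow> comm a v \<in> norm A"
      using max_abelian_normalized[OF K V VK KV AK nn] by blast
    obtain B where B: "B \<in> max_abelian K" "B \<subseteq> norm A" "A \<inter> ?V \<subset> B \<inter> ?V"
      using thompson_replacement[OF K V VK KV Vab AK v] by blast
    have "card (A \<inter> ?V) < card (B \<inter> ?V)"
      using B(3) finite_sub[OF V] by (intro psubset_card_mono) auto
    then have BW: "B \<subseteq> W" using Amax[of B] B(1) by force
    have "?V \<subseteq> B"
      using max_abelian_self_centralizing[OF B(1) K] VK Vcomm BW by blast
    then show False using B(2) nn by blast
  qed
  then show ?thesis using that A by blast
qed

text \<open>The element is the last one outside \<open>W\<close> among the iterated p-th powers of
  an element of \<open>A\<close> outside \<open>W\<close>.\<close>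

lemma power_into_subgroup:
  assumes A: "subgroup A P" and W: "subgroup W P" and AW: "\<not> A \<subseteq> W"
  obtains a where "a \<in> A" "a \<notin> W" "a [^] p \<in> W"
proof -
  obtain b where b: "b \<in> A" "b \<notin> W" using AW by blast
  have bc: "b \<in> carrier P" using sub_carrier[OF A b(1)] .
  have "b [^] (p ^ n) = \<one>" using pow_order_eq_1[OF bc] card_carrier by (simp add: order_def)
  then have ex: "b [^] (p ^ n) \<in> W" using subgroup.one_closed[OF W] by simp
  define k where "k = (LEAST k. b [^] (p ^ k) \<in> W)"
  have k: "b [^] (p ^ k) \<in> W" unfolding k_def using ex by (rule LeastI)
  have "k \<noteq> 0" using k b(2) bc by (intro notI) simp
  then obtain j where j: "k = Suc j" by (cases k) auto
  have "b [^] (p ^ j) \<notin> W" using not_less_Least[of j "\<lambda>k. b [^] (p ^ k) \<in> W"] j unfolding k_def by simp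
  moreover have "(b [^] (p ^ j)) [^] p \<in> W" using k j bc by (simp add: nat_pow_pow mult.commute)
  moreover have "b [^] (p ^ j) \<in> A" using sub_pow[OF A b(1)] .
  ultimately show ?thesis using that by blast
qed

text \<open>Since \<open>[Z(W), A, A] = 1\<close>, an element \<open>a\<close> of \<open>A\<close> with \<open>a\<^sup>p \<in> W\<close> satisfies
  \<open>1 = [a\<^sup>p, z] = [a, z]\<^sup>p = [a, z\<^sup>p]\<close> for \<open>z\<close> in \<open>Z(W)\<close>.\<close>

lemma J_norm_subset:
  assumes W: "subgroup W P" and T: "power_cent W \<subseteq> W"
  shows "J (norm W) \<subseteq> W"
proof (rule ccontr)
  assume "\<not> ?thesis"
  then obtain A where A: "A \<in> max_abelian (norm W)" "\<not> A \<subseteq> W" "center_of W \<subseteq> norm A"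
    using quadratic_max_abelian[OF norm_sub[OF W] W sub_norm[OF W]] by blast
  note A' = max_abelianD[OF A(1)]
  obtain a where a: "a \<in> A" "a \<notin> W" "a [^] p \<in> W"
    using power_into_subgroup[OF A'(1) W A(2)] .
  have ac: "a \<in> carrier P" using sub_carrier[OF A'(1) a(1)] .
  have an: "a \<in> norm W" using a(1) A'(2) by blast
  have "a \<otimes> z [^] p = z [^] p \<otimes> a" if z: "z \<in> center_of W" for z
  proof -
    have zW: "z \<in> W" and zn: "z \<in> norm A" using z A(3) unfolding center_of_def by auto
    have zc: "z \<in> carrier P" using sub_carrier[OF W zW] .
    define c where "c = comm a z"
    have cc: "c \<in> carrier P" unfolding c_def using comm_closed ac zc by blast
    have "z \<otimes> inv a \<otimes> inv z \<in> A" using normD[OF zn subgroup.m_inv_closed[OF A'(1) a(1)]] .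
    then have "a \<otimes> (z \<otimes> inv a \<otimes> inv z) \<in> A" using a(1) by (simp add: subgroup.m_closed[OF A'(1)])
    \<comment> \<open>Here quadratic action enters: the commutator \<open>c\<close> lies in the
      abelian group \<open>A\<close> and hence commutes with \<open>a\<close>.\<close>
    then have cA: "c \<in> A" unfolding c_def comm_def using ac zc by (simp add: m_assoc)
    have aca: "a \<otimes> c \<otimes> inv a = c"
      using conj_eq_iff[OF ac cc cc] A'(3)[OF a(1) cA] by simp
    have aza: "a \<otimes> z \<otimes> inv a = c \<otimes> z" unfolding c_def using comm_mult[OF ac zc] by simp
    have cW: "c \<in> W"
    proof -
      have "c = (a \<otimes> z \<otimes> inv a) \<otimes> inv z" unfolding c_def comm_def ..
      then show ?thesis using normD[OF an zW] subgroup.m_inv_closed[OF W zW] by (simp add: subgroup.m_closed[OF W])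
    qed
    have zcomm: "z \<otimes> w = w \<otimes> z" if "w \<in> W" for w
      using z that unfolding center_of_def by (auto simp: grp_centralizer_def)
    \<comment> \<open>Because \<open>a\<close> commutes with \<open>c\<close>, each further
      conjugation by \<open>a\<close> contributes one more factor \<open>c\<close>.\<close>
    have powk: "a [^] k \<otimes> z \<otimes> inv (a [^] k) = c [^] k \<otimes> z" for k :: nat
    proof (induction k)
      case 0 then show ?case using zc by simp
    next
      case (Suc k)
      have "a [^] Suc k \<otimes> z \<otimes> inv (a [^] Suc k) = a \<otimes> (a [^] k \<otimes> z \<otimes> inv (a [^] k)) \<otimes> inv a"
        unfolding nat_pow_Suc2[OF ac] using ac zc by (simp add: m_assoc inv_mult_group)
      also have "\<dots> = (a \<otimes> c [^] k \<otimes> inv a) \<otimes> (a \<otimes> z \<otimes> inv a)"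
        unfolding Suc using ac zc cc by (simp add: m_assoc mult_inv_cancel)
      also have "\<dots> = c [^] k \<otimes> (c \<otimes> z)" using conj_nat_pow[OF ac cc, of k] aca aza by simp
      finally show ?case using cc zc by (simp add: m_assoc)
    qed
    have "a [^] p \<otimes> z \<otimes> inv (a [^] p) = z"
      using conj_eq_iff[of "a [^] p" z z] zcomm[OF a(3)] ac zc by simp
    then have "c [^] p \<otimes> z = z" using powk by simp
    then have cp: "c [^] p = \<one>" using cc zc by (simp add: r_cancel_one)
    have "a \<otimes> z [^] p \<otimes> inv a = (c \<otimes> z) [^] p" using conj_nat_pow[OF ac zc] aza by simp
    \<comment> \<open>\<open>c\<close> lies in \<open>W\<close> and \<open>z\<close> in its center,
      so the power of the product splits.\<close>
    also have "\<dots> = z [^] p" using pow_mult_distrib[OF _ cc zc] zcomm[OF cW] cp zc by simp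
    finally show ?thesis using conj_eq_iff[of a "z [^] p" "z [^] p"] ac zc by simp
  qed
  then have "a \<in> power_cent W"
    unfolding power_cent_def center_powers_def using an ac by (auto simp: grp_centralizer_def)
  then show False using T a(2) by blast
qed

text \<open>The centralizer of the powers contains \<open>W\<close>. Were it larger, it would
  contain an element outside \<open>W\<close> that normalizes \<open>W\<close>, and such an element
  lies in \<open>power_cent W\<close>.\<close>

lemma cent_center_powers_subset:
  assumes W: "subgroup W P" and T: "power_cent W \<subseteq> W"
  shows "cent (center_powers W) \<subseteq> W"
proof (rule ccontr)
  assume nn: "\<not> ?thesis"
  have pc: "center_powers W \<subseteq> center_of W" using center_powers_subset[OF W] .
  then have "center_powers W \<subseteq> carrier P" using center_of_sub[OF W] sub_subset by blast
  then have C: "subgroup (cent (center_powers W)) P" by (rule cent_sub)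
  have "W \<subseteq> cent (center_of W)" using sub_subset[OF W]
    unfolding center_of_def by (auto simp: grp_centralizer_def)
  then have "W \<subseteq> cent (center_powers W)" using cent_mono[OF pc] by blast
  then obtain x where "x \<in> cent (center_powers W)" "x \<notin> W" "x \<in> norm W"
    using norm_grows[OF W C] nn by blast
  then show False using T unfolding power_cent_def by blast
qed

lemma center_of_J:
  assumes "subgroup W P"
  shows "center_of W \<subseteq> J W"
proof -
  obtain A where A: "A \<in> max_abelian W" using max_abelian_nonempty[OF assms] .
  show ?thesis using center_of_max_abelian[OF assms A] max_abelian_J[OF A] by blast
qed

text \<open>This makes \<open>J W\<close> centric, so that the induction may pass to it. The powers
  of Z(W) lie in \<open>J W\<close>, so what centralizes \<open>J W\<close> lies in
  \<open>W\<close>, where an abelian subgroup of maximal order is self-centralizing.\<close>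

lemma cent_J_subset:
  assumes W: "subgroup W P" and T: "power_cent W \<subseteq> W"
  shows "cent (J W) \<subseteq> J W"
proof
  fix x assume x: "x \<in> cent (J W)"
  have "center_powers W \<subseteq> J W" using center_powers_subset[OF W] center_of_J[OF W] by blast
  then have xW: "x \<in> W" using x cent_mono cent_center_powers_subset[OF W T] by blast
  obtain A where A: "A \<in> max_abelian W" using max_abelian_nonempty[OF W] .
  have "x \<in> A"
    using max_abelian_self_centralizing[OF A W xW] cent_comm[OF x] max_abelian_J[OF A] by blast
  then show "x \<in> J W" using max_abelian_J[OF A] by blast
qed

section \<open>Injective homomorphisms on subgroups and what they preserve\<close>

abbreviation ihom :: "'a set \<Rightarrow> ('a \<Rightarrow> 'a) \<Rightarrow> bool" where
  "ihom Q \<phi> \<equiv> inj_hom P Q (carrier P) \<phi>"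

lemma ihomD:
  assumes "ihom Q \<phi>"
  shows "\<phi> \<in> extensional Q" "\<And>x. x \<in> Q \<Longrightarrow> \<phi> x \<in> carrier P" "inj_on \<phi> Q"
    "\<And>x y. x \<in> Q \<Longrightarrow> y \<in> Q \<Longrightarrow> \<phi> (x \<otimes> y) = \<phi> x \<otimes> \<phi> y"
  using assms unfolding inj_hom_def by blast+

lemma ihom_group_hom:
  assumes "subgroup Q P" "ihom Q \<phi>"
  shows "group_hom (P\<lparr>carrier := Q\<rparr>) P \<phi>"
  using assms subgroup_imp_group is_group ihomD[OF assms(2)]
  unfolding group_hom_def group_hom_axioms_def hom_def by auto

lemma ihom_inv:
  assumes Q: "subgroup Q P" and \<phi>: "ihom Q \<phi>" and x: "x \<in> Q"
  shows "\<phi> (inv x) = inv (\<phi> x)"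
  using group_hom.hom_inv[OF ihom_group_hom[OF Q \<phi>], of x] x m_inv_consistent[OF Q x] by simp

lemma ihom_conj:
  assumes Q: "subgroup Q P" and \<phi>: "ihom Q \<phi>" and x: "x \<in> Q" and y: "y \<in> Q"
  shows "\<phi> (x \<otimes> y \<otimes> inv x) = \<phi> x \<otimes> \<phi> y \<otimes> inv (\<phi> x)"
  using ihomD(4)[OF \<phi>] ihom_inv[OF Q \<phi> x] x y subgroup.m_closed[OF Q] subgroup.m_inv_closed[OF Q] by metis

lemma ihom_pow:
  assumes Q: "subgroup Q P" and \<phi>: "ihom Q \<phi>" and x: "x \<in> Q"
  shows "\<phi> (x [^] (k :: nat)) = \<phi> x [^] k"
proof (induction k)
  case 0
  then show ?case using group_hom.hom_one[OF ihom_group_hom[OF Q \<phi>]] by simp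
next
  case (Suc k)
  then show ?case using ihomD(4)[OF \<phi> sub_pow[OF Q x] x] by simp
qed

lemma ihom_img_sub:
  assumes Q: "subgroup Q P" and \<phi>: "ihom Q \<phi>" and X: "subgroup X P" "X \<subseteq> Q"
  shows "subgroup (\<phi> ` X) P"
  using group_hom.subgroup_img_is_subgroup[OF ihom_group_hom[OF Q \<phi>] subgroup_incl[OF X(1) Q X(2)]] .

lemma ihom_card:
  assumes "ihom Q \<phi>" "X \<subseteq> Q"
  shows "card (\<phi> ` X) = card X"
  using assms ihomD(3) by (metis card_image inj_on_subset)

lemma ihom_mem_img:
  assumes "ihom Q \<phi>" "X \<subseteq> Q" "x \<in> Q"
  shows "\<phi> x \<in> \<phi> ` X \<longleftrightarrow> x \<in> X"
  using assms ihomD(3) inj_on_image_mem_iff by metis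

lemma ihom_norm:
  assumes Q: "subgroup Q P" and \<phi>: "ihom Q \<phi>" and X: "subgroup X P" "X \<subseteq> Q" and x: "x \<in> Q"
  shows "\<phi> x \<in> norm (\<phi> ` X) \<longleftrightarrow> x \<in> norm X"
proof
  assume n: "\<phi> x \<in> norm (\<phi> ` X)"
  show "x \<in> norm X"
  proof (rule normI[OF X(1) sub_carrier[OF Q x]])
    fix w assume w: "w \<in> X"
    then have wQ: "w \<in> Q" using X(2) by blast
    have "\<phi> (x \<otimes> w \<otimes> inv x) \<in> \<phi> ` X" using normD[OF n] w ihom_conj[OF Q \<phi> x wQ] by simp
    then show "x \<otimes> w \<otimes> inv x \<in> X" using ihom_mem_img[OF \<phi> X(2) sub_conj[OF Q x wQ]] by simp
  qed
next
  assume n: "x \<in> norm X"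
  show "\<phi> x \<in> norm (\<phi> ` X)"
  proof (rule normI[OF ihom_img_sub[OF Q \<phi> X] ihomD(2)[OF \<phi> x]])
    fix y assume "y \<in> \<phi> ` X"
    then obtain w where w: "w \<in> X" "y = \<phi> w" by blast
    then have "\<phi> x \<otimes> y \<otimes> inv (\<phi> x) = \<phi> (x \<otimes> w \<otimes> inv x)" using ihom_conj[OF Q \<phi> x, of w] X(2) by auto
    then show "\<phi> x \<otimes> y \<otimes> inv (\<phi> x) \<in> \<phi> ` X" using normD[OF n w(1)] by simp
  qed
qed

lemma ihom_cent:
  assumes Q: "subgroup Q P" and \<phi>: "ihom Q \<phi>" and X: "X \<subseteq> Q" and x: "x \<in> Q"
  shows "\<phi> x \<in> cent (\<phi> ` X) \<longleftrightarrow> x \<in> cent X"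
proof -
  have "\<phi> x \<otimes> \<phi> w = \<phi> w \<otimes> \<phi> x \<longleftrightarrow> x \<otimes> w = w \<otimes> x" if w: "w \<in> X" for w
  proof -
    have wQ: "w \<in> Q" using w X by blast
    show ?thesis
      using ihomD(4)[OF \<phi> x wQ] ihomD(4)[OF \<phi> wQ x] inj_on_eq_iff[OF ihomD(3)[OF \<phi>]] x wQ subgroup.m_closed[OF Q]
      by metis
  qed
  then show ?thesis using sub_carrier[OF Q x] ihomD(2)[OF \<phi> x] by (simp add: grp_centralizer_def)
qed

lemma ihom_center_of:
  assumes Q: "subgroup Q P" and \<phi>: "ihom Q \<phi>" and X: "X \<subseteq> Q"
  shows "center_of (\<phi> ` X) = \<phi> ` center_of X"
  unfolding center_of_def using ihom_cent[OF Q \<phi> X] X by blast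

lemma ihom_center_powers:
  assumes Q: "subgroup Q P" and \<phi>: "ihom Q \<phi>" and X: "X \<subseteq> Q"
  shows "center_powers (\<phi> ` X) = \<phi> ` center_powers X"
proof -
  have "\<phi> z [^] p = \<phi> (z [^] p)" if "z \<in> center_of X" for z
    using ihom_pow[OF Q \<phi>, of z] that X unfolding center_of_def by auto
  then show ?thesis unfolding center_powers_def ihom_center_of[OF Q \<phi> X] image_image by simp
qed

lemma ihom_preimage:
  assumes Q: "subgroup Q P" and \<phi>: "ihom Q \<phi>" and K: "subgroup K P" "K \<subseteq> Q" and B: "abel B"
  shows "abel {x \<in> K. \<phi> x \<in> B}"
proof -
  have Bs: "subgroup B P" using B unfolding Defs.abelian_subgroup_def by blast
  have "subgroup {x \<in> K. \<phi> x \<in> B} P"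
  proof (rule subgroupI)
    show "{x \<in> K. \<phi> x \<in> B} \<subseteq> carrier P" using sub_subset[OF K(1)] by blast
    have "\<phi> \<one> = \<one>" using group_hom.hom_one[OF ihom_group_hom[OF Q \<phi>]] by simp
    then show "{x \<in> K. \<phi> x \<in> B} \<noteq> {}" using subgroup.one_closed[OF K(1)] subgroup.one_closed[OF Bs] by force
  next
    fix a assume "a \<in> {x \<in> K. \<phi> x \<in> B}"
    then show "inv a \<in> {x \<in> K. \<phi> x \<in> B}"
      using subgroup.m_inv_closed[OF K(1)] subgroup.m_inv_closed[OF Bs] ihom_inv[OF Q \<phi>] K(2) by auto
  next
    fix a b assume a: "a \<in> {x \<in> K. \<phi> x \<in> B}" and b: "b \<in> {x \<in> K. \<phi> x \<in> B}"
    have "\<phi> (a \<otimes> b) = \<phi> a \<otimes> \<phi> b" using a b K(2) by (intro ihomD(4)[OF \<phi>]) auto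
    then show "a \<otimes> b \<in> {x \<in> K. \<phi> x \<in> B}"
      using a b subgroup.m_closed[OF K(1)] subgroup.m_closed[OF Bs] by simp
  qed
  moreover have "x \<otimes> y = y \<otimes> x" if x: "x \<in> K" "\<phi> x \<in> B" and y: "y \<in> K" "\<phi> y \<in> B" for x y
  proof -
    have q: "x \<in> Q" "y \<in> Q" using x y K(2) by auto
    have "\<phi> (x \<otimes> y) = \<phi> (y \<otimes> x)"
      using ihomD(4)[OF \<phi> q] ihomD(4)[OF \<phi> q(2,1)] B x(2) y(2) unfolding Defs.abelian_subgroup_def by simp
    then show ?thesis using inj_on_eq_iff[OF ihomD(3)[OF \<phi>]] q subgroup.m_closed[OF Q] by blast
  qed
  ultimately show ?thesis unfolding Defs.abelian_subgroup_def by blast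
qed

lemma ihom_abel:
  assumes Q: "subgroup Q P" and \<phi>: "ihom Q \<phi>" and A: "abel A" "A \<subseteq> Q"
  shows "abel (\<phi> ` A)"
proof -
  have As: "subgroup A P" using A unfolding Defs.abelian_subgroup_def by blast
  have "\<phi> x \<otimes> \<phi> y = \<phi> y \<otimes> \<phi> x" if "x \<in> A" "y \<in> A" for x y
  proof -
    have "x \<in> Q" "y \<in> Q" using that A(2) by auto
    moreover have "x \<otimes> y = y \<otimes> x" using that A(1) unfolding Defs.abelian_subgroup_def by blast
    ultimately show ?thesis using ihomD(4)[OF \<phi>] by metis
  qed
  then show ?thesis using ihom_img_sub[OF Q \<phi> As A(2)] unfolding Defs.abelian_subgroup_def by blast
qed

lemma ihom_max_abelian:
  assumes Q: "subgroup Q P" and \<phi>: "ihom Q \<phi>" and K: "subgroup K P" "K \<subseteq> Q"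
  shows "max_abelian (\<phi> ` K) = (`) \<phi> ` max_abelian K"
proof (intro equalityI subsetI)
  have pre: "\<phi> ` {x \<in> K. \<phi> x \<in> B} = B" if "B \<subseteq> \<phi> ` K" for B using that by blast
  have cpre: "card {x \<in> K. \<phi> x \<in> B} = card B" if "B \<subseteq> \<phi> ` K" for B
  proof -
    have "{x \<in> K. \<phi> x \<in> B} \<subseteq> Q" using K(2) by blast
    then show ?thesis using ihom_card[OF \<phi>] pre[OF that] by metis
  qed
  {
    fix B assume "B \<in> max_abelian (\<phi> ` K)"
    then have B: "abel B" "B \<subseteq> \<phi> ` K" "\<And>C. abel C \<Longrightarrow> C \<subseteq> \<phi> ` K \<Longrightarrow> card C \<le> card B"
      unfolding max_abelian_def by auto
    let ?B = "{x \<in> K. \<phi> x \<in> B}"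
    have "card C \<le> card ?B" if C: "abel C" "C \<subseteq> K" for C
    proof -
      have CQ: "C \<subseteq> Q" using C K(2) by blast
      have "card (\<phi> ` C) \<le> card B" using B(3)[OF ihom_abel[OF Q \<phi> C(1) CQ]] C(2) by blast
      then show ?thesis using ihom_card[OF \<phi> CQ] cpre[OF B(2)] by simp
    qed
    then have "?B \<in> max_abelian K" using ihom_preimage[OF Q \<phi> K B(1)] unfolding max_abelian_def by blast
    then show "B \<in> (`) \<phi> ` max_abelian K" by (rule rev_image_eqI) (rule pre[OF B(2), symmetric])
  next
    fix B assume "B \<in> (`) \<phi> ` max_abelian K"
    then obtain A where A: "A \<in> max_abelian K" "B = \<phi> ` A" by blast
    then have A': "abel A" "A \<subseteq> K" unfolding max_abelian_def by auto
    then have AQ: "A \<subseteq> Q" using K(2) by blast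
    have "card C \<le> card B" if C: "abel C" "C \<subseteq> \<phi> ` K" for C
    proof -
      have "card {x \<in> K. \<phi> x \<in> C} \<le> card A"
        using max_abelianD(4)[OF A(1) ihom_preimage[OF Q \<phi> K C(1)]] by blast
      then show ?thesis using cpre[OF C(2)] ihom_card[OF \<phi> AQ] A(2) by simp
    qed
    then show "B \<in> max_abelian (\<phi> ` K)"
      using ihom_abel[OF Q \<phi> A'(1) AQ] A'(2) A(2) unfolding max_abelian_def by blast
  }
qed

lemma ihom_J:
  assumes Q: "subgroup Q P" and \<phi>: "ihom Q \<phi>" and K: "subgroup K P" "K \<subseteq> Q"
  shows "J (\<phi> ` K) = \<phi> ` J K"
proof -
  have S: "\<Union>(max_abelian K) \<subseteq> Q" using K(2) max_abelianD(2) by blast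
  have "\<Union>(max_abelian (\<phi> ` K)) = \<phi> ` \<Union>(max_abelian K)"
    unfolding ihom_max_abelian[OF Q \<phi> K] by blast
  then show ?thesis
    unfolding J_def
    using group_hom.generate_img[OF ihom_group_hom[OF Q \<phi>], of "\<Union>(max_abelian K)"] S
      generate_consistent[OF S Q] by simp
qed

lemma conjmap_ihom:
  assumes Q: "subgroup Q P" and g: "g \<in> carrier P"
  shows "ihom Q (conjmap P g Q)"
proof -
  have c: "x \<in> carrier P" if "x \<in> Q" for x using sub_carrier[OF Q that] .
  have "inj_on (conjmap P g Q) Q" using g c unfolding conjmap_def by (intro inj_onI) simp
  moreover have "conjmap P g Q (x \<otimes> y) = conjmap P g Q x \<otimes> conjmap P g Q y" if "x \<in> Q" "y \<in> Q" for x y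
    using that g c subgroup.m_closed[OF Q that] unfolding conjmap_def by (simp add: m_assoc mult_inv_cancel)
  ultimately show ?thesis using g c unfolding inj_hom_def conjmap_def by auto
qed

lemma conjmap_img:
  assumes "X \<subseteq> Q" "g \<in> norm X"
  shows "conjmap P g Q ` X = X"
proof -
  have "conjmap P g Q ` X = (\<lambda>w. g \<otimes> w \<otimes> inv g) ` X"
    using assms(1) unfolding conjmap_def by (intro image_cong) auto
  then show ?thesis using assms(2) unfolding grp_normalizer_def by simp
qed

text \<open>\<open>J K\<close> is characteristic in \<open>K\<close>: conjugation by an element that
  normalizes \<open>K\<close> is an injective homomorphism of \<open>K\<close> onto itself.\<close>

lemma norm_subset_norm_J:
  assumes K: "subgroup K P"
  shows "norm K \<subseteq> norm (J K)"
proof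
  fix g assume g: "g \<in> norm K"
  have gc: "g \<in> carrier P" using g by (rule norm_carrier)
  have "conjmap P g K ` J K = J K"
    using ihom_J[OF K conjmap_ihom[OF K gc] K order_refl] conjmap_img[OF order_refl g] by simp
  moreover have "conjmap P g K ` J K = (\<lambda>w. g \<otimes> w \<otimes> inv g) ` J K"
    using J_sub(2)[OF K] unfolding conjmap_def by (intro image_cong) auto
  ultimately show "g \<in> norm (J K)" using gc unfolding grp_normalizer_def by simp
qed

text \<open>For the last claim: the normalizer of \<open>W\<close> permutes
  \<open>center_powers W\<close>, and \<open>power_cent W\<close> is the kernel of this
  action.\<close>

lemma power_cent_sub:
  assumes W: "subgroup W P"
  shows "subgroup (power_cent W) P" "W \<subseteq> power_cent W" "norm W \<subseteq> norm (power_cent W)"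
proof -
  have pc: "center_powers W \<subseteq> center_of W" by (rule center_powers_subset[OF W])
  have "center_powers W \<subseteq> W" using pc unfolding center_of_def by blast
  then have pcc: "center_powers W \<subseteq> carrier P" using sub_subset[OF W] by blast
  show T: "subgroup (power_cent W) P"
    unfolding power_cent_def by (intro inter_sub norm_sub[OF W] cent_sub[OF pcc])
  have "w \<otimes> z = z \<otimes> w" if "w \<in> W" "z \<in> center_powers W" for w z
    using that pc cent_comm[of z W w] unfolding center_of_def by auto
  then show "W \<subseteq> power_cent W"
    using sub_norm[OF W] sub_subset[OF W] unfolding power_cent_def grp_centralizer_def by auto
  show "norm W \<subseteq> norm (power_cent W)"
  proof
    fix g assume g: "g \<in> norm W"
    have gc: "g \<in> carrier P" using g by (rule norm_carrier)
    let ?c = "conjmap P g (carrier P)"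
    have i: "ihom (carrier P) ?c" by (rule conjmap_ihom[OF carrier_sub gc])
    have im: "?c ` center_powers W = center_powers W"
      using ihom_center_powers[OF carrier_sub i sub_subset[OF W]] conjmap_img[OF sub_subset[OF W] g] by simp
    show "g \<in> norm (power_cent W)"
    proof (rule normI[OF T gc])
      fix t assume t: "t \<in> power_cent W"
      then have tc: "t \<in> carrier P" "t \<in> norm W" "t \<in> cent (center_powers W)"
        using sub_carrier[OF T] unfolding power_cent_def by auto
      have "g \<otimes> t \<otimes> inv g \<in> norm W" using sub_conj[OF norm_sub[OF W] g tc(2)] .
      moreover have "?c t \<in> cent (center_powers W)"
        using ihom_cent[OF carrier_sub i pcc tc(1)] tc(3) im by simp
      ultimately show "g \<otimes> t \<otimes> inv g \<in> power_cent W"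
        using tc(1) unfolding power_cent_def conjmap_def by simp
    qed
  qed
qed

end

section \<open>Saturated fusion systems\<close>

lemma card_hom_image_dvd:
  assumes "group_hom G H h"
  shows "card (h ` carrier G) dvd card (carrier G)"
proof -
  interpret group_hom G H h by fact
  let ?K = "kernel G H h" and ?I = "H\<lparr>carrier := h ` carrier G\<rparr>"
  have I: "subgroup (h ` carrier G) H" using img_is_subgroup .
  interpret h': group_hom G ?I h
    using G.group_axioms H.subgroup_imp_group[OF I]
    unfolding group_hom_def group_hom_axioms_def hom_def by auto
  have "kernel G ?I h = ?K" by (simp add: kernel_def)
  then have "(\<lambda>X. the_elem (h ` X)) \<in> iso (G Mod ?K) ?I"
    using h'.FactGroup_iso_set by simp
  then have "card (rcosets\<^bsub>G\<^esub> ?K) = card (h ` carrier G)"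
    unfolding iso_def FactGroup_def by (auto intro: bij_betw_same_card)
  then show ?thesis
    using G.lagrange[OF subgroup_kernel] unfolding order_def by (metis dvd_triv_left)
qed

locale fusion = finite_p_group +
  fixes F :: "'a homs"
  assumes saturated: "saturated_fusion_system P p F"
begin

abbreviation mor :: "'a set \<Rightarrow> ('a \<Rightarrow> 'a) set" where "mor Q \<equiv> F Q (carrier P)"
abbreviation fn :: "'a set \<Rightarrow> bool" where "fn \<equiv> fully_normalized P F"

lemma category: "category_on P F"
  using saturated unfolding saturated_fusion_system_def by blast

lemma F_subgroup: "\<phi> \<in> F Q R \<Longrightarrow> subgroup Q P \<and> subgroup R P"
  using category unfolding category_on_def by blast

lemma F_inj_hom: "\<phi> \<in> F Q R \<Longrightarrow> inj_hom P Q R \<phi>"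
  using category unfolding category_on_def by blast

lemma F_id: "subgroup Q P \<Longrightarrow> idmap Q \<in> F Q Q"
  using category unfolding category_on_def by blast

lemma F_compose: "\<phi> \<in> F Q R \<Longrightarrow> \<psi> \<in> F R T \<Longrightarrow> compose Q \<psi> \<phi> \<in> F Q T"
  using category unfolding category_on_def by blast

lemma F_onto: "\<phi> \<in> F Q R \<Longrightarrow> \<phi> \<in> F Q (\<phi> ` Q)"
  using category unfolding category_on_def by blast

lemma F_inverse:
  "\<phi> \<in> F Q R \<Longrightarrow> \<exists>\<psi> \<in> F (\<phi> ` Q) Q. compose Q \<psi> \<phi> = idmap Q"
  using category unfolding category_on_def by blast

lemma F_conj:
  assumes "subgroup Q P" "subgroup R P" "g \<in> carrier P" "\<And>x. x \<in> Q \<Longrightarrow> g \<otimes> x \<otimes> inv g \<in> R"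
  shows "conjmap P g Q \<in> F Q R"
proof -
  have "(\<lambda>x. g \<otimes> x \<otimes> inv g) ` Q \<subseteq> R" using assms(4) by blast
  then show ?thesis using saturated assms(1-3) unfolding saturated_fusion_system_def by blast
qed

lemma F_incl:
  assumes Q: "subgroup Q P" and R: "subgroup R P" and "Q \<subseteq> R"
  shows "idmap Q \<in> F Q R"
proof -
  have c: "x \<in> carrier P" if "x \<in> Q" for x using sub_carrier[OF Q that] .
  have "conjmap P \<one> Q = idmap Q"
    unfolding conjmap_def idmap_def using c by (auto simp: restrict_def)
  moreover have "conjmap P \<one> Q \<in> F Q R"
    using c assms(3) by (intro F_conj[OF Q R]) auto
  ultimately show ?thesis by simp
qed

text \<open>Composing with an inclusion does not change the underlying function, so the target of a
  morphism may be any subgroup that contains the image. Therefore most statements below use the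
  target \<open>carrier P\<close>.\<close>

lemma F_into:
  assumes "\<phi> \<in> F Q R" "subgroup S P" "\<phi> ` Q \<subseteq> S"
  shows "\<phi> \<in> F Q S"
proof -
  have o: "\<phi> \<in> F Q (\<phi> ` Q)" using F_onto assms(1) by blast
  then have "compose Q (idmap (\<phi> ` Q)) \<phi> \<in> F Q S"
    using F_compose[OF o F_incl] F_subgroup[OF o] assms(2,3) by blast
  moreover have "compose Q (idmap (\<phi> ` Q)) \<phi> = \<phi>"
    using F_inj_hom[OF assms(1)] unfolding inj_hom_def idmap_def
    by (intro ext) (auto simp: compose_def extensional_def restrict_def)
  ultimately show ?thesis by simp
qed

lemma F_img: "\<phi> \<in> F Q R \<Longrightarrow> \<phi> ` Q \<subseteq> R"
  using F_inj_hom unfolding inj_hom_def by blast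

lemma F_mor: "\<phi> \<in> F Q R \<Longrightarrow> \<phi> \<in> mor Q"
  using F_into[OF _ carrier_sub] F_img F_subgroup sub_subset by blast

lemma mor_sub: "\<phi> \<in> mor Q \<Longrightarrow> subgroup Q P"
  using F_subgroup by blast

lemma mor_ihom: "\<phi> \<in> mor Q \<Longrightarrow> ihom Q \<phi>"
  by (rule F_inj_hom)

lemma mor_img_sub: "\<phi> \<in> mor Q \<Longrightarrow> subgroup X P \<Longrightarrow> X \<subseteq> Q \<Longrightarrow> subgroup (\<phi> ` X) P"
  using ihom_img_sub mor_sub mor_ihom by blast

lemma mor_restrict:
  assumes "\<phi> \<in> mor Q" "subgroup X P" "X \<subseteq> Q"
  shows "restrict \<phi> X \<in> mor X"
proof -
  have "compose X \<phi> (idmap X) \<in> mor X"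
    using F_compose[OF F_incl[OF assms(2) mor_sub[OF assms(1)] assms(3)] assms(1)] .
  moreover have "compose X \<phi> (idmap X) = restrict \<phi> X"
    unfolding idmap_def by (auto simp: compose_def restrict_def)
  ultimately show ?thesis by simp
qed

lemma mor_compose:
  assumes "\<phi> \<in> mor Q" "\<psi> \<in> mor R" "\<phi> ` Q \<subseteq> R"
  shows "compose Q \<psi> \<phi> \<in> mor Q"
  using F_compose[OF F_into[OF assms(1) mor_sub[OF assms(2)] assms(3)] assms(2)] .

lemma compose_img: "X \<subseteq> Q \<Longrightarrow> compose Q \<psi> \<phi> ` X = \<psi> ` \<phi> ` X"
  by (force simp: compose_def image_iff)

lemma restrict_img: "X \<subseteq> Q \<Longrightarrow> restrict \<phi> Q ` X = \<phi> ` X"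
  by (force simp: image_iff)

lemma mor_ext:
  assumes "\<phi> \<in> mor Q" "\<psi> \<in> mor Q" "\<And>x. x \<in> Q \<Longrightarrow> \<phi> x = \<psi> x"
  shows "\<phi> = \<psi>"
  using ihomD(1)[OF mor_ihom] assms extensionalityI by metis

definition finv :: "'a set \<Rightarrow> ('a \<Rightarrow> 'a) \<Rightarrow> 'a \<Rightarrow> 'a" where
  "finv Q \<phi> = restrict (inv_into Q \<phi>) (\<phi> ` Q)"

lemma finv_left: "\<phi> \<in> mor Q \<Longrightarrow> x \<in> Q \<Longrightarrow> finv Q \<phi> (\<phi> x) = x"
  unfolding finv_def using ihomD(3)[OF mor_ihom] by simp

lemma finv_right: "y \<in> \<phi> ` Q \<Longrightarrow> \<phi> (finv Q \<phi> y) = y"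
  unfolding finv_def by (simp add: f_inv_into_f)

lemma finv_img:
  assumes "\<phi> \<in> mor Q" "X \<subseteq> Q"
  shows "finv Q \<phi> ` \<phi> ` X = X"
  using finv_left[OF assms(1)] assms(2) by (force simp: image_iff subset_iff)

lemma finv_mor:
  assumes "\<phi> \<in> mor Q"
  shows "finv Q \<phi> \<in> mor (\<phi> ` Q)"
proof -
  obtain \<psi> where \<psi>: "\<psi> \<in> F (\<phi> ` Q) Q" "compose Q \<psi> \<phi> = idmap Q" using F_inverse[OF assms] by blast
  have "\<psi> (\<phi> x) = finv Q \<phi> (\<phi> x)" if x: "x \<in> Q" for x
  proof -
    have "\<psi> (\<phi> x) = compose Q \<psi> \<phi> x" using x by (simp add: compose_def)
    then show ?thesis using finv_left[OF assms x] \<psi>(2) x by (simp add: idmap_def)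
  qed
  moreover have "\<psi> \<in> extensional (\<phi> ` Q)" "finv Q \<phi> \<in> extensional (\<phi> ` Q)"
    using F_inj_hom[OF \<psi>(1)] unfolding inj_hom_def finv_def by auto
  ultimately have "\<psi> = finv Q \<phi>" by (intro extensionalityI[of _ "\<phi> ` Q"]) auto
  then show ?thesis using F_mor[OF \<psi>(1)] by simp
qed

lemma mor_conj: "subgroup Q P \<Longrightarrow> g \<in> carrier P \<Longrightarrow> conjmap P g Q \<in> mor Q"
  by (rule F_conj[OF _ carrier_sub]) (auto intro: sub_carrier)

text \<open>Hypothesis \<open>N\<close> says that \<open>R\<close> lies in the set
  \<open>N_phi\<close> of the extension axiom; the extension obtained there is restricted to
  \<open>R\<close>.\<close>

lemma mor_extend:
  assumes \<phi>: "\<phi> \<in> mor Q" and fn: "fn (\<phi> ` Q)" and R: "subgroup R P" "R \<subseteq> norm Q" "Q \<subseteq> R"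
    and N: "\<forall>x\<in>R. \<exists>y\<in>norm (\<phi> ` Q). \<forall>z\<in>Q. \<phi> (x \<otimes> z \<otimes> inv x) = y \<otimes> \<phi> z \<otimes> inv y"
  shows "\<exists>\<psi>\<in>mor R. \<forall>z\<in>Q. \<psi> z = \<phi> z"
proof -
  have "F_iso F Q (\<phi> ` Q) \<phi>" using F_onto[OF \<phi>] unfolding F_iso_def by blast
  then obtain \<psi> where \<psi>: "\<psi> \<in> mor (N_phi P Q \<phi>)" "\<forall>z\<in>Q. \<psi> z = \<phi> z"
    using saturated fn unfolding saturated_fusion_system_def by blast
  have "R \<subseteq> N_phi P Q \<phi>" unfolding N_phi_def using R(2) N by blast
  then have 1: "restrict \<psi> R \<in> mor R" using mor_restrict[OF \<psi>(1) R(1)] by blast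
  have "\<forall>z\<in>Q. restrict \<psi> R z = \<phi> z" using \<psi>(2) R(3) by auto
  with 1 show ?thesis by blast
qed

section \<open>Automizers as groups\<close>

definition aut_grp :: "'a set \<Rightarrow> ('a \<Rightarrow> 'a) monoid" where
  "aut_grp Q = \<lparr>carrier = F Q Q, monoid.mult = (\<lambda>\<psi> \<phi>. compose Q \<psi> \<phi>), one = idmap Q\<rparr>"

definition aut_P :: "'a set \<Rightarrow> ('a \<Rightarrow> 'a) set" where
  "aut_P Q = (\<lambda>g. conjmap P g Q) ` norm Q"

lemma aut_grp_simps [simp]:
  "carrier (aut_grp Q) = F Q Q" "\<psi> \<otimes>\<^bsub>aut_grp Q\<^esub> \<phi> = compose Q \<psi> \<phi>" "\<one>\<^bsub>aut_grp Q\<^esub> = idmap Q"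
  by (simp_all add: aut_grp_def)

lemma aut_img:
  assumes "\<theta> \<in> F Q Q"
  shows "\<theta> ` Q = Q"
  using endo_inj_surj[OF finite_sub] F_subgroup[OF assms] F_inj_hom[OF assms] unfolding inj_hom_def by blast

lemma aut_mem: "\<theta> \<in> F Q Q \<Longrightarrow> x \<in> Q \<Longrightarrow> \<theta> x \<in> Q"
  using F_img by blast

lemma mor_autI: "\<theta> \<in> mor Q \<Longrightarrow> \<theta> ` Q = Q \<Longrightarrow> \<theta> \<in> F Q Q"
  using F_onto by metis

lemma finv_aut: "\<theta> \<in> F Q Q \<Longrightarrow> finv Q \<theta> \<in> F Q Q"
  using finv_mor[OF F_mor] finv_img[OF F_mor order_refl] aut_img mor_autI by metis

lemma group_aut_grp:
  assumes Q: "subgroup Q P"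
  shows "group (aut_grp Q)"
proof (rule groupI; simp only: aut_grp_simps)
  show "idmap Q \<in> F Q Q" using F_id[OF Q] .
  fix \<phi> assume \<phi>: "\<phi> \<in> F Q Q"
  show "compose Q (idmap Q) \<phi> = \<phi>"
    by (rule mor_ext[of _ Q]) (use F_compose[OF \<phi> F_id[OF Q]] \<phi> F_mor aut_mem in \<open>auto simp: compose_def idmap_def\<close>)
  show "\<exists>\<psi>\<in>F Q Q. compose Q \<psi> \<phi> = idmap Q" using F_inverse[OF \<phi>] aut_img[OF \<phi>] by simp
  fix \<psi> assume \<psi>: "\<psi> \<in> F Q Q"
  show "compose Q \<phi> \<psi> \<in> F Q Q" using F_compose \<phi> \<psi> by blast
  fix \<theta> assume \<theta>: "\<theta> \<in> F Q Q"
  show "compose Q (compose Q \<phi> \<psi>) \<theta> = compose Q \<phi> (compose Q \<psi> \<theta>)"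
    using aut_mem[OF \<theta>] by (auto simp: compose_def restrict_def)
qed

lemma inv_aut_grp:
  assumes "\<theta> \<in> F Q Q"
  shows "inv\<^bsub>aut_grp Q\<^esub> \<theta> = finv Q \<theta>"
proof -
  have Q: "subgroup Q P" using F_subgroup assms by blast
  interpret g: group "aut_grp Q" by (rule group_aut_grp[OF Q])
  have "compose Q (finv Q \<theta>) \<theta> = idmap Q"
    using finv_left[OF F_mor[OF assms]] by (auto simp: compose_def idmap_def restrict_def)
  then show ?thesis using g.inv_equality[of "finv Q \<theta>" \<theta>] assms finv_aut by simp
qed

lemma finite_aut_grp:
  assumes Q: "subgroup Q P"
  shows "finite (F Q Q)"
proof (rule finite_subset)
  show "F Q Q \<subseteq> extensional_funcset Q Q"
    using ihomD(1)[OF mor_ihom[OF F_mor]] aut_mem by (auto simp: PiE_def)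
  show "finite (extensional_funcset Q Q)" using finite_sub[OF Q] by (intro finite_PiE) auto
qed

lemma conj_hom:
  assumes Q: "subgroup Q P"
  shows "group_hom (P\<lparr>carrier := norm Q\<rparr>) (aut_grp Q) (\<lambda>g. conjmap P g Q)"
proof -
  have c: "x \<in> carrier P" if "x \<in> Q" for x using sub_carrier[OF Q that] .
  have n: "x \<in> carrier P" if "x \<in> norm Q" for x using norm_carrier[OF that] .
  have "conjmap P g Q \<in> F Q Q" if "g \<in> norm Q" for g
    using F_conj[OF Q Q n[OF that]] normD[OF that] by blast
  moreover have "conjmap P (g \<otimes> h) Q = compose Q (conjmap P g Q) (conjmap P h Q)"
    if "g \<in> norm Q" "h \<in> norm Q" for g h
    using that n c normD[OF that(2)]
    by (auto simp: conjmap_def compose_def restrict_def m_assoc inv_mult_group)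
  ultimately show ?thesis
    unfolding group_hom_def group_hom_axioms_def hom_def
    using subgroup_imp_group[OF norm_sub[OF Q]] group_aut_grp[OF Q] by auto
qed

lemma conj_image_subgroup:
  assumes Q: "subgroup Q P" and R: "subgroup R P" "R \<subseteq> norm Q"
  shows "subgroup ((\<lambda>g. conjmap P g Q) ` R) (aut_grp Q)"
  using group_hom.subgroup_img_is_subgroup[OF conj_hom[OF Q] subgroup_incl[OF R(1) norm_sub[OF Q] R(2)]] .

lemma p_group_image:
  assumes R: "subgroup R P" and S: "subgroup S P" "R \<subseteq> S" and h: "group_hom (P\<lparr>carrier := S\<rparr>) H h"
  obtains k where "card (h ` R) = p ^ k"
proof -
  have "group_hom (P\<lparr>carrier := R\<rparr>) H h"
    using h subgroup_imp_group[OF R] S(2) unfolding group_hom_def group_hom_axioms_def hom_def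
    by (auto simp: Pi_iff subset_iff)
  then have "card (h ` R) dvd card R"
    using card_hom_image_dvd[of "P\<lparr>carrier := R\<rparr>" H h] by simp
  moreover obtain j where "card R = p ^ j" using card_sub[OF R] .
  ultimately show ?thesis using that divides_primepow_nat[OF prime_p] by auto
qed

lemma aut_P_subgroup: "subgroup Q P \<Longrightarrow> subgroup (aut_P Q) (aut_grp Q)"
  unfolding aut_P_def using conj_image_subgroup norm_sub by blast

text \<open>Conjugation of an automorphism \<open>\<theta>\<close> of \<open>X\<close> by the
  isomorphism \<open>\<beta>\<close> onto its image; it carries the automizer of \<open>X\<close> to
  that of the image.\<close>

definition twist :: "'a set \<Rightarrow> ('a \<Rightarrow> 'a) \<Rightarrow> ('a \<Rightarrow> 'a) \<Rightarrow> 'a \<Rightarrow> 'a" where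
  "twist X \<beta> \<theta> = compose (\<beta> ` X) \<beta> (compose (\<beta> ` X) \<theta> (finv X \<beta>))"

lemma twist_apply:
  assumes "\<beta> \<in> mor X" "z \<in> X"
  shows "twist X \<beta> \<theta> (\<beta> z) = \<beta> (\<theta> z)"
  unfolding twist_def using finv_left[OF assms] assms(2) by (simp add: compose_def)

lemma twist_aut:
  assumes \<beta>: "\<beta> \<in> mor X" and \<theta>: "\<theta> \<in> F X X"
  shows "twist X \<beta> \<theta> \<in> F (\<beta> ` X) (\<beta> ` X)"
proof -
  have "finv X \<beta> \<in> F (\<beta> ` X) X"
    using F_into[OF finv_mor[OF \<beta>] mor_sub[OF \<beta>]] finv_img[OF \<beta> order_refl] by simp
  then show ?thesis unfolding twist_def using F_compose[OF F_compose[OF _ \<theta>] F_onto[OF \<beta>]] by blast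
qed

lemma twist_hom:
  assumes \<beta>: "\<beta> \<in> mor X"
  shows "group_hom (aut_grp X) (aut_grp (\<beta> ` X)) (twist X \<beta>)"
proof -
  have X: "subgroup X P" "subgroup (\<beta> ` X) P" using mor_sub[OF \<beta>] mor_img_sub[OF \<beta>] by auto
  have "twist X \<beta> (compose X \<theta> \<eta>) = compose (\<beta> ` X) (twist X \<beta> \<theta>) (twist X \<beta> \<eta>)"
    if t: "\<theta> \<in> F X X" "\<eta> \<in> F X X" for \<theta> \<eta>
  proof (rule mor_ext[of _ "\<beta> ` X"])
    show "twist X \<beta> (compose X \<theta> \<eta>) \<in> mor (\<beta> ` X)" using F_mor twist_aut[OF \<beta>] F_compose t by metis
    show "compose (\<beta> ` X) (twist X \<beta> \<theta>) (twist X \<beta> \<eta>) \<in> mor (\<beta> ` X)"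
      using F_mor F_compose twist_aut[OF \<beta>] t by metis
    fix y assume "y \<in> \<beta> ` X"
    then obtain z where z: "z \<in> X" "y = \<beta> z" by blast
    then show "twist X \<beta> (compose X \<theta> \<eta>) y = compose (\<beta> ` X) (twist X \<beta> \<theta>) (twist X \<beta> \<eta>) y"
      using twist_apply[OF \<beta>] aut_mem[OF t(2)] by (simp add: compose_def)
  qed
  then show ?thesis
    unfolding group_hom_def group_hom_axioms_def hom_def
    using group_aut_grp X twist_aut[OF \<beta>] by auto
qed

text \<open>The automorphisms induced by \<open>P\<close> form a p-group, so an index prime to
  \<open>p\<close> means that they are a Sylow subgroup of the automizer: \<open>Q\<close> is fully
  automized.\<close>

definition syl :: "'a set \<Rightarrow> bool" where
  "syl Q \<longleftrightarrow> \<not> p dvd card (lcosets\<^bsub>aut_grp Q\<^esub> (aut_P Q))"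

lemma aut_P_memE:
  assumes h: "h \<in> F Q Q" and b: "b \<in> F Q Q" and m: "inv\<^bsub>aut_grp Q\<^esub> h \<otimes>\<^bsub>aut_grp Q\<^esub> b \<otimes>\<^bsub>aut_grp Q\<^esub> h \<in> aut_P Q"
  obtains y where "y \<in> norm Q" "\<And>z. z \<in> Q \<Longrightarrow> b (h z) = h (y \<otimes> z \<otimes> inv y)"
proof -
  obtain y where y: "y \<in> norm Q" "compose Q (compose Q (finv Q h) b) h = conjmap P y Q"
    using m inv_aut_grp[OF h] unfolding aut_P_def by auto
  have "b (h z) = h (y \<otimes> z \<otimes> inv y)" if z: "z \<in> Q" for z
  proof -
    have "finv Q h (b (h z)) = y \<otimes> z \<otimes> inv y"
      using fun_cong[OF y(2), of z] z aut_mem[OF h z] by (simp add: compose_def conjmap_def)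
    moreover have "b (h z) \<in> h ` Q" using aut_mem[OF b aut_mem[OF h z]] aut_img[OF h] by simp
    ultimately show ?thesis using finv_right by metis
  qed
  then show ?thesis using that y(1) by blast
qed

lemma syl_conj_normal:
  assumes Q: "subgroup Q P" and syl: "syl Q" and B: "subgroup B (aut_grp Q)" "card B = p ^ k"
    and L: "L \<lhd> aut_grp Q" "B \<subseteq> L <#>\<^bsub>aut_grp Q\<^esub> aut_P Q"
  obtains h where "h \<in> L" "\<And>b. b \<in> B \<Longrightarrow> \<exists>y\<in>norm Q. \<forall>z\<in>Q. b (h z) = h (y \<otimes> z \<otimes> inv y)"
proof -
  interpret g: group "aut_grp Q" by (rule group_aut_grp[OF Q])
  obtain h where h: "h \<in> L" "\<And>b. b \<in> B \<Longrightarrow> inv\<^bsub>aut_grp Q\<^esub> h \<otimes>\<^bsub>aut_grp Q\<^esub> b \<otimes>\<^bsub>aut_grp Q\<^esub> h \<in> aut_P Q"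
    using g.sylow_conjugate_normal[OF _ prime_p aut_P_subgroup[OF Q] B L] finite_aut_grp[OF Q] syl
    unfolding syl_def by auto
  have hQ: "h \<in> F Q Q" using subgroup.mem_carrier[OF normal_imp_subgroup[OF L(1)] h(1)] by simp
  have "\<exists>y\<in>norm Q. \<forall>z\<in>Q. b (h z) = h (y \<otimes> z \<otimes> inv y)" if b: "b \<in> B" for b
  proof -
    have "b \<in> F Q Q" using subgroup.mem_carrier[OF B(1) b] by simp
    then obtain y where "y \<in> norm Q" "\<And>z. z \<in> Q \<Longrightarrow> b (h z) = h (y \<otimes> z \<otimes> inv y)"
      using aut_P_memE[OF hQ _ h(2)[OF b]] by metis
    then show ?thesis by blast
  qed
  then show ?thesis using that h(1) by blast
qed

text \<open>\<open>B\<close> is carried to the automizer of the image, where some \<open>h\<close>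
  in \<open>L\<close> conjugates it into the automorphisms induced by \<open>P\<close>. Composing
  \<open>\<beta>\<close> with the inverse of \<open>h\<close> gives \<open>\<gamma>\<close>, which
  turns each element of \<open>B\<close> into conjugation by an element of \<open>P\<close>, as the
  extension axiom demands.\<close>

lemma syl_conj_twist_normal:
  assumes \<beta>: "\<beta> \<in> mor X" and syl: "syl (\<beta> ` X)" and B: "subgroup B (aut_grp X)" "card B = p ^ k"
    and L: "L \<lhd> aut_grp (\<beta> ` X)" "twist X \<beta> ` B \<subseteq> L <#>\<^bsub>aut_grp (\<beta> ` X)\<^esub> aut_P (\<beta> ` X)"
  obtains \<gamma> h where "\<gamma> \<in> mor X" "\<gamma> ` X = \<beta> ` X" "h \<in> L" "\<And>z. z \<in> X \<Longrightarrow> h (\<gamma> z) = \<beta> z"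
    "\<And>b. b \<in> B \<Longrightarrow> \<exists>y\<in>norm (\<beta> ` X). \<forall>z\<in>X. \<gamma> (b z) = y \<otimes> \<gamma> z \<otimes> inv y"
proof -
  have X: "subgroup X P" "subgroup (\<beta> ` X) P" using mor_sub[OF \<beta>] mor_img_sub[OF \<beta>] by auto
  interpret tw: group_hom "aut_grp X" "aut_grp (\<beta> ` X)" "twist X \<beta>" by (rule twist_hom[OF \<beta>])
  have B': "subgroup (twist X \<beta> ` B) (aut_grp (\<beta> ` X))" using tw.subgroup_img_is_subgroup[OF B(1)] .
  have "inj_on (twist X \<beta>) B"
  proof (rule inj_onI)
    fix b c assume bc: "b \<in> B" "c \<in> B" "twist X \<beta> b = twist X \<beta> c"
    have m: "b \<in> F X X" "c \<in> F X X" using bc subgroup.mem_carrier[OF B(1)] by auto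
    have "b z = c z" if z: "z \<in> X" for z
      using twist_apply[OF \<beta> z] bc(3) aut_mem[OF m(1) z] aut_mem[OF m(2) z] finv_left[OF \<beta>] by metis
    then show "b = c" using mor_ext F_mor m by blast
  qed
  then have cB: "card (twist X \<beta> ` B) = p ^ k" using B(2) card_image by metis
  obtain h where hL: "h \<in> L" and
    h2: "\<And>b. b \<in> twist X \<beta> ` B \<Longrightarrow> \<exists>y\<in>norm (\<beta> ` X). \<forall>z\<in>\<beta> ` X. b (h z) = h (y \<otimes> z \<otimes> inv y)"
    using syl_conj_normal[OF X(2) syl B' cB L] by blast
  have "h \<in> F (\<beta> ` X) (\<beta> ` X)"
    using subgroup.mem_carrier[OF normal_imp_subgroup[OF L(1)] hL] by simp
  note h = this h2
  define \<gamma> where "\<gamma> = compose X (finv (\<beta> ` X) h) \<beta>"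
  have hi: "finv (\<beta> ` X) h \<in> F (\<beta> ` X) (\<beta> ` X)" using finv_aut[OF h(1)] .
  have \<gamma>: "\<gamma> \<in> mor X" unfolding \<gamma>_def using mor_compose[OF \<beta> F_mor[OF hi] order_refl] .
  have im: "\<gamma> ` X = \<beta> ` X" unfolding \<gamma>_def compose_img[OF order_refl] using aut_img[OF hi] .
  have hg: "h (\<gamma> z) = \<beta> z" if "z \<in> X" for z
    unfolding \<gamma>_def using that finv_right[of "\<beta> z" h "\<beta> ` X"] aut_img[OF h(1)] by (simp add: compose_def)
  have "\<exists>y\<in>norm (\<beta> ` X). \<forall>z\<in>X. \<gamma> (b z) = y \<otimes> \<gamma> z \<otimes> inv y" if b: "b \<in> B" for b
  proof -
    have bX: "b \<in> F X X" using b subgroup.mem_carrier[OF B(1)] by auto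
    obtain y where y: "y \<in> norm (\<beta> ` X)" "\<And>z. z \<in> \<beta> ` X \<Longrightarrow> twist X \<beta> b (h z) = h (y \<otimes> z \<otimes> inv y)"
      using h(2)[of "twist X \<beta> b"] b by blast
    have "\<gamma> (b z) = y \<otimes> \<gamma> z \<otimes> inv y" if z: "z \<in> X" for z
    proof -
      have gz: "\<gamma> z \<in> \<beta> ` X" using z im by blast
      have "\<beta> (b z) = h (y \<otimes> \<gamma> z \<otimes> inv y)"
        using y(2)[OF gz] twist_apply[OF \<beta> z, of b] hg[OF z] by simp
      then show ?thesis
        using aut_mem[OF bX z] finv_left[OF F_mor[OF h(1)] normD[OF y(1) gz]] unfolding \<gamma>_def
        by (simp add: compose_def)
    qed
    then show ?thesis using y(1) by blast
  qed
  then show ?thesis using that \<gamma> im hL hg by blast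
qed

lemma syl_conj_twist:
  assumes \<beta>: "\<beta> \<in> mor X" and syl: "syl (\<beta> ` X)" and B: "subgroup B (aut_grp X)" "card B = p ^ k"
  obtains \<gamma> where "\<gamma> \<in> mor X" "\<gamma> ` X = \<beta> ` X"
    "\<And>b. b \<in> B \<Longrightarrow> \<exists>y\<in>norm (\<beta> ` X). \<forall>z\<in>X. \<gamma> (b z) = y \<otimes> \<gamma> z \<otimes> inv y"
proof -
  let ?A = "aut_grp (\<beta> ` X)"
  have X1: "subgroup (\<beta> ` X) P" using mor_img_sub[OF \<beta> mor_sub[OF \<beta>] order_refl] .
  interpret g: group ?A by (rule group_aut_grp[OF X1])
  have L: "carrier ?A \<lhd> ?A" using g.normal_inv_iff g.subgroup_self by blast
  have "carrier ?A \<subseteq> carrier ?A <#>\<^bsub>?A\<^esub> aut_P (\<beta> ` X)"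
    using subgroup.one_closed[OF aut_P_subgroup[OF X1]] g.r_one unfolding set_mult_def by force
  moreover have "twist X \<beta> ` B \<subseteq> carrier ?A"
    using twist_aut[OF \<beta>] subgroup.mem_carrier[OF B(1)] by auto
  ultimately have sub: "twist X \<beta> ` B \<subseteq> carrier ?A <#>\<^bsub>?A\<^esub> aut_P (\<beta> ` X)" by blast
  show ?thesis
  proof (rule syl_conj_twist_normal[OF \<beta> syl B L sub])
    fix \<gamma>
    assume *: "\<gamma> \<in> mor X" "\<gamma> ` X = \<beta> ` X"
      "\<And>b. b \<in> B \<Longrightarrow> \<exists>y\<in>norm (\<beta> ` X). \<forall>z\<in>X. \<gamma> (b z) = y \<otimes> \<gamma> z \<otimes> inv y"
    show ?thesis by (rule that[OF *])
  qed
qed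

lemma card_aut_P:
  assumes "subgroup Q P"
  obtains k where "card (aut_P Q) = p ^ k"
  unfolding aut_P_def
  using p_group_image[OF norm_sub[OF assms] norm_sub[OF assms] order_refl conj_hom[OF assms]] by blast

text \<open>With \<open>B\<close> the automorphisms induced by \<open>norm X\<close>, correcting
  \<open>\<beta>\<close> by an automorphism of its image makes all of \<open>norm X\<close> satisfy
  the condition for extension.\<close>

lemma extend_to_norm_if_syl:
  assumes \<beta>: "\<beta> \<in> mor X" and fn: "fn (\<beta> ` X)" and syl: "syl (\<beta> ` X)"
  obtains \<gamma> where "\<gamma> \<in> mor (norm X)" "\<gamma> ` X = \<beta> ` X"
proof -
  have X: "subgroup X P" using mor_sub[OF \<beta>] .
  obtain k where k: "card (aut_P X) = p ^ k" using card_aut_P[OF X] .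
  obtain \<gamma> where \<gamma>: "\<gamma> \<in> mor X" "\<gamma> ` X = \<beta> ` X"
    "\<And>b. b \<in> aut_P X \<Longrightarrow> \<exists>y\<in>norm (\<beta> ` X). \<forall>z\<in>X. \<gamma> (b z) = y \<otimes> \<gamma> z \<otimes> inv y"
    using syl_conj_twist[OF \<beta> syl aut_P_subgroup[OF X] k] by blast
  have "\<exists>y\<in>norm (\<gamma> ` X). \<forall>z\<in>X. \<gamma> (x \<otimes> z \<otimes> inv x) = y \<otimes> \<gamma> z \<otimes> inv y" if x: "x \<in> norm X" for x
    using \<gamma>(3)[of "conjmap P x X"] x \<gamma>(2) unfolding aut_P_def conjmap_def by auto
  moreover have "fn (\<gamma> ` X)" using fn \<gamma>(2) by simp
  ultimately obtain \<psi> where \<psi>: "\<psi> \<in> mor (norm X)" "\<forall>z\<in>X. \<psi> z = \<gamma> z"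
    using mor_extend[OF \<gamma>(1) _ norm_sub[OF X] order_refl sub_norm[OF X]] by blast
  have "\<psi> ` X = \<beta> ` X" using \<psi>(2) \<gamma>(2) by (metis image_cong)
  then show ?thesis using that \<psi>(1) by blast
qed

section \<open>Fully normalized subgroups and Sylow automizers\<close>

lemma fn_card:
  assumes fn: "fn X" and \<alpha>: "\<alpha> \<in> mor X"
  shows "card (norm (\<alpha> ` X)) \<le> card (norm X)"
proof -
  have "F_iso F (\<alpha> ` X) X (finv X \<alpha>)"
    unfolding F_iso_def
    using finv_img[OF \<alpha> order_refl] F_into[OF finv_mor[OF \<alpha>] mor_sub[OF \<alpha>]] by simp
  then show ?thesis using fn unfolding fully_normalized_def by blast
qed

lemma fnI:
  assumes \<beta>: "\<beta> \<in> mor X"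
    and max: "\<And>\<alpha>. \<alpha> \<in> mor X \<Longrightarrow> card (norm (\<alpha> ` X)) \<le> card (norm (\<beta> ` X))"
  shows "fn (\<beta> ` X)"
  unfolding fully_normalized_def
proof (intro allI impI)
  fix Q \<phi> assume "F_iso F Q (\<beta> ` X) \<phi>"
  then have \<phi>: "\<phi> \<in> mor Q" "\<phi> ` Q = \<beta> ` X" unfolding F_iso_def using F_mor by auto
  have "finv Q \<phi> \<in> mor (\<beta> ` X)" using finv_mor[OF \<phi>(1)] \<phi>(2) by simp
  then have 1: "compose X (finv Q \<phi>) \<beta> \<in> mor X" using mor_compose[OF \<beta>] by blast
  have "compose X (finv Q \<phi>) \<beta> ` X = Q"
    unfolding compose_img[OF order_refl] using finv_img[OF \<phi>(1) order_refl] \<phi>(2) by simp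
  then show "card (norm Q) \<le> card (norm (\<beta> ` X))" using max[OF 1] by simp
qed

lemma fn_representative:
  assumes X: "subgroup X P"
  obtains \<beta> where "\<beta> \<in> mor X" "fn (\<beta> ` X)"
proof -
  have "idmap X \<in> mor X" using F_mor[OF F_id[OF X]] .
  moreover have "\<forall>\<alpha>. \<alpha> \<in> mor X \<longrightarrow> card (norm (\<alpha> ` X)) < Suc (card (carrier P))"
  proof (intro allI impI)
    fix \<alpha> assume "\<alpha> \<in> mor X"
    then have "norm (\<alpha> ` X) \<subseteq> carrier P" using norm_carrier by blast
    then show "card (norm (\<alpha> ` X)) < Suc (card (carrier P))"
      using card_mono[OF finite_carrier] by (simp add: less_Suc_eq_le)
  qed
  ultimately obtain \<beta> where "\<beta> \<in> mor X" "\<forall>\<alpha>. \<alpha> \<in> mor X \<longrightarrow> card (norm (\<alpha> ` X)) \<le> card (norm (\<beta> ` X))"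
    using ex_has_greatest_nat[of "\<lambda>\<alpha>. \<alpha> \<in> mor X" "idmap X" "\<lambda>\<alpha>. card (norm (\<alpha> ` X))" "Suc (card (carrier P))"]
    by blast
  then show ?thesis using that fnI by blast
qed

text \<open>A morphism sends the normalizer of \<open>X\<close> injectively into that of the image.
  As \<open>X\<close> has the largest normalizer among its conjugates, this is onto, and the image
  is fully normalized as well.\<close>

lemma fn_norm_img:
  assumes X: "subgroup X P" and fn: "fn X" and \<alpha>: "\<alpha> \<in> mor D" and D: "norm X \<subseteq> D"
  shows "norm (\<alpha> ` X) = \<alpha> ` norm X" "fn (\<alpha> ` X)"
proof -
  have Ds: "subgroup D P" using mor_sub[OF \<alpha>] .
  have XD: "X \<subseteq> D" using sub_norm[OF X] D by blast
  have rX: "restrict \<alpha> X \<in> mor X" "restrict \<alpha> X ` X = \<alpha> ` X"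
    using mor_restrict[OF \<alpha> X XD] restrict_img by auto
  have sub: "\<alpha> ` norm X \<subseteq> norm (\<alpha> ` X)"
    using ihom_norm[OF Ds mor_ihom[OF \<alpha>] X XD] D by blast
  have c: "card (\<alpha> ` norm X) = card (norm X)" using ihom_card[OF mor_ihom[OF \<alpha>] D] .
  have le: "card (norm (\<alpha> ` X)) \<le> card (norm X)" using fn_card[OF fn rX(1)] rX(2) by simp
  have "finite (norm (\<alpha> ` X))" using finite_sub[OF norm_sub[OF mor_img_sub[OF \<alpha> X XD]]] .
  then show eq: "norm (\<alpha> ` X) = \<alpha> ` norm X" using card_seteq[OF _ sub] le c by simp
  have "fn (restrict \<alpha> X ` X)"
    by (rule fnI[OF rX(1)]) (use fn_card[OF fn] eq c rX(2) in simp)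
  then show "fn (\<alpha> ` X)" using rX(2) by simp
qed

lemma syl_carrier: "syl (carrier P)"
proof -
  let ?P = "carrier P"
  interpret g: group "aut_grp ?P" by (rule group_aut_grp[OF carrier_sub])
  have "norm ?P = ?P" using sub_norm[OF carrier_sub] norm_carrier by blast
  then have e: "Aut_P P = aut_P ?P" unfolding Aut_P_def aut_P_def by auto
  obtain a m where am: "card (Aut_P P) = p ^ a" "card (F ?P ?P) = p ^ a * m" "\<not> p dvd m"
    using saturated unfolding saturated_fusion_system_def by blast
  have "card (lcosets\<^bsub>aut_grp ?P\<^esub> (aut_P ?P)) * p ^ a = m * p ^ a"
    using g.l_lagrange[OF _ aut_P_subgroup[OF carrier_sub]] finite_aut_grp[OF carrier_sub] am e
    by (simp add: order_def mult.commute)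
  then have "card (lcosets\<^bsub>aut_grp ?P\<^esub> (aut_P ?P)) = m" using prime_gt_0_nat[OF prime_p] by simp
  then show ?thesis unfolding syl_def using am(3) by simp
qed

lemma restrict_aut_pow:
  assumes \<psi>: "\<psi> \<in> F R R" and \<phi>: "\<phi> \<in> F Q Q" and QR: "Q \<subseteq> R" and eq: "\<And>z. z \<in> Q \<Longrightarrow> \<psi> z = \<phi> z"
    and z: "z \<in> Q"
  shows "(\<psi> [^]\<^bsub>aut_grp R\<^esub> (k :: nat)) z = (\<phi> [^]\<^bsub>aut_grp Q\<^esub> k) z"
  using z
proof (induction k arbitrary: z)
  case 0
  then show ?case using QR by (auto simp: idmap_def)
next
  case (Suc k)
  then show ?case using QR eq[OF Suc.prems] aut_mem[OF \<phi> Suc.prems] by (auto simp: compose_def)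
qed

text \<open>Let \<open>m\<close> be the part prime to \<open>p\<close> of the order of the automizer
  of \<open>R\<close>. The power of \<open>\<psi>\<close> with exponent \<open>m * c\<close> has
  p-power order, and the choice of \<open>c\<close> as an inverse of \<open>m\<close> modulo
  \<open>p ^ i\<close> keeps its restriction to \<open>Q\<close> equal to
  \<open>\<phi>\<close>.\<close>

lemma p_element_lift:
  assumes \<psi>: "\<psi> \<in> F R R" and \<phi>: "\<phi> \<in> F Q Q" and QR: "Q \<subseteq> R" and eq: "\<And>z. z \<in> Q \<Longrightarrow> \<psi> z = \<phi> z"
    and pow: "\<phi> [^]\<^bsub>aut_grp Q\<^esub> (p ^ i) = idmap Q"
  obtains \<chi> b where "\<chi> \<in> F R R" "\<And>z. z \<in> Q \<Longrightarrow> \<chi> z = \<phi> z" "\<chi> [^]\<^bsub>aut_grp R\<^esub> (p ^ b) = idmap R"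
proof -
  have R: "subgroup R P" and Q: "subgroup Q P" using F_subgroup \<psi> \<phi> by blast+
  interpret gR: group "aut_grp R" by (rule group_aut_grp[OF R])
  interpret gQ: group "aut_grp Q" by (rule group_aut_grp[OF Q])
  have "order (aut_grp R) \<noteq> 0" using finite_aut_grp[OF R] gR.order_gt_0_iff_finite by simp
  then obtain b m where bm: "order (aut_grp R) = p ^ b * m" "\<not> p dvd m"
    using prime_power_canonical[OF prime_p, of "order (aut_grp R)"] by (metis gr0I mult.commute)
  have "coprime m (p ^ i)" using bm(2) prime_p by (metis coprime_commute coprime_power_left_iff prime_imp_coprime_nat)
  then obtain c where c: "[m * c = Suc 0] (mod p ^ i)" using cong_solve_coprime_nat by blast
  define \<chi> where "\<chi> = \<psi> [^]\<^bsub>aut_grp R\<^esub> (m * c)"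
  have \<chi>: "\<chi> \<in> F R R" unfolding \<chi>_def using gR.nat_pow_closed[of \<psi>] \<psi> by simp
  have "\<phi> [^]\<^bsub>aut_grp Q\<^esub> (m * c) = \<phi> [^]\<^bsub>aut_grp Q\<^esub> Suc 0"
    using gQ.pow_mod_exponent[of \<phi> "p ^ i" "m * c"] gQ.pow_mod_exponent[of \<phi> "p ^ i" "Suc 0"] \<phi> pow c
    by (simp add: cong_def)
  also have "\<dots> = \<phi>" using gQ.nat_pow_eone[of \<phi>] \<phi> by simp
  finally have "\<chi> z = \<phi> z" if "z \<in> Q" for z
    using restrict_aut_pow[OF \<psi> \<phi> QR eq that, of "m * c"] unfolding \<chi>_def by simp
  moreover have "\<chi> [^]\<^bsub>aut_grp R\<^esub> (p ^ b) = idmap R"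
  proof -
    have "\<chi> [^]\<^bsub>aut_grp R\<^esub> (p ^ b) = (\<psi> [^]\<^bsub>aut_grp R\<^esub> (order (aut_grp R))) [^]\<^bsub>aut_grp R\<^esub> c"
      unfolding \<chi>_def bm(1) using \<psi> gR.nat_pow_pow[of \<psi>] by (simp add: ac_simps)
    also have "\<dots> = idmap R" using gR.pow_order_eq_1[of \<psi>] \<psi> gR.nat_pow_one[of c] by simp
    finally show ?thesis .
  qed
  ultimately show ?thesis using that \<chi> by blast
qed

text \<open>If \<open>Aut\<^sub>P(Q)\<close> is not Sylow, some \<open>p\<close>-element \<open>\<phi>\<close> outside it normalizes it, hence extends to
  \<open>N\<^sub>P(Q)\<close>. Moving \<open>N\<^sub>P(Q)\<close> to a fully normalized conjugate turns the extension into conjugation by an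
  element \<open>y\<close> that normalizes the image of \<open>Q\<close>, and \<open>y\<close> comes from \<open>N\<^sub>P(Q)\<close> because \<open>Q\<close> is fully
  normalized.\<close>

lemma fn_imp_syl:
  assumes "subgroup Q P" "fn Q"
  shows "syl Q"
  using assms
proof (induction "card (carrier P) - card Q" arbitrary: Q rule: less_induct)
  case (less Q)
  note Q = less.prems(1) and fnQ = less.prems(2)
  show ?case
  proof (cases "Q = carrier P")
    case True
    then show ?thesis using syl_carrier by simp
  next
    case False
    show ?thesis
    proof (rule ccontr)
      assume ns: "\<not> syl Q"
      interpret gQ: group "aut_grp Q" by (rule group_aut_grp[OF Q])
      let ?R = "norm Q"
      have R: "subgroup ?R P" using norm_sub[OF Q] .
      have QR: "Q \<subseteq> ?R" using sub_norm[OF Q] .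
      obtain j where j: "card (aut_P Q) = p ^ j" using card_aut_P[OF Q] .
      obtain \<phi> i where \<phi>: "\<phi> \<in> F Q Q" "\<phi> \<notin> aut_P Q"
          "\<And>a. a \<in> aut_P Q \<Longrightarrow> \<phi> \<otimes>\<^bsub>aut_grp Q\<^esub> a \<otimes>\<^bsub>aut_grp Q\<^esub> inv\<^bsub>aut_grp Q\<^esub> \<phi> \<in> aut_P Q"
          "\<phi> [^]\<^bsub>aut_grp Q\<^esub> (p ^ i) = idmap Q"
        using gQ.normalizing_p_element[OF _ prime_p aut_P_subgroup[OF Q] j] finite_aut_grp[OF Q] ns
        unfolding syl_def by auto
      have \<phi>im: "\<phi> ` Q = Q" using aut_img[OF \<phi>(1)] .
      \<comment> \<open>\<open>\<phi>\<close> normalizes the group of automorphisms induced by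
        \<open>P\<close>, so it turns conjugation by \<open>x\<close> into conjugation by some
        \<open>y\<close>; the extension axiom thus covers all of \<open>norm Q\<close>.\<close>
      have "\<exists>y\<in>norm (\<phi> ` Q). \<forall>z\<in>Q. \<phi> (x \<otimes> z \<otimes> inv x) = y \<otimes> \<phi> z \<otimes> inv y" if x: "x \<in> ?R" for x
      proof -
        have "conjmap P x Q \<in> aut_P Q" using x unfolding aut_P_def by blast
        then obtain y where y: "y \<in> norm Q"
            "compose Q (compose Q \<phi> (conjmap P x Q)) (finv Q \<phi>) = conjmap P y Q"
          using \<phi>(3) inv_aut_grp[OF \<phi>(1)] unfolding aut_P_def by fastforce
        have "\<phi> (x \<otimes> z \<otimes> inv x) = y \<otimes> \<phi> z \<otimes> inv y" if z: "z \<in> Q" for z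
          using fun_cong[OF y(2), of "\<phi> z"] z aut_mem[OF \<phi>(1) z] finv_left[OF F_mor[OF \<phi>(1)] z]
          by (simp add: compose_def conjmap_def)
        then show ?thesis using y(1) \<phi>im by auto
      qed
      then obtain \<psi> where \<psi>: "\<psi> \<in> mor ?R" "\<forall>z\<in>Q. \<psi> z = \<phi> z"
        using mor_extend[OF F_mor[OF \<phi>(1)] _ R order_refl QR] fnQ \<phi>im by auto
      have \<psi>Q: "\<psi> ` Q = Q" using \<psi>(2) \<phi>im by (metis image_cong)
      have "\<psi> ` ?R = ?R" using fn_norm_img(1)[OF Q fnQ \<psi>(1) order_refl] \<psi>Q by simp
      then have \<psi>a: "\<psi> \<in> F ?R ?R" using mor_autI \<psi>(1) by blast
      \<comment> \<open>The extension is replaced by one of p-power order, since only a p-subgroup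
        can be conjugated into the automorphisms induced by \<open>P\<close>.\<close>
      obtain \<chi> b where \<chi>: "\<chi> \<in> F ?R ?R" "\<And>z. z \<in> Q \<Longrightarrow> \<chi> z = \<phi> z" "\<chi> [^]\<^bsub>aut_grp ?R\<^esub> (p ^ b) = idmap ?R"
        using p_element_lift[OF \<psi>a \<phi>(1) QR _ \<phi>(4)] \<psi>(2) by blast
      interpret gR: group "aut_grp ?R" by (rule group_aut_grp[OF R])
      let ?B = "generate (aut_grp ?R) {\<chi>}"
      have B: "subgroup ?B (aut_grp ?R)" using \<chi>(1) by (intro gR.generate_is_subgroup) simp
      have "card ?B dvd p ^ b"
        using gR.generate_pow_card[of \<chi>] gR.pow_eq_id[of \<chi> "p ^ b"] \<chi>(1,3) by simp
      then obtain k where k: "card ?B = p ^ k" using divides_primepow_nat[OF prime_p] by auto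
      obtain \<beta> where \<beta>: "\<beta> \<in> mor ?R" "fn (\<beta> ` ?R)" using fn_representative[OF R] .
      have "card Q < card ?R" using norm_grows_card[OF Q False] .
      moreover have "card ?R \<le> card (carrier P)" using card_mono[OF finite_carrier sub_subset[OF R]] .
      ultimately have "syl (\<beta> ` ?R)"
        using less.hyps[OF _ mor_img_sub[OF \<beta>(1) R order_refl] \<beta>(2)]
          ihom_card[OF mor_ihom[OF \<beta>(1)] order_refl] by simp
      then obtain \<tau> where \<tau>: "\<tau> \<in> mor ?R"
          "\<And>b. b \<in> ?B \<Longrightarrow> \<exists>y\<in>norm (\<beta> ` ?R). \<forall>z\<in>?R. \<tau> (b z) = y \<otimes> \<tau> z \<otimes> inv y"
        using syl_conj_twist[OF \<beta>(1) _ B k] by metis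
      obtain y where y: "y \<in> norm (\<beta> ` ?R)" "\<And>z. z \<in> ?R \<Longrightarrow> \<tau> (\<chi> z) = y \<otimes> \<tau> z \<otimes> inv y"
        using \<tau>(2)[of \<chi>] by (auto intro: generate.incl)
      have "y \<in> norm (\<tau> ` Q)"
      proof (rule normI[OF mor_img_sub[OF \<tau>(1) Q QR] norm_carrier[OF y(1)]])
        fix w assume "w \<in> \<tau> ` Q"
        then obtain z where z: "z \<in> Q" "w = \<tau> z" by blast
        then have "y \<otimes> w \<otimes> inv y = \<tau> (\<phi> z)" using y(2)[of z] QR \<chi>(2) by auto
        then show "y \<otimes> w \<otimes> inv y \<in> \<tau> ` Q" using aut_mem[OF \<phi>(1) z(1)] by simp
      qed
      \<comment> \<open>As \<open>Q\<close> is fully normalized, the normalizer of its image under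
        \<open>\<tau>\<close> is the image of \<open>norm Q\<close>, so \<open>y\<close> has a
        preimage there.\<close>
      then obtain x where x: "x \<in> ?R" "y = \<tau> x"
        using fn_norm_img(1)[OF Q fnQ \<tau>(1) order_refl] by blast
      have "\<phi> z = x \<otimes> z \<otimes> inv x" if z: "z \<in> Q" for z
      proof -
        have zR: "z \<in> ?R" using z QR by blast
        have "\<tau> (\<phi> z) = \<tau> (x \<otimes> z \<otimes> inv x)"
          using y(2)[OF zR] \<chi>(2)[OF z] ihom_conj[OF R mor_ihom[OF \<tau>(1)] x(1) zR] x(2) by simp
        moreover have "\<phi> z \<in> ?R" using aut_mem[OF \<phi>(1) z] QR by blast
        moreover have "x \<otimes> z \<otimes> inv x \<in> ?R" using sub_conj[OF R x(1) zR] .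
        ultimately show ?thesis using inj_onD[OF ihomD(3)[OF mor_ihom[OF \<tau>(1)]]] by blast
      qed
      then have "\<phi> = conjmap P x Q"
        using mor_ext[OF F_mor[OF \<phi>(1)] mor_conj[OF Q norm_carrier[OF x(1)]]] by (simp add: conjmap_def)
      then show False using \<phi>(2) x(1) unfolding aut_P_def by blast
    qed
  qed
qed

lemma extend_to_norm:
  assumes \<beta>: "\<beta> \<in> mor X" and fn: "fn (\<beta> ` X)"
  obtains \<gamma> where "\<gamma> \<in> mor (norm X)" "\<gamma> ` X = \<beta> ` X"
  using extend_to_norm_if_syl[OF \<beta> fn fn_imp_syl[OF mor_img_sub[OF \<beta> mor_sub[OF \<beta>] order_refl] fn]] by blast

text \<open>The centralizer of the image lies in its normalizer, which is the image of
  \<open>norm W\<close> because \<open>W\<close> is fully normalized; so both conditions can be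
  checked in \<open>W\<close>.\<close>

lemma fn_transport:
  assumes W: "subgroup W P" and fn: "fn W" and cW: "cent W \<subseteq> W" and \<alpha>: "\<alpha> \<in> mor D" and D: "norm W \<subseteq> D"
  shows "cent (\<alpha> ` W) \<subseteq> \<alpha> ` W" "power_cent (\<alpha> ` W) \<subseteq> \<alpha> ` power_cent W"
proof -
  have Ds: "subgroup D P" using mor_sub[OF \<alpha>] .
  note ih = mor_ihom[OF \<alpha>]
  have WD: "W \<subseteq> D" using sub_norm[OF W] D by blast
  have W': "subgroup (\<alpha> ` W) P" using mor_img_sub[OF \<alpha> W WD] .
  note n = fn_norm_img(1)[OF W fn \<alpha> D]
  show "cent (\<alpha> ` W) \<subseteq> \<alpha> ` W"
  proof
    fix y assume y: "y \<in> cent (\<alpha> ` W)"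
    then obtain x where x: "x \<in> norm W" "y = \<alpha> x" using cent_norm[OF W'] n by blast
    then show "y \<in> \<alpha> ` W" using ihom_cent[OF Ds ih WD, of x] y D cW by blast
  qed
  show "power_cent (\<alpha> ` W) \<subseteq> \<alpha> ` power_cent W"
  proof
    fix y assume y: "y \<in> power_cent (\<alpha> ` W)"
    then obtain x where x: "x \<in> norm W" "y = \<alpha> x" using n unfolding power_cent_def by blast
    have "\<alpha> x \<in> cent (\<alpha> ` center_powers W)"
      using y x(2) ihom_center_powers[OF Ds ih WD] unfolding power_cent_def by simp
    moreover have "center_powers W \<subseteq> D"
      using center_powers_subset[OF W] WD unfolding center_of_def by blast
    ultimately have "x \<in> cent (center_powers W)" using ihom_cent[OF Ds ih _, of _ x] x(1) D by blast
    then show "y \<in> \<alpha> ` power_cent W" using x unfolding power_cent_def by blast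
  qed
qed

lemma power_cent_img:
  assumes W: "subgroup W P" and \<psi>: "\<psi> \<in> mor Y" and TY: "power_cent W \<subseteq> Y" and WW: "\<psi> ` W = W"
  shows "\<psi> ` power_cent W = power_cent W"
proof -
  note T = power_cent_sub[OF W]
  have Y: "subgroup Y P" using mor_sub[OF \<psi>] .
  note ih = mor_ihom[OF \<psi>]
  have WY: "W \<subseteq> Y" using T(2) TY by blast
  have UY: "center_powers W \<subseteq> Y" using center_powers_subset[OF W] WY unfolding center_of_def by blast
  have U: "\<psi> ` center_powers W = center_powers W" using ihom_center_powers[OF Y ih WY] WW by simp
  have "\<psi> ` power_cent W \<subseteq> power_cent W"
  proof
    fix y assume "y \<in> \<psi> ` power_cent W"
    then obtain t where t: "t \<in> power_cent W" "y = \<psi> t" by blast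
    have tY: "t \<in> Y" using t TY by blast
    show "y \<in> power_cent W"
      using ihom_norm[OF Y ih W WY tY] ihom_cent[OF Y ih UY tY] t WW U unfolding power_cent_def by simp
  qed
  then show ?thesis
    using ihom_card[OF ih TY] finite_sub[OF T(1)] by (simp add: card_seteq)
qed

text \<open>The kernel of the action of the automizer of \<open>W\<close> on
  \<open>center_powers W\<close>.\<close>

definition fixing_aut :: "'a set \<Rightarrow> ('a \<Rightarrow> 'a) set" where
  "fixing_aut W = {\<theta> \<in> F W W. \<forall>u\<in>center_powers W. \<theta> u = u}"

lemma aut_center_powers:
  assumes W: "subgroup W P" and \<theta>: "\<theta> \<in> F W W"
  shows "\<theta> ` center_powers W = center_powers W"
  using ihom_center_powers[OF W mor_ihom[OF F_mor[OF \<theta>]] order_refl] aut_img[OF \<theta>] by simp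

lemma center_powers_mem: "subgroup W P \<Longrightarrow> u \<in> center_powers W \<Longrightarrow> u \<in> W"
  using center_powers_subset[of W] unfolding center_of_def by blast

lemma fixing_aut_normal:
  assumes W: "subgroup W P"
  shows "fixing_aut W \<lhd> aut_grp W"
proof -
  interpret g: group "aut_grp W" by (rule group_aut_grp[OF W])
  note mem = center_powers_mem[OF W]
  have inv: "finv W \<theta> u = u" if "\<theta> \<in> fixing_aut W" "u \<in> center_powers W" for \<theta> u
    using that finv_left[OF F_mor, of \<theta> W W u] mem unfolding fixing_aut_def by auto
  have "subgroup (fixing_aut W) (aut_grp W)"
  proof (rule g.subgroupI)
    show "fixing_aut W \<subseteq> carrier (aut_grp W)" unfolding fixing_aut_def by auto
    have "idmap W \<in> fixing_aut W" unfolding fixing_aut_def using F_id[OF W] mem by (simp add: idmap_def)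
    then show "fixing_aut W \<noteq> {}" by blast
    fix \<theta> assume \<theta>: "\<theta> \<in> fixing_aut W"
    then have \<theta>F: "\<theta> \<in> F W W" unfolding fixing_aut_def by blast
    show "inv\<^bsub>aut_grp W\<^esub> \<theta> \<in> fixing_aut W"
      using inv_aut_grp[OF \<theta>F] finv_aut[OF \<theta>F] inv[OF \<theta>] unfolding fixing_aut_def by simp
    fix \<eta> assume \<eta>: "\<eta> \<in> fixing_aut W"
    show "\<theta> \<otimes>\<^bsub>aut_grp W\<^esub> \<eta> \<in> fixing_aut W"
      using \<theta> \<eta> F_compose mem unfolding fixing_aut_def by (auto simp: compose_def)
  qed
  moreover have "\<eta> \<otimes>\<^bsub>aut_grp W\<^esub> \<theta> \<otimes>\<^bsub>aut_grp W\<^esub> inv\<^bsub>aut_grp W\<^esub> \<eta> \<in> fixing_aut W"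
    if \<eta>: "\<eta> \<in> F W W" and \<theta>: "\<theta> \<in> fixing_aut W" for \<eta> \<theta>
  proof -
    have \<theta>F: "\<theta> \<in> F W W" using \<theta> unfolding fixing_aut_def by blast
    have "\<eta> (\<theta> (finv W \<eta> u)) = u" if u: "u \<in> center_powers W" for u
    proof -
      obtain v where v: "v \<in> center_powers W" "u = \<eta> v" using u aut_center_powers[OF W \<eta>] by blast
      then show ?thesis using finv_left[OF F_mor[OF \<eta>] mem[OF v(1)]] \<theta> unfolding fixing_aut_def by simp
    qed
    then show ?thesis
      using inv_aut_grp[OF \<eta>] F_compose[OF F_compose[OF finv_aut[OF \<eta>] \<theta>F] \<eta>] F_compose[OF finv_aut[OF \<eta>] F_compose[OF \<theta>F \<eta>]] mem
        aut_mem[OF finv_aut[OF \<eta>]]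
      unfolding fixing_aut_def by (simp add: compose_def)
  qed
  ultimately show ?thesis using g.normal_inv_iff by simp
qed

text \<open>A Frattini argument for the normal subgroup \<open>fixing_aut W\<close> of the automizer of \<open>W\<close>: up to a
  factor in this subgroup, \<open>\<phi>\<close> extends to the product of its domain with \<open>power_cent W\<close>.\<close>

lemma frattini:
  assumes W: "subgroup W P" and fn: "fn W"
    and R: "subgroup R P" "W \<subseteq> R" "R \<subseteq> norm W" and \<phi>: "\<phi> \<in> mor R" and \<phi>W: "\<phi> ` W = W"
  obtains \<psi> where "\<psi> \<in> mor (power_cent W <#> R)" "\<psi> ` W = W" "\<And>u. u \<in> center_powers W \<Longrightarrow> \<psi> u = \<phi> u"
proof -
  let ?T = "power_cent W" let ?Y = "?T <#> R" let ?A = "aut_grp W" let ?L = "fixing_aut W"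
  note T = power_cent_sub[OF W]
  define h where "h = restrict \<phi> W"
  have h: "h \<in> mor W" unfolding h_def using mor_restrict[OF \<phi> W R(2)] .
  have him: "h ` W = W" unfolding h_def using restrict_img[OF order_refl] \<phi>W by simp
  have hz: "h z = \<phi> z" if "z \<in> W" for z unfolding h_def using that by simp
  have hF: "h \<in> F W W" using mor_autI[OF h him] .
  have Y: "subgroup ?Y P" using set_mult_sub[OF T(1) R(1)] R(3) T(3) by blast
  have TN: "?T \<subseteq> norm W" unfolding power_cent_def by blast
  have YN: "?Y \<subseteq> norm W"
    using TN R(3) subgroup.m_closed[OF norm_sub[OF W]] unfolding set_mult_def by blast
  have TY: "?T \<subseteq> ?Y"
    using subgroup.one_closed[OF R(1)] sub_carrier[OF T(1)] unfolding set_mult_def by force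
  have WY: "W \<subseteq> ?Y" using T(2) TY by blast
  interpret g: group ?A by (rule group_aut_grp[OF W])
  have syl: "syl (h ` W)" using fn_imp_syl[OF W fn] him by simp
  \<comment> \<open>The automorphisms of \<open>W\<close> induced by the product \<open>?Y\<close>.
    Once an element of \<open>fixing_aut W\<close> conjugates their transports into those induced by
    \<open>P\<close>, the corrected map extends to \<open>?Y\<close>.\<close>
  let ?B = "(\<lambda>g. conjmap P g W) ` ?Y"
  have B: "subgroup ?B ?A" using conj_image_subgroup[OF W Y YN] .
  obtain k where k: "card ?B = p ^ k" using p_group_image[OF Y norm_sub[OF W] YN conj_hom[OF W]] .
  have L: "?L \<lhd> aut_grp (h ` W)" using fixing_aut_normal[OF W] him by simp
  have tw: "group_hom ?A ?A (twist W h)" using twist_hom[OF h] him by simp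
  have cF: "conjmap P x W \<in> F W W" if "x \<in> norm W" for x
    using F_conj[OF W W norm_carrier[OF that]] normD[OF that] by blast
  have "twist W h (conjmap P x W) \<in> ?L <#>\<^bsub>?A\<^esub> aut_P W" if x: "x \<in> ?Y" for x
  proof -
    obtain t r where tr: "t \<in> ?T" "r \<in> R" "x = t \<otimes> r" using x unfolding set_mult_def by blast
    have tn: "t \<in> norm W" "r \<in> norm W" using tr TN R(3) by auto
    have "conjmap P x W = compose W (conjmap P t W) (conjmap P r W)"
      using group_hom.hom_mult[OF conj_hom[OF W], of t r] tn tr(3) by simp
    then have e: "twist W h (conjmap P x W) = twist W h (conjmap P t W) \<otimes>\<^bsub>?A\<^esub> twist W h (conjmap P r W)"
      using group_hom.hom_mult[OF tw, of "conjmap P t W" "conjmap P r W"] cF tn by simp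
    have tF: "twist W h (conjmap P z W) \<in> F W W" if "z \<in> norm W" for z
      using twist_aut[OF h cF[OF that]] him by simp
    \<comment> \<open>The factor from \<open>power_cent W\<close>: conjugation by \<open>t\<close>
      fixes the powers, and so does its transport by \<open>h\<close>, since \<open>h\<close>
      permutes them.\<close>
    have "twist W h (conjmap P t W) u = u" if u: "u \<in> center_powers W" for u
    proof -
      obtain v where v: "v \<in> center_powers W" "u = h v" using u aut_center_powers[OF W hF] by blast
      have vW: "v \<in> W" using center_powers_mem[OF W v(1)] .
      have tc: "t \<in> carrier P" "v \<in> carrier P" using norm_carrier[OF tn(1)] sub_carrier[OF W vW] by auto
      have "t \<otimes> v = v \<otimes> t" using cent_comm[of t "center_powers W" v] tr(1) v(1) unfolding power_cent_def by blast
      then have "t \<otimes> v \<otimes> inv t = v" using conj_eq_iff[of t v v] tc by simp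
      then show ?thesis using twist_apply[OF h vW, of "conjmap P t W"] v(2) vW by (simp add: conjmap_def)
    qed
    then have 1: "twist W h (conjmap P t W) \<in> ?L" unfolding fixing_aut_def using tF[OF tn(1)] by blast
    have rN: "\<phi> r \<in> norm W" using ihom_norm[OF R(1) mor_ihom[OF \<phi>] W R(2) tr(2)] tn(2) \<phi>W by simp
    \<comment> \<open>The factor from \<open>R\<close>: there \<open>\<phi>\<close> is defined, so
      the transport is conjugation by \<open>\<phi> r\<close>.\<close>
    have "twist W h (conjmap P r W) = conjmap P (\<phi> r) W"
    proof (rule mor_ext[of _ W])
      show "twist W h (conjmap P r W) \<in> mor W" using F_mor[OF tF[OF tn(2)]] .
      show "conjmap P (\<phi> r) W \<in> mor W" using F_mor[OF cF[OF rN]] .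
      fix y assume y: "y \<in> W"
      then obtain z where z: "z \<in> W" "y = h z" using him by blast
      have "twist W h (conjmap P r W) y = \<phi> (r \<otimes> z \<otimes> inv r)"
        using twist_apply[OF h z(1), of "conjmap P r W"] z hz normD[OF tn(2) z(1)] by (simp add: conjmap_def)
      also have "\<dots> = \<phi> r \<otimes> \<phi> z \<otimes> inv (\<phi> r)"
        using ihom_conj[OF R(1) mor_ihom[OF \<phi>] tr(2), of z] z(1) R(2) by blast
      finally show "twist W h (conjmap P r W) y = conjmap P (\<phi> r) W y"
        using y z hz by (simp add: conjmap_def)
    qed
    then have "twist W h (conjmap P r W) \<in> aut_P W" using rN unfolding aut_P_def by blast
    then show ?thesis using e 1 unfolding set_mult_def by blast
  qed
  then have BL: "twist W h ` ?B \<subseteq> ?L <#>\<^bsub>aut_grp (h ` W)\<^esub> aut_P (h ` W)" using him by auto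
  obtain \<gamma> l where \<gamma>: "\<gamma> \<in> mor W" "\<gamma> ` W = W" and l: "l \<in> ?L" "\<And>z. z \<in> W \<Longrightarrow> l (\<gamma> z) = h z"
    and N: "\<And>b. b \<in> ?B \<Longrightarrow> \<exists>y\<in>norm W. \<forall>z\<in>W. \<gamma> (b z) = y \<otimes> \<gamma> z \<otimes> inv y"
  proof (rule syl_conj_twist_normal[OF h syl B k L BL])
    fix \<gamma> l
    assume *: "\<gamma> \<in> mor W" "\<gamma> ` W = h ` W" "l \<in> ?L" "\<And>z. z \<in> W \<Longrightarrow> l (\<gamma> z) = h z"
      "\<And>b. b \<in> ?B \<Longrightarrow> \<exists>y\<in>norm (h ` W). \<forall>z\<in>W. \<gamma> (b z) = y \<otimes> \<gamma> z \<otimes> inv y"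
    show thesis by (rule that[OF *[unfolded him]])
  qed
  have "\<forall>x\<in>?Y. \<exists>y\<in>norm (\<gamma> ` W). \<forall>z\<in>W. \<gamma> (x \<otimes> z \<otimes> inv x) = y \<otimes> \<gamma> z \<otimes> inv y"
  proof
    fix x assume "x \<in> ?Y"
    then show "\<exists>y\<in>norm (\<gamma> ` W). \<forall>z\<in>W. \<gamma> (x \<otimes> z \<otimes> inv x) = y \<otimes> \<gamma> z \<otimes> inv y"
      using N[of "conjmap P x W"] \<gamma>(2) by (auto simp: conjmap_def)
  qed
  then obtain \<psi> where \<psi>: "\<psi> \<in> mor ?Y" "\<forall>z\<in>W. \<psi> z = \<gamma> z"
    using mor_extend[OF \<gamma>(1) _ Y YN WY] fn \<gamma>(2) by auto
  have "\<psi> ` W = W" using \<psi>(2) \<gamma>(2) by (metis image_cong)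
  \<comment> \<open>On \<open>W\<close> the map \<open>\<phi>\<close> is \<open>l\<close> after
    \<open>\<gamma>\<close>, and \<open>l\<close> fixes every power. So \<open>\<psi>\<close>, which
    extends \<open>\<gamma>\<close>, agrees with \<open>\<phi>\<close> on the powers, though perhaps
    not on all of \<open>W\<close>.\<close>
  moreover have "\<psi> u = \<phi> u" if u: "u \<in> center_powers W" for u
  proof -
    have uW: "u \<in> W" using center_powers_mem[OF W u] .
    have "\<gamma> ` center_powers W = center_powers W"
      using aut_center_powers[OF W mor_autI[OF \<gamma>]] .
    then have "\<gamma> u \<in> center_powers W" using u by blast
    then have "l (\<gamma> u) = \<gamma> u" using l(1) unfolding fixing_aut_def by blast
    then show ?thesis using l(2)[OF uW] hz[OF uW] \<psi>(2) uW by simp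
  qed
  ultimately show ?thesis using that \<psi>(1) by blast
qed

text \<open>Z(P) centralizes \<open>W\<close>, so it lies in \<open>W\<close> and therefore in
  Z(W).\<close>

lemma center_powers_carrier:
  assumes W: "subgroup W P" and cW: "cent W \<subseteq> W"
  shows "center_powers (carrier P) \<subseteq> center_powers W"
proof -
  have "center_of (carrier P) \<subseteq> cent W"
    unfolding center_of_def using cent_mono[OF sub_subset[OF W]] by blast
  then have "center_of (carrier P) \<subseteq> center_of W" unfolding center_of_def[of W] using cW by blast
  then show ?thesis unfolding center_powers_def by blast
qed

lemma gen_closed_F:
  "gen_closed P F {C_F P F W, N_F P F V} F"
  unfolding gen_closed_def
proof (intro conjI allI impI)
  fix Q R Q' R' \<phi>
  assume a: "\<phi> \<in> F Q R" "subgroup Q' P" "subgroup R' P" "Q' \<subseteq> Q" "\<phi> ` Q' \<subseteq> R'"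
  have "restrict \<phi> Q' \<in> mor Q'" using mor_restrict[OF F_mor[OF a(1)] a(2,4)] .
  then show "restrict \<phi> Q' \<in> F Q' R'"
    using F_into a(3,5) restrict_img[OF order_refl, of \<phi> Q'] by simp
qed (auto simp: C_F_def N_F_def intro: F_id F_compose)

end

section \<open>Generation\<close>

text \<open>The generated subsystem is an intersection over closed families, so an arbitrary closed
  family \<open>G\<close> is fixed and shown to contain \<open>F\<close>.\<close>

locale fusion_generation = fusion +
  fixes G :: "'a homs"
  assumes gen: "gen_closed P F {C_F P F (agemo1 P p (grp_center P)), N_F P F (thompson P)} G"
begin

abbreviation gmor :: "'a set \<Rightarrow> ('a \<Rightarrow> 'a) set" where "gmor Q \<equiv> G Q (carrier P)"

lemma G_F: "G Q R \<subseteq> F Q R"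
  using gen[unfolded gen_closed_def, THEN conjunct1] by blast

lemma G_gens:
  "C_F P F (agemo1 P p (grp_center P)) Q R \<subseteq> G Q R" "N_F P F (thompson P) Q R \<subseteq> G Q R"
  using gen[unfolded gen_closed_def, THEN conjunct2, THEN conjunct1] by simp_all

lemma G_restrict:
  assumes "\<phi> \<in> gmor Q" "subgroup X P" "X \<subseteq> Q" "subgroup S P" "\<phi> ` X \<subseteq> S"
  shows "restrict \<phi> X \<in> G X S"
  using gen[unfolded gen_closed_def, THEN conjunct2, THEN conjunct2, THEN conjunct2, THEN conjunct2,
      rule_format, OF assms(1,2,4,3,5) sub_subset[OF assms(4)]] .

lemma gmor_restrict:
  assumes "\<phi> \<in> gmor Q" "subgroup X P" "X \<subseteq> Q"
  shows "restrict \<phi> X \<in> gmor X"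
proof -
  have m: "\<phi> \<in> mor Q" using assms(1) G_F by blast
  have "\<phi> ` X \<subseteq> carrier P" using ihomD(2)[OF mor_ihom[OF m]] assms(3) by blast
  then show ?thesis using G_restrict[OF assms carrier_sub] by blast
qed

lemma gmor_into:
  assumes "\<phi> \<in> gmor Q" "subgroup S P" "\<phi> ` Q \<subseteq> S"
  shows "\<phi> \<in> G Q S"
proof -
  have m: "\<phi> \<in> mor Q" using assms(1) G_F by blast
  have "restrict \<phi> Q = \<phi>" using ihomD(1)[OF mor_ihom[OF m]] by (rule extensional_restrict)
  then show ?thesis using G_restrict[OF assms(1) mor_sub[OF m] order_refl assms(2,3)] by simp
qed

lemma gmor_compose:
  assumes "\<phi> \<in> gmor Q" "\<psi> \<in> gmor R" "\<phi> ` Q \<subseteq> R"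
  shows "compose Q \<psi> \<phi> \<in> gmor Q"
proof -
  have R: "subgroup R P" using assms(2) G_F mor_sub by blast
  have "\<phi> \<in> G Q R" using gmor_into[OF assms(1) R assms(3)] .
  then show ?thesis
    using gen[unfolded gen_closed_def, THEN conjunct2, THEN conjunct2, THEN conjunct2, THEN conjunct1] assms(2)
    by blast
qed

lemma set_mult_absorb:
  assumes "subgroup R P" "subgroup W P" "W \<subseteq> R"
  shows "W <#> R = R"
proof
  show "W <#> R \<subseteq> R" unfolding set_mult_def using subgroup.m_closed[OF assms(1)] assms(3) by blast
  show "R \<subseteq> W <#> R"
    unfolding set_mult_def using subgroup.one_closed[OF assms(2)] sub_carrier[OF assms(1)] by force
qed

text \<open>If \<open>R\<close> contains J(P), the product of J(P) and \<open>R\<close> is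
  \<open>R\<close>, so \<open>\<phi>\<close> is its own witness in the definition of
  \<open>N_F\<close>. Normality of J(P) in \<open>P\<close> takes care of the domain and
  target.\<close>

lemma gmor_thompson:
  assumes \<phi>: "\<phi> \<in> mor R" and J: "thompson P \<subseteq> R" "\<phi> ` thompson P = thompson P"
  shows "\<phi> \<in> gmor R"
proof -
  let ?J = "thompson P"
  have R: "subgroup R P" using mor_sub[OF \<phi>] .
  have Js: "subgroup ?J P" using J_sub(1)[OF carrier_sub] J_carrier by simp
  have "norm (carrier P) \<subseteq> norm ?J" using norm_subset_norm_J[OF carrier_sub] J_carrier by simp
  then have n: "carrier P \<subseteq> norm ?J" using sub_norm[OF carrier_sub] by blast
  have "\<phi> \<in> N_F P F ?J R (carrier P)"
    unfolding N_F_def using \<phi> R carrier_sub n sub_subset[OF R] J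
      set_mult_absorb[OF R Js J(1)] set_mult_absorb[OF carrier_sub Js sub_subset[OF Js]] by auto
  then show ?thesis using G_gens(2) by blast
qed

text \<open>The subgroup generated by the powers is central in \<open>P\<close> and lies in
  \<open>R\<close>, so \<open>\<phi>\<close> is its own witness in the definition of
  \<open>C_F\<close>; it fixes this subgroup because it fixes the generators.\<close>

lemma gmor_fixing:
  assumes \<phi>: "\<phi> \<in> mor R" and sub: "center_powers (carrier P) \<subseteq> R"
    and fixd: "\<And>z. z \<in> center_powers (carrier P) \<Longrightarrow> \<phi> z = z"
  shows "\<phi> \<in> gmor R"
proof -
  let ?W = "agemo1 P p (grp_center P)"
  have R: "subgroup R P" using mor_sub[OF \<phi>] .
  have gc: "grp_center P = center_of (carrier P)"
    unfolding grp_center_def center_of_def grp_centralizer_def by auto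
  have W: "?W = generate P (center_powers (carrier P))"
    unfolding agemo1_def center_powers_def gc by (simp add: Setcompr_eq_image)
  have cpc: "center_powers (carrier P) \<subseteq> carrier P" using sub sub_subset[OF R] by blast
  have Ws: "subgroup ?W P" unfolding W using generate_is_subgroup[OF cpc] .
  have WR: "?W \<subseteq> R" unfolding W using generate_subgroup_incl[OF sub R] .
  have "?W \<subseteq> center_of (carrier P)" unfolding W
    using generate_subgroup_incl[OF center_powers_subset[OF carrier_sub] center_of_sub[OF carrier_sub]] .
  then have cen: "carrier P \<subseteq> cent ?W"
    unfolding center_of_def grp_centralizer_def by auto
  have Wfix: "\<phi> w = w" if "w \<in> ?W" for w
    using that unfolding W
  proof (induction rule: generate.induct)
    case one
    then show ?case using group_hom.hom_one[OF ihom_group_hom[OF R mor_ihom[OF \<phi>]]] by simp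
  next
    case (incl h)
    then show ?case using fixd by blast
  next
    case (inv h)
    then show ?case using fixd[of h] ihom_inv[OF R mor_ihom[OF \<phi>], of h] sub by auto
  next
    case (eng h1 h2)
    then have "h1 \<in> R" "h2 \<in> R" using WR unfolding W by auto
    then show ?case using eng ihomD(4)[OF mor_ihom[OF \<phi>]] by simp
  qed
  have "\<phi> \<in> C_F P F ?W R (carrier P)"
    unfolding C_F_def using \<phi> R carrier_sub cen sub_subset[OF R] Wfix
      set_mult_absorb[OF R Ws WR] set_mult_absorb[OF carrier_sub Ws sub_subset[OF Ws]] by auto
  then show ?thesis using G_gens(1) by blast
qed

text \<open>\<open>\<phi>\<close> factors as \<open>\<kappa>\<close> after a restriction of
  \<open>\<psi>\<close>. A p-th power \<open>z\<close> from Z(P) is one from Z(W), hence the image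
  under \<open>\<psi>\<close> of such a power \<open>u\<close>, at which \<open>\<phi>\<close> takes
  the same value; so \<open>\<kappa>\<close> fixes \<open>z\<close> and lies in
  \<open>G\<close>.\<close>

lemma gmor_frattini:
  assumes W: "subgroup W P" and cW: "cent W \<subseteq> W" and R: "W \<subseteq> R" and \<phi>: "\<phi> \<in> mor R"
    and \<psi>: "\<psi> \<in> gmor Y" and Y: "R \<subseteq> Y" and \<psi>W: "\<psi> ` W = W"
    and eq: "\<And>u. u \<in> center_powers W \<Longrightarrow> \<psi> u = \<phi> u"
  shows "\<phi> \<in> gmor R"
proof -
  have Rs: "subgroup R P" using mor_sub[OF \<phi>] .
  define \<rho> where "\<rho> = restrict \<psi> R"
  have \<rho>: "\<rho> \<in> gmor R" unfolding \<rho>_def using gmor_restrict[OF \<psi> Rs Y] .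
  have \<rho>m: "\<rho> \<in> mor R" using \<rho> G_F by blast
  have \<psi>m: "\<psi> \<in> mor Y" using \<psi> G_F by blast
  have WY: "W \<subseteq> Y" using R Y by blast
  define \<kappa> where "\<kappa> = compose (\<rho> ` R) \<phi> (finv R \<rho>)"
  have \<kappa>: "\<kappa> \<in> mor (\<rho> ` R)"
    unfolding \<kappa>_def using mor_compose[OF finv_mor[OF \<rho>m] \<phi>] finv_img[OF \<rho>m order_refl] by simp
  have \<kappa>app: "\<kappa> (\<rho> x) = \<phi> x" if "x \<in> R" for x
    unfolding \<kappa>_def using that finv_left[OF \<rho>m that] by (simp add: compose_def)
  have U: "\<psi> ` center_powers W = center_powers W"
    using ihom_center_powers[OF mor_sub[OF \<psi>m] mor_ihom[OF \<psi>m] WY] \<psi>W by simp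
  have key: "\<exists>u\<in>R. z = \<rho> u \<and> \<kappa> z = z" if z: "z \<in> center_powers (carrier P)" for z
  proof -
    obtain u where u: "u \<in> center_powers W" "z = \<psi> u"
      using z center_powers_carrier[OF W cW] U by blast
    have uR: "u \<in> R" using center_powers_mem[OF W u(1)] R by blast
    then have zu: "z = \<rho> u" using u(2) unfolding \<rho>_def by simp
    have "\<kappa> z = z" using \<kappa>app[OF uR] zu u(2) eq[OF u(1)] by simp
    then show ?thesis using uR zu by blast
  qed
  have "\<kappa> \<in> gmor (\<rho> ` R)"
  proof (rule gmor_fixing[OF \<kappa>])
    show "center_powers (carrier P) \<subseteq> \<rho> ` R" using key by blast
    show "\<kappa> z = z" if "z \<in> center_powers (carrier P)" for z using key[OF that] by blast
  qed
  then have "compose R \<kappa> \<rho> \<in> gmor R" using gmor_compose[OF \<rho>] by blast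
  moreover have "compose R \<kappa> \<rho> = \<phi>"
    by (rule mor_ext[OF _ \<phi>]) (use calculation G_F \<kappa>app in \<open>auto simp: compose_def\<close>)
  ultimately show ?thesis by simp
qed

text \<open>This says that \<open>G\<close> contains the part of the normalizer system of
  \<open>W\<close> whose domains contain \<open>W\<close>; for such domains the extension required
  in \<open>N_F\<close> is the morphism itself.\<close>

definition controlled :: "'a set \<Rightarrow> bool" where
  "controlled W \<longleftrightarrow> (\<forall>R \<phi>. W \<subseteq> R \<longrightarrow> R \<subseteq> norm W \<longrightarrow> \<phi> \<in> mor R \<longrightarrow> \<phi> ` W = W \<longrightarrow> \<phi> \<in> gmor R)"

lemma controlledI:
  "(\<And>R \<phi>. W \<subseteq> R \<Longrightarrow> R \<subseteq> norm W \<Longrightarrow> \<phi> \<in> mor R \<Longrightarrow> \<phi> ` W = W \<Longrightarrow> \<phi> \<in> gmor R) \<Longrightarrow> controlled W"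
  unfolding controlled_def by simp

lemma controlledD:
  "controlled W \<Longrightarrow> W \<subseteq> R \<Longrightarrow> R \<subseteq> norm W \<Longrightarrow> \<phi> \<in> mor R \<Longrightarrow> \<phi> ` W = W \<Longrightarrow> \<phi> \<in> gmor R"
  unfolding controlled_def by simp

text \<open>Conjugation by \<open>\<alpha>\<close> turns \<open>\<phi>\<close> into a morphism that
  stabilizes the controlled image of \<open>X\<close>. Since \<open>\<alpha>\<close> and its inverse
  have domains of order more than \<open>m\<close>, they lie in \<open>G\<close>, and
  \<open>\<phi>\<close> is recovered by composition.\<close>

lemma controlled_transport:
  assumes X: "subgroup X P" and \<alpha>: "\<alpha> \<in> mor (norm X)" and c: "controlled (\<alpha> ` X)"
    and big: "\<And>D. m < card D \<Longrightarrow> mor D \<subseteq> gmor D" and m: "m < card (norm X)"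
  shows "controlled X"
proof (rule controlledI)
  fix R \<phi> assume XR: "X \<subseteq> R" and RN: "R \<subseteq> norm X" and \<phi>: "\<phi> \<in> mor R" and \<phi>X: "\<phi> ` X = X"
  let ?N = "norm X"
  have R: "subgroup R P" using mor_sub[OF \<phi>] .
  have N: "subgroup ?N P" using norm_sub[OF X] .
  have XN: "X \<subseteq> ?N" using XR RN by blast
  have \<alpha>g: "\<alpha> \<in> gmor ?N" using big[OF m] \<alpha> by blast
  have "card (\<alpha> ` ?N) = card ?N" using ihom_card[OF mor_ihom[OF \<alpha>] order_refl] .
  then have \<alpha>ig: "finv ?N \<alpha> \<in> gmor (\<alpha> ` ?N)" using big[of "\<alpha> ` ?N"] finv_mor[OF \<alpha>] m by auto
  have \<phi>R: "\<phi> ` R \<subseteq> ?N"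
    using ihom_norm[OF R mor_ihom[OF \<phi>] X XR] RN \<phi>X by auto
  define \<rho> where "\<rho> = restrict \<alpha> R"
  have \<rho>: "\<rho> \<in> gmor R" unfolding \<rho>_def using gmor_restrict[OF \<alpha>g R RN] .
  have \<rho>m: "\<rho> \<in> mor R" using \<rho> G_F by blast
  have \<rho>a: "\<rho> x = \<alpha> x" if "x \<in> R" for x unfolding \<rho>_def using that by simp
  have \<rho>i: "\<rho> ` Z = \<alpha> ` Z" if "Z \<subseteq> R" for Z unfolding \<rho>_def using restrict_img[OF that] .
  define \<beta> where "\<beta> = compose (\<rho> ` R) \<alpha> (compose (\<rho> ` R) \<phi> (finv R \<rho>))"
  have 1: "compose (\<rho> ` R) \<phi> (finv R \<rho>) \<in> mor (\<rho> ` R)"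
    using mor_compose[OF finv_mor[OF \<rho>m] \<phi>] finv_img[OF \<rho>m order_refl] by simp
  have "compose (\<rho> ` R) \<phi> (finv R \<rho>) ` \<rho> ` R = \<phi> ` R"
    unfolding compose_img[OF order_refl] using finv_img[OF \<rho>m order_refl] by simp
  then have \<beta>: "\<beta> \<in> mor (\<rho> ` R)" unfolding \<beta>_def using mor_compose[OF 1 \<alpha>] \<phi>R by simp
  have \<beta>a: "\<beta> (\<rho> x) = \<alpha> (\<phi> x)" if "x \<in> R" for x
    unfolding \<beta>_def using that finv_left[OF \<rho>m that] by (simp add: compose_def)
  have \<beta>i: "\<beta> ` \<rho> ` Z = \<alpha> ` \<phi> ` Z" if "Z \<subseteq> R" for Z
    using \<beta>a that by (force simp: image_iff subset_iff)
  have "\<beta> \<in> gmor (\<rho> ` R)"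
  proof -
    have s1: "\<alpha> ` X \<subseteq> \<rho> ` R" using \<rho>i[OF order_refl] XR by blast
    have s2: "\<rho> ` R \<subseteq> norm (\<alpha> ` X)"
    proof
      fix y assume "y \<in> \<rho> ` R"
      then obtain x where x: "x \<in> R" "y = \<alpha> x" using \<rho>i[OF order_refl] by blast
      then show "y \<in> norm (\<alpha> ` X)" using ihom_norm[OF N mor_ihom[OF \<alpha>] X XN, of x] RN by blast
    qed
    have "\<beta> ` \<alpha> ` X = \<alpha> ` X" using \<beta>i[OF XR] \<rho>i[OF XR] \<phi>X by simp
    then show ?thesis by (rule controlledD[OF c s1 s2 \<beta>])
  qed
  then have 2: "compose R \<beta> \<rho> \<in> gmor R" using gmor_compose[OF \<rho>] by blast
  have "compose R \<beta> \<rho> ` R = \<alpha> ` \<phi> ` R" unfolding compose_img[OF order_refl] using \<beta>i[OF order_refl] .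
  then have 3: "compose R (finv ?N \<alpha>) (compose R \<beta> \<rho>) \<in> gmor R"
    using gmor_compose[OF 2 \<alpha>ig] \<phi>R by blast
  moreover have "compose R (finv ?N \<alpha>) (compose R \<beta> \<rho>) = \<phi>"
  proof (rule mor_ext[OF _ \<phi>])
    show "compose R (finv ?N \<alpha>) (compose R \<beta> \<rho>) \<in> mor R" using 3 G_F by blast
    fix x assume x: "x \<in> R"
    then have "\<phi> x \<in> ?N" using \<phi>R by blast
    then show "compose R (finv ?N \<alpha>) (compose R \<beta> \<rho>) x = \<phi> x"
      using x \<beta>a[OF x] finv_left[OF \<alpha>] by (simp add: compose_def)
  qed
  ultimately show "\<phi> \<in> gmor R" by simp
qed

lemma cent_image_overgroup:
  assumes W: "subgroup W P" and fn: "fn W" and cW: "cent W \<subseteq> W"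
    and WX: "W \<subseteq> X" and N: "norm W \<subseteq> norm X"
    and \<alpha>: "\<alpha> \<in> mor (norm X)"
  shows "cent (\<alpha> ` X) \<subseteq> \<alpha> ` X"
proof -
  have "cent (\<alpha> ` X) \<subseteq> cent (\<alpha> ` W)" using WX by (intro cent_mono image_mono)
  also have "\<dots> \<subseteq> \<alpha> ` W" using fn_transport(1)[OF W fn cW \<alpha> N] .
  also have "\<dots> \<subseteq> \<alpha> ` X" using WX by blast
  finally show ?thesis .
qed

text \<open>Here the descent ends: J(P) lies in \<open>W\<close> and so equals \<open>J W\<close>,
  which every morphism stabilizing \<open>W\<close> preserves.\<close>

lemma gmor_normal_thompson:
  assumes W: "subgroup W P" and T: "power_cent W \<subseteq> W" and nP: "norm W = carrier P"
    and WR: "W \<subseteq> R" and \<phi>: "\<phi> \<in> mor R" and \<phi>W: "\<phi> ` W = W"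
  shows "\<phi> \<in> gmor R"
proof -
  have JW: "J (carrier P) \<subseteq> W" using J_norm_subset[OF W T] nP by simp
  have e: "J W = thompson P" using J_eqI[OF carrier_sub sub_subset[OF W] JW] J_carrier by simp
  have "\<phi> ` J W = J W" using ihom_J[OF mor_sub[OF \<phi>] mor_ihom[OF \<phi>] W WR] \<phi>W by simp
  then show ?thesis using gmor_thompson[OF \<phi>] J_sub(2)[OF W] WR e by auto
qed

text \<open>The normalizer of \<open>W\<close> is controlled through that of a characteristic overgroup or subgroup \<open>X\<close> of \<open>W\<close>
  with a larger normalizer or the same normalizer and larger order: \<open>X = power_cent W\<close> if this
  differs from \<open>W\<close>, and \<open>X = J(W) = J(N(W))\<close> otherwise.\<close>

lemma centric_controlled:
  assumes big: "\<And>D. m < card D \<Longrightarrow> mor D \<subseteq> gmor D"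
    and "subgroup W P" "fn W" "cent W \<subseteq> W" "m < card (norm W)"
  shows "controlled W"
  using assms(2-)
\<comment> \<open>A lexicographic measure: the normalizer grows, or it keeps its order while the
  subgroup grows. The normalizer comes first because \<open>J W\<close> may be smaller than
  \<open>W\<close>.\<close>
proof (induction W rule: wf_induct_rule[OF wf_measures[of "[\<lambda>W. card (carrier P) - card (norm W), \<lambda>W. card (carrier P) - card W]"]])
  case (1 W)
  note W = "1.prems"(1) and fn = "1.prems"(2) and cW = "1.prems"(3) and m = "1.prems"(4)
  have le_P: "card Q \<le> card (carrier P)" if "subgroup Q P" for Q
    using card_mono[OF finite_carrier sub_subset[OF that]] .
  have N: "subgroup (norm W) P" using norm_sub[OF W] .
  \<comment> \<open>\<open>X\<close> need not be fully normalized, so the induction hypothesis is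
    applied to a fully normalized image, reached by a morphism on \<open>norm X\<close>. The
    normalizer of the image is at least as large, so the measure still decreases.\<close>
  have step: "controlled X"
    if X: "subgroup X P" and NX: "norm W \<subseteq> norm X"
      and lt: "card (norm W) < card (norm X) \<or> card W < card X"
      and cX: "\<And>\<alpha>. \<alpha> \<in> mor (norm X) \<Longrightarrow> cent (\<alpha> ` X) \<subseteq> \<alpha> ` X"
    for X
  proof -
    have nX: "subgroup (norm X) P" using norm_sub[OF X] .
    obtain \<beta> where \<beta>: "\<beta> \<in> mor X" "fn (\<beta> ` X)" using fn_representative[OF X] .
    obtain \<alpha> where \<alpha>: "\<alpha> \<in> mor (norm X)" "\<alpha> ` X = \<beta> ` X" using extend_to_norm[OF \<beta>] .
    have XnX: "X \<subseteq> norm X" using sub_norm[OF X] .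
    let ?X = "\<alpha> ` X"
    have X': "subgroup ?X P" using mor_img_sub[OF \<alpha>(1) X XnX] .
    have fnX: "fn ?X" using \<alpha>(2) \<beta>(2) by simp
    have nX': "subgroup (norm ?X) P" using norm_sub[OF X'] .
    have "\<alpha> ` norm X \<subseteq> norm ?X"
      using ihom_norm[OF nX mor_ihom[OF \<alpha>(1)] X XnX] by blast
    then have "card (\<alpha> ` norm X) \<le> card (norm ?X)" using card_mono[OF finite_sub[OF nX']] by blast
    then have c1: "card (norm X) \<le> card (norm ?X)" using ihom_card[OF mor_ihom[OF \<alpha>(1)] order_refl] by simp
    have c2: "card (norm W) \<le> card (norm X)" using card_mono[OF finite_sub[OF nX] NX] .
    have c3: "card ?X = card X" using ihom_card[OF mor_ihom[OF \<alpha>(1)] XnX] .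
    have "(?X, W) \<in> measures [\<lambda>W. card (carrier P) - card (norm W), \<lambda>W. card (carrier P) - card W]"
      using lt c1 c2 c3 le_P[OF nX'] le_P[OF X'] by auto
    then have "controlled ?X"
      using "1.IH"[OF _ X' fnX cX[OF \<alpha>(1)]] m c1 c2 by simp
    then show ?thesis using controlled_transport[OF X \<alpha>(1) _ big] m c2 by simp
  qed
  show ?case
  proof (cases "power_cent W \<subseteq> W")
    case T: True
    show ?thesis
    proof (cases "norm W = carrier P")
      case True
      then show ?thesis using gmor_normal_thompson[OF W T] by (intro controlledI)
    next
      case False
      have JW: "J W = J (norm W)"
        using J_eqI[OF N sub_norm[OF W] J_norm_subset[OF W T]] .
      have Js: "subgroup (J W) P" "J W \<subseteq> W" using J_sub[OF W] by auto
      \<comment> \<open>What normalizes \<open>norm W\<close> normalizes \<open>J (norm W)\<close>,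
        which is \<open>J W\<close>; and a proper subgroup such as \<open>norm W\<close> is smaller
        than its own normalizer.\<close>
      have nn: "norm (norm W) \<subseteq> norm (J W)" unfolding JW using norm_subset_norm_J[OF N] .
      have NJ: "norm W \<subseteq> norm (J W)" using sub_norm[OF N] nn by blast
      have "card (norm W) < card (norm (norm W))" using norm_grows_card[OF N False] .
      also have "\<dots> \<le> card (norm (J W))" using card_mono[OF finite_sub[OF norm_sub[OF Js(1)]] nn] .
      finally have lt: "card (norm W) < card (norm (J W))" .
      have "cent (\<alpha> ` J W) \<subseteq> \<alpha> ` J W" if \<alpha>: "\<alpha> \<in> mor (norm (J W))" for \<alpha>
      proof -
        have WN: "W \<subseteq> norm (J W)" using sub_norm[OF W] NJ by blast
        have W': "subgroup (\<alpha> ` W) P" using mor_img_sub[OF \<alpha> W WN] .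
        \<comment> \<open>The condition \<open>power_cent W \<subseteq> W\<close> carries over to
          the image of \<open>W\<close>, so the Thompson subgroup of the image contains its
          centralizer too.\<close>
        have "power_cent (\<alpha> ` W) \<subseteq> \<alpha> ` W" using fn_transport(2)[OF W fn cW \<alpha> NJ] T by blast
        then have "cent (J (\<alpha> ` W)) \<subseteq> J (\<alpha> ` W)" by (rule cent_J_subset[OF W'])
        then show ?thesis using ihom_J[OF mor_sub[OF \<alpha>] mor_ihom[OF \<alpha>] W WN] by simp
      qed
      then have cJ: "controlled (J W)" using step[OF Js(1) NJ] lt by blast
      show ?thesis
      proof (rule controlledI)
        fix R \<phi> assume R: "W \<subseteq> R" "R \<subseteq> norm W" and \<phi>: "\<phi> \<in> mor R" "\<phi> ` W = W"
        have "\<phi> ` J W = J W" using ihom_J[OF mor_sub[OF \<phi>(1)] mor_ihom[OF \<phi>(1)] W R(1)] \<phi>(2) by simp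
        moreover have "J W \<subseteq> R" "R \<subseteq> norm (J W)" using Js(2) R NJ by auto
        ultimately show "\<phi> \<in> gmor R" using controlledD[OF cJ _ _ \<phi>(1)] by blast
      qed
    qed
  next
    case False
    let ?T = "power_cent W"
    note T = power_cent_sub[OF W]
    have "card W < card ?T" using card_sub_lt[OF T(1,2)] False by blast
    moreover have "cent (\<alpha> ` ?T) \<subseteq> \<alpha> ` ?T" if "\<alpha> \<in> mor (norm ?T)" for \<alpha>
      using cent_image_overgroup[OF W fn cW T(2,3) that] .
    ultimately have cT: "controlled ?T" using step[OF T(1) T(3)] by blast
    show ?thesis
    proof (rule controlledI)
      fix R \<phi> assume R: "W \<subseteq> R" "R \<subseteq> norm W" and \<phi>: "\<phi> \<in> mor R" "\<phi> ` W = W"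
      have Rs: "subgroup R P" using mor_sub[OF \<phi>(1)] .
      obtain \<psi> where \<psi>: "\<psi> \<in> mor (?T <#> R)" "\<psi> ` W = W" "\<And>u. u \<in> center_powers W \<Longrightarrow> \<psi> u = \<phi> u"
        using frattini[OF W fn Rs R \<phi>] by blast
      have TY: "?T \<subseteq> ?T <#> R"
        using subgroup.one_closed[OF Rs] sub_carrier[OF T(1)] unfolding set_mult_def by force
      have RY: "R \<subseteq> ?T <#> R"
        using subgroup.one_closed[OF T(1)] sub_carrier[OF Rs] unfolding set_mult_def by force
      have "?T <#> R \<subseteq> norm ?T"
        using R(2) T(3) sub_norm[OF T(1)] subgroup.m_closed[OF norm_sub[OF T(1)]] unfolding set_mult_def by blast
      \<comment> \<open>The extension from the Frattini argument stabilizes \<open>W\<close> and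
        hence \<open>power_cent W\<close>, which is already known to be controlled.\<close>
      then have "\<psi> \<in> gmor (?T <#> R)"
        using controlledD[OF cT TY _ \<psi>(1) power_cent_img[OF W \<psi>(1) TY \<psi>(2)]] by blast
      then show "\<phi> \<in> gmor R" using gmor_frattini[OF W cW R(1) \<phi>(1) _ RY \<psi>(2,3)] by blast
    qed
  qed
qed

section \<open>Generation of automorphisms and then of all morphisms\<close>

lemma aut_generated:
  assumes big: "\<And>D. card Q < card D \<Longrightarrow> mor D \<subseteq> gmor D"
    and Q: "subgroup Q P" and fn: "fn Q" and ne: "Q \<noteq> carrier P"
  shows "F Q Q \<subseteq> gmor Q"
proof
  fix \<theta> assume \<theta>F: "\<theta> \<in> F Q Q"
  have \<theta>: "\<theta> \<in> mor Q" "\<theta> ` Q = Q" using F_mor[OF \<theta>F] aut_img[OF \<theta>F] by auto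
  show "\<theta> \<in> gmor Q"
  proof (cases "cent Q \<subseteq> Q")
    case True
    have "controlled Q"
      using centric_controlled[OF big Q fn True] norm_grows_card[OF Q ne] by blast
    then show ?thesis using controlledD[OF _ order_refl sub_norm[OF Q] \<theta>] by blast
  next
    case False
    let ?R = "Q <#> cent Q"
    have C: "subgroup (cent Q) P" using cent_sub[OF sub_subset[OF Q]] .
    have R: "subgroup ?R P" using set_mult_sub[OF Q C cent_norm[OF Q]] .
    have RN: "?R \<subseteq> norm Q"
      using sub_norm[OF Q] cent_norm[OF Q] subgroup.m_closed[OF norm_sub[OF Q]] unfolding set_mult_def by blast
    have QR: "Q \<subseteq> ?R"
      using subgroup.one_closed[OF C] sub_carrier[OF Q] unfolding set_mult_def by force
    have CR: "cent Q \<subseteq> ?R"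
      using subgroup.one_closed[OF Q] sub_carrier[OF C] unfolding set_mult_def by force
    \<comment> \<open>An element of \<open>cent Q\<close> acts trivially on \<open>Q\<close>, so
      \<open>x\<close> induces the same automorphism as its factor \<open>q\<close>, and
      \<open>\<theta>\<close> carries this to conjugation by \<open>\<theta> q\<close>. Hence
      \<open>\<theta>\<close> extends to \<open>Q <#> cent Q\<close>, which is larger than
      \<open>Q\<close> in this case.\<close>
    have "\<exists>y\<in>norm (\<theta> ` Q). \<forall>z\<in>Q. \<theta> (x \<otimes> z \<otimes> inv x) = y \<otimes> \<theta> z \<otimes> inv y" if x: "x \<in> ?R" for x
    proof -
      obtain q c where qc: "q \<in> Q" "c \<in> cent Q" "x = q \<otimes> c" using x unfolding set_mult_def by blast
      have cc: "q \<in> carrier P" "c \<in> carrier P" using qc sub_carrier[OF Q] sub_carrier[OF C] by auto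
      have "\<theta> (x \<otimes> z \<otimes> inv x) = \<theta> q \<otimes> \<theta> z \<otimes> inv (\<theta> q)" if z: "z \<in> Q" for z
      proof -
        have zc: "z \<in> carrier P" using sub_carrier[OF Q z] .
        have "c \<otimes> z \<otimes> inv c = z" using conj_eq_iff[of c z z] cent_comm[OF qc(2) z] cc zc by simp
        moreover have "x \<otimes> z \<otimes> inv x = q \<otimes> (c \<otimes> z \<otimes> inv c) \<otimes> inv q"
          using qc(3) cc zc by (simp add: m_assoc inv_mult_group)
        ultimately have "x \<otimes> z \<otimes> inv x = q \<otimes> z \<otimes> inv q" by simp
        then show ?thesis using ihom_conj[OF Q mor_ihom[OF \<theta>(1)] qc(1) z] by simp
      qed
      moreover have "\<theta> q \<in> norm (\<theta> ` Q)" using \<theta>(2) qc(1) sub_norm[OF Q] by auto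
      ultimately show ?thesis by blast
    qed
    then obtain \<psi> where \<psi>: "\<psi> \<in> mor ?R" "\<forall>z\<in>Q. \<psi> z = \<theta> z"
      using mor_extend[OF \<theta>(1) _ R RN QR] fn \<theta>(2) by auto
    have "card Q < card ?R" using card_sub_lt[OF R QR] CR False by blast
    then have "\<psi> \<in> gmor ?R" using big \<psi>(1) by blast
    then have g: "restrict \<psi> Q \<in> gmor Q" using gmor_restrict Q QR by blast
    have "restrict \<psi> Q = \<theta>"
      by (rule mor_ext[OF _ \<theta>(1)]) (use g G_F \<psi>(2) in auto)
    then show ?thesis using g by simp
  qed
qed

text \<open>The factorization behind Alperin's theorem: \<open>Q\<close> and its image are moved to
  a common fully normalized subgroup by morphisms on their normalizers. Those domains are larger
  than \<open>Q\<close>, so only an automorphism of that subgroup remains.\<close>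

lemma mor_generated: "mor Q \<subseteq> gmor Q"
proof (induction "card (carrier P) - card Q" arbitrary: Q rule: less_induct)
  case (less Q)
  show ?case
  proof
    fix \<phi> assume \<phi>: "\<phi> \<in> mor Q"
    have Q: "subgroup Q P" using mor_sub[OF \<phi>] .
    have big: "mor D \<subseteq> gmor D" if "card Q < card D" for D
    proof
      fix \<theta> assume \<theta>: "\<theta> \<in> mor D"
      have "card D \<le> card (carrier P)" using card_mono[OF finite_carrier sub_subset[OF mor_sub[OF \<theta>]]] .
      then have "card (carrier P) - card D < card (carrier P) - card Q" using that by linarith
      then show "\<theta> \<in> gmor D" using less \<theta> by blast
    qed
    show "\<phi> \<in> gmor Q"
    proof (cases "Q = carrier P")
      case True
      have \<phi>P: "\<phi> \<in> F (carrier P) (carrier P)" using \<phi> True by simp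
      \<comment> \<open>\<open>P\<close> has no larger normalizer to pass to, but its automorphisms
        preserve J(P) and so belong to the normalizer system directly.\<close>
      have "\<phi> ` thompson P = thompson P"
        using ihom_J[OF carrier_sub mor_ihom[OF \<phi>P] carrier_sub order_refl] aut_img[OF \<phi>P] J_carrier by simp
      moreover have "thompson P \<subseteq> Q" using J_sub(2)[OF carrier_sub] J_carrier True by simp
      ultimately show ?thesis using gmor_thompson[OF \<phi>] by blast
    next
      case False
      obtain \<beta> where \<beta>: "\<beta> \<in> mor Q" "fn (\<beta> ` Q)" using fn_representative[OF Q] .
      let ?S = "\<phi> ` Q" and ?X = "\<beta> ` Q"
      have S: "subgroup ?S P" using mor_img_sub[OF \<phi> Q order_refl] .
      have X: "subgroup ?X P" using mor_img_sub[OF \<beta>(1) Q order_refl] .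
      have cS: "card ?S = card Q" using ihom_card[OF mor_ihom[OF \<phi>] order_refl] .
      have cX: "card ?X = card Q" using ihom_card[OF mor_ihom[OF \<beta>(1)] order_refl] .
      have SP: "?S \<noteq> carrier P" "?X \<noteq> carrier P"
        using cS cX card_sub_lt[OF carrier_sub sub_subset[OF Q] False] by auto
      obtain \<gamma> where \<gamma>: "\<gamma> \<in> mor (norm Q)" "\<gamma> ` Q = ?X" using extend_to_norm[OF \<beta>] .
      define \<beta>' where "\<beta>' = compose ?S \<beta> (finv Q \<phi>)"
      have \<beta>': "\<beta>' \<in> mor ?S"
        unfolding \<beta>'_def using mor_compose[OF finv_mor[OF \<phi>] \<beta>(1)] finv_img[OF \<phi> order_refl] by simp
      have "\<beta>' ` ?S = ?X"
        unfolding \<beta>'_def compose_img[OF order_refl] using finv_img[OF \<phi> order_refl] by simp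
      then obtain \<delta> where \<delta>: "\<delta> \<in> mor (norm ?S)" "\<delta> ` ?S = ?X"
        using extend_to_norm[OF \<beta>'] \<beta>(2) by metis
      have QN: "Q \<subseteq> norm Q" and SN: "?S \<subseteq> norm ?S" using sub_norm Q S by auto
      have \<gamma>g: "\<gamma> \<in> gmor (norm Q)" using big norm_grows_card[OF Q False] \<gamma>(1) by blast
      have "card (\<delta> ` norm ?S) = card (norm ?S)" using ihom_card[OF mor_ihom[OF \<delta>(1)] order_refl] .
      then have \<delta>g: "finv (norm ?S) \<delta> \<in> gmor (\<delta> ` norm ?S)"
        using big[of "\<delta> ` norm ?S"] norm_grows_card[OF S SP(1)] cS finv_mor[OF \<delta>(1)] by auto
      define \<rho> where "\<rho> = restrict \<gamma> Q"
      have \<rho>: "\<rho> \<in> gmor Q" unfolding \<rho>_def using gmor_restrict[OF \<gamma>g Q QN] .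
      have \<rho>m: "\<rho> \<in> mor Q" using \<rho> G_F by blast
      have \<rho>i: "\<rho> ` Q = ?X" unfolding \<rho>_def restrict_img[OF order_refl] using \<gamma>(2) .
      \<comment> \<open>As \<open>\<gamma>\<close> and \<open>\<delta>\<close> end in the same
        subgroup, \<open>\<phi>\<close> becomes an automorphism \<open>\<theta>\<close> of it, and
        is recovered as the inverse of \<open>\<delta>\<close> after \<open>\<theta>\<close> after
        \<open>\<gamma>\<close>.\<close>
      define \<theta> where "\<theta> = compose ?X \<delta> (compose ?X \<phi> (finv Q \<rho>))"
      have f: "finv Q \<rho> \<in> mor ?X" "finv Q \<rho> ` ?X = Q"
        using finv_mor[OF \<rho>m] finv_img[OF \<rho>m order_refl] \<rho>i by auto
      have 1: "compose ?X \<phi> (finv Q \<rho>) \<in> mor ?X" using mor_compose[OF f(1) \<phi>] f(2) by simp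
      have 2: "compose ?X \<phi> (finv Q \<rho>) ` ?X = ?S" unfolding compose_img[OF order_refl] using f(2) by simp
      have "\<theta> \<in> mor ?X" unfolding \<theta>_def using mor_compose[OF 1 \<delta>(1)] 2 SN by simp
      moreover have "\<theta> ` ?X = ?X" unfolding \<theta>_def compose_img[OF order_refl, of ?X \<delta>] using 2 \<delta>(2) by simp
      ultimately have "\<theta> \<in> F ?X ?X" by (rule mor_autI)
      then have \<theta>: "\<theta> \<in> gmor ?X" "\<theta> ` ?X = ?X"
        using aut_generated[OF _ X \<beta>(2) SP(2)] big cX aut_img by auto
      have \<theta>a: "\<theta> (\<rho> x) = \<delta> (\<phi> x)" if x: "x \<in> Q" for x
        using x \<rho>i finv_left[OF \<rho>m x] unfolding \<theta>_def by (auto simp: compose_def)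
      have 3: "compose Q \<theta> \<rho> \<in> gmor Q" using gmor_compose[OF \<rho> \<theta>(1)] \<rho>i by simp
      have 4: "compose Q \<theta> \<rho> ` Q = ?X" unfolding compose_img[OF order_refl] using \<rho>i \<theta>(2) by simp
      have "?X \<subseteq> \<delta> ` norm ?S" using \<delta>(2) SN by blast
      then have 5: "compose Q (finv (norm ?S) \<delta>) (compose Q \<theta> \<rho>) \<in> gmor Q"
        using gmor_compose[OF 3 \<delta>g] 4 by simp
      have "compose Q (finv (norm ?S) \<delta>) (compose Q \<theta> \<rho>) = \<phi>"
      proof (rule mor_ext[OF _ \<phi>])
        show "compose Q (finv (norm ?S) \<delta>) (compose Q \<theta> \<rho>) \<in> mor Q" using 5 G_F by blast
        fix x assume x: "x \<in> Q"
        then have "\<phi> x \<in> norm ?S" using SN by blast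
        then show "compose Q (finv (norm ?S) \<delta>) (compose Q \<theta> \<rho>) x = \<phi> x"
          using x \<theta>a[OF x] finv_left[OF \<delta>(1)] by (simp add: compose_def)
      qed
      then show ?thesis using 5 by simp
    qed
  qed
qed

lemma F_generated: "F Q R \<subseteq> G Q R"
proof
  fix \<phi> assume \<phi>: "\<phi> \<in> F Q R"
  then have "\<phi> \<in> gmor Q" using mor_generated F_mor by blast
  then show "\<phi> \<in> G Q R" using gmor_into F_subgroup[OF \<phi>] F_img[OF \<phi>] by blast
qed

end

theorem theorem1p6:
  fixes P :: "('a, 'b) monoid_scheme" and p :: nat and F :: "'a homs"
  assumes "Factorial_Ring.prime p"
    and "group P"
    and "finite (carrier P)"
    and "\<exists>n. n \<ge> 1 \<and> card (carrier P) = p ^ n"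
    and "saturated_fusion_system P p F"
  shows "generated_subsystem P F
           {C_F P F (agemo1 P p (grp_center P)), N_F P F (thompson P)} = F"
proof -
  obtain n where n: "card (carrier P) = p ^ n" using assms(4) by blast
  interpret fusion P p n F
    using assms n by (simp add: fusion_def fusion_axioms_def finite_p_group_def finite_p_group_axioms_def)
  let ?H = "{C_F P F (agemo1 P p (grp_center P)), N_F P F (thompson P)}"
  have le: "F Q R \<subseteq> G Q R" if "gen_closed P F ?H G" for G Q R
  proof -
    interpret fusion_generation P p n F G by unfold_locales (rule that)
    show ?thesis by (rule F_generated)
  qed
  have "\<Inter>{G Q R | G. gen_closed P F ?H G} = F Q R" for Q R
  proof
    show "\<Inter>{G Q R | G. gen_closed P F ?H G} \<subseteq> F Q R"
      by (rule Inter_lower) (use gen_closed_F in blast)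
    show "F Q R \<subseteq> \<Inter>{G Q R | G. gen_closed P F ?H G}"
      by (rule Inter_greatest) (use le in blast)
  qed
  then show ?thesis unfolding generated_subsystem_def by (intro ext)
qed

end
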